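(* Let $\mathcal{F}$ be a family of meromorphic functions on a domain $D\subseteq\mathbb{C}$. Let $A\subset\mathbb{C}\cup\{\infty\}$, $B\subset\mathbb{C}\setminus\{0\}$ and $C\subset\mathbb{C}\cup\{\infty\}$ be pairwise disjoint finite sets of cardinalities $n$, $s$ and $r$ respectively, write $C=\{c_1,\ldots,c_r\}$, and suppose: (a) All $f\in\mathcal{F}$ share the set $A$, i.e., for every $z_1\in D$ either $f(z_1)\in A$ for all $f\in\mathcal{F}$, or $f(z_1)\notin A$ for all $f\in\mathcal{F}$. (b) For every $b\in B$, every $f\in\mathcal{F}$ and every $z_1\in D$: if $f(z_1)=b$ then $f'(z_1)=b$. (c) If $\infty\in C$, say $c_1=\infty$, then there is an integer $m_1\geq 2$ such that on $D$ every pole of every $f\in\mathcal{F}$ has multiplicity at least $m_1$. For every finite $c_j\in C$ there exist an integer $m_j\geq 2$ and a number $M_j$ such that for every $f\in\mathcal{F}$ and every $z_1\in D$: if $f(z_1)=c_j$ then $|f^{(k)}(z_1)|\leq M_j$ for $k=1,\ldots,m_j-1$. If $$n+s+\sum_{j=1}^{r}\Bigl(1-\frac{1}{m_j}\Bigr)>2,$$ then $\mathcal{F}$ is normal on $D$.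
   Context: A family $\mathcal{F}$ of meromorphic functions on a domain $D$ is normal if every sequence in $\mathcal{F}$ has a subsequence converging spherically uniformly on compact subsets of $D$. $\mathbb{C}^*=\mathbb{C}\setminus\{0\}$. *)

theory Defs
  imports "HOL-Complex_Analysis.Complex_Analysis"
begin

text \<open>Extended complex plane: None represents infinity.
  The value of a (nicely) meromorphic function f at z in the Riemann sphere.\<close>
definition ext_val :: "(complex \<Rightarrow> complex) \<Rightarrow> complex \<Rightarrow> complex option" where
  "ext_val f z = (if is_pole f z then None else Some (f z))"

fun chordal :: "complex option \<Rightarrow> complex option \<Rightarrow> real" where
  "chordal None None = 0"
| "chordal (Some a) None = 2 / sqrt (1 + (norm a)^2)"
| "chordal None (Some b) = 2 / sqrt (1 + (norm b)^2)"
| "chordal (Some a) (Some b) =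
     2 * norm (a - b) / (sqrt (1 + (norm a)^2) * sqrt (1 + (norm b)^2))"

definition normal_family :: "(complex \<Rightarrow> complex) set \<Rightarrow> complex set \<Rightarrow> bool" where
  "normal_family F D \<longleftrightarrow>
     (\<forall>fs. (\<forall>n. fs n \<in> F) \<longrightarrow>
        (\<exists>(r::nat \<Rightarrow> nat) (g::complex \<Rightarrow> complex option). strict_mono r \<and>
           (\<forall>K. compact K \<and> K \<subseteq> D \<longrightarrow>
              (\<forall>e>0. \<exists>N. \<forall>n\<ge>N. \<forall>z\<in>K. chordal (ext_val (fs (r n)) z) (g z) < e))))"

end

theory Submission
  imports Defs
begin

text \<open>
  If the spherical derivatives of the family are not locally bounded, Zalcman's rescaling produces a nonconstant
  meromorphic limit \<open>g\<close> on the plane of functions \<open>f\<^sub>n (a\<^sub>n + \<rho>\<^sub>n \<zeta>)\<close> with \<open>f\<^sub>n\<close> in the family. By Hurwitz-type arguments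
  \<open>g\<close> omits the values in \<open>B\<close>, takes each value \<open>c \<in> C\<close> only with multiplicity at least \<open>m c\<close>, and takes values in \<open>A\<close>
  at one point \<open>\<zeta>\<^sub>0\<close> at most, because two such points would make the \<open>A\<close>-points of a single fixed member of the
  family, shared by all \<open>f\<^sub>n\<close>, accumulate at \<open>lim a\<^sub>n\<close>.
  Replacing \<open>g\<close> by \<open>g (\<zeta>\<^sub>0 + exp w)\<close> removes that point without changing the ramification. The resulting function is
  excluded by a Picard theorem for ramified values: the metric with density
  \<open>\<Prod>\<bar>w - a\<bar> powr -\<alpha>\<^sub>a * (1 + \<bar>w - a\<bar> powr 2\<beta>)\<close>, where \<open>\<alpha>\<^sub>a\<close> is slightly below \<open>1 - 1 / m\<^sub>a\<close> and \<open>\<beta>\<close> is small, has curvature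
  bounded above by a negative constant, and its pullback extends continuously by \<open>0\<close> to all special points, so
  Ahlfors' version of the Schwarz lemma forces it to vanish.
\<close>

section \<open>The Riemann sphere\<close>

text \<open>Condition (b) does not make b-points multiple: as f' = b there and b is nonzero, they
  are simple. Rescaling multiplies derivatives by \<rho>, so a b-point of the limit would be
  multiple although it arises from simple ones; that all of these carry the same derivative \<rho> b
  is what rules it out. Condition (c) only bounds derivatives, but a k-th derivative is multiplied
  by \<rho>^k with k \<ge> 1, so the bounds turn into vanishing derivatives of the limit. The
  exponents lie below 1 - 1 / m for two reasons: the pullback must vanish at special points, so that
  the maximum in the Schwarz lemma falls where a second-order expansion exists, and the curvature
  bound near a cone point needs some room below 1. Omitted values would have exponent 1 and lose a
  little as well. The strict inequality in the hypothesis pays for these losses. Infinity is no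
  exception: maps take values in \<open>complex option\<close>, and inversion is a chordal isometry,
  so local statements are proved where the value is finite and carried over.\<close>

fun stereo :: "complex option \<Rightarrow> complex \<times> real" where
  "stereo None = (0, 1)"
| "stereo (Some a) = ((2 / (1 + (norm a)\<^sup>2)) *\<^sub>R a, ((norm a)\<^sup>2 - 1) / (1 + (norm a)\<^sup>2))"

text \<open>The map w to 1/w on the sphere. It exchanges the two charts and is a chordal isometry,
  which is what transports results from finite values to poles.\<close>

fun sinv :: "complex option \<Rightarrow> complex option" where
  "sinv None = Some 0"
| "sinv (Some a) = (if a = 0 then None else Some (inverse a))"

lemma sinv_sinv [simp]: "sinv (sinv x) = x"
  by (cases x) auto

lemma sinv_eq_iff: "sinv x = y \<longleftrightarrow> x = sinv y"
  by (metis sinv_sinv)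

lemma one_plus_norm_pos [simp]: "0 < 1 + (norm (a::complex))\<^sup>2"
  by (simp add: add_pos_nonneg)

lemma one_plus_norm_neq [simp]: "1 + (norm (a::complex))\<^sup>2 \<noteq> 0"
  using one_plus_norm_pos[of a] by linarith

lemma norm_stereo [simp]: "norm (stereo x) = 1"
proof (cases x)
  case (Some a)
  define t where "t = 1 + (norm a)\<^sup>2"
  have t: "t > 0" "(norm a)\<^sup>2 = t - 1" by (auto simp: t_def)
  have "(norm (stereo x))\<^sup>2 = (2 * norm a / t)\<^sup>2 + ((t - 2) / t)\<^sup>2"
    using Some t by (simp only: norm_Pair stereo.simps real_sqrt_pow2[OF sum_power2_ge_zero] norm_scaleR t_def[symmetric]) (simp add: power_divide power_mult_distrib)
  also have "\<dots> = 1"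
    using t by (simp add: power_divide power_mult_distrib field_simps) (simp add: power2_eq_square algebra_simps)
  finally show ?thesis
    by (metis norm_ge_zero one_power2 power2_eq_iff_nonneg zero_le_one)
qed (simp add: norm_Pair)

text \<open>On the unit sphere both squared distances equal 2 minus twice the inner product. The
  identity imports the metric axioms from Euclidean space and turns sphere-valued maps into bounded
  vector-valued ones, as Arzela-Ascoli requires.\<close>

lemma chordal_stereo: "chordal x y = dist (stereo x) (stereo y)"
proof -
  have sq: "(chordal x y)\<^sup>2 = 2 - 2 * (stereo x \<bullet> stereo y)"
  proof -
    have 1: "(chordal None (Some b))\<^sup>2 = 2 - 2 * (stereo None \<bullet> stereo (Some b))" for b
    proof -
      define t where "t = 1 + (norm b)\<^sup>2"
      have t: "t > 0" "(norm b)\<^sup>2 = t - 1" by (auto simp: t_def)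
      show ?thesis using t by (simp add: power_divide field_simps)
    qed
    have 2: "(chordal (Some a) (Some b))\<^sup>2 = 2 - 2 * (stereo (Some a) \<bullet> stereo (Some b))" for a b
    proof -
      define s where "s = 1 + (norm a)\<^sup>2"
      define t where "t = 1 + (norm b)\<^sup>2"
      have t: "t > 0" "(norm b)\<^sup>2 = t - 1" and s: "s > 0" "(norm a)\<^sup>2 = s - 1" by (auto simp: t_def s_def)
      have d: "(norm (a - b))\<^sup>2 = (norm a)\<^sup>2 + (norm b)\<^sup>2 - 2 * (a \<bullet> b)"
        by (simp add: power2_norm_eq_inner inner_diff_left inner_diff_right inner_commute)
      have "(chordal (Some a) (Some b))\<^sup>2 = 4 * (norm (a - b))\<^sup>2 / (s * t)"
        using s t by (simp add: s_def[symmetric] t_def[symmetric] power_divide power_mult_distrib)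
      also have "\<dots> = 4 * (s + t - 2 - 2 * (a \<bullet> b)) / (s * t)"
        using s t d by simp
      also have "\<dots> = 2 - 2 * (stereo (Some a) \<bullet> stereo (Some b))"
      proof -
        have st: "stereo (Some a) \<bullet> stereo (Some b) = (4 * (a \<bullet> b) + (s - 2) * (t - 2)) / (s * t)"
          using s t by (simp add: add_divide_distrib)
        show ?thesis unfolding st using s(1) t(1) by (simp add: field_simps)
      qed
      finally show ?thesis .
    qed
    have 3: "chordal (Some b) None = chordal None (Some b)" for b by simp
    have 4: "(chordal (Some b) None)\<^sup>2 = 2 - 2 * (stereo (Some b) \<bullet> stereo None)" for b
      using 1[of b] by (simp only: 3 inner_commute[of "stereo (Some b)"])
    have 5: "(chordal None None)\<^sup>2 = 2 - 2 * (stereo None \<bullet> stereo None)" by simp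
    show ?thesis
      by (cases x; cases y; simp only: 1 2 4 5)
  qed
  have "(dist (stereo x) (stereo y))\<^sup>2 = 2 - 2 * (stereo x \<bullet> stereo y)"
    by (simp add: dot_norm_neg dist_norm field_simps)
  with sq have "(chordal x y)\<^sup>2 = (dist (stereo x) (stereo y))\<^sup>2" by simp
  moreover have "chordal x y \<ge> 0" by (cases x; cases y) auto
  ultimately show ?thesis by (simp add: power2_eq_iff_nonneg)
qed

lemma chordal_self [simp]: "chordal x x = 0"
  by (simp add: chordal_stereo)

lemma chordal_nonneg [simp]: "chordal x y \<ge> 0"
  by (simp add: chordal_stereo)

lemma chordal_commute: "chordal x y = chordal y x"
  by (simp add: chordal_stereo dist_commute)

lemma chordal_triangle: "chordal x z \<le> chordal x y + chordal y z"
  by (simp add: chordal_stereo dist_triangle)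

lemma chordal_eq_0_iff [simp]: "chordal x y = 0 \<longleftrightarrow> x = y"
proof -
  have "1 + norm (a::complex) * norm a \<noteq> 0" for a
    using one_plus_norm_neq[of a] by (simp add: power2_eq_square)
  then show ?thesis by (cases x; cases y) (auto simp: power2_eq_square)
qed

lemma chordal_sinv [simp]: "chordal (sinv x) (sinv y) = chordal x y"
proof -
  have s: "sqrt (1 + (inverse (norm a))\<^sup>2) = sqrt (1 + (norm a)\<^sup>2) / norm a" if "a \<noteq> 0" for a :: complex
  proof -
    have "1 + (inverse (norm a))\<^sup>2 = (1 + (norm a)\<^sup>2) / (norm a)\<^sup>2"
      using that by (simp add: field_simps)
    then show ?thesis by (simp add: real_sqrt_divide)
  qed
  have d: "norm (inverse a - inverse b) = norm (a - b) / (norm a * norm b)" if "a \<noteq> 0" "b \<noteq> 0" for a b :: complex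
  proof -
    have "inverse a - inverse b = (b - a) / (a * b)" using that by (simp add: field_simps)
    then show ?thesis by (simp only: norm_divide norm_mult norm_minus_commute[of a b])
  qed
  show ?thesis
    by (cases x; cases y) (auto simp: norm_inverse s d)
qed

text \<open>Limits supplied by Arzela-Ascoli are only known to be unit vectors; this reads them back
  as points of the extended plane. The preimage is the projection \<open>w / (1 - t)\<close> from
  the north pole.\<close>

lemma surj_stereo:
  assumes "norm p = 1" shows "\<exists>x. stereo x = p"
proof (cases "snd p = 1")
  case True
  obtain w t where p: "p = (w, t)" by (cases p)
  have "(norm w)\<^sup>2 + t\<^sup>2 = 1" using assms p by (simp add: norm_Pair real_sqrt_eq_1_iff)
  with True p have "p = (0, 1)" by simp
  then have "stereo None = p" by simp
  then show ?thesis by blast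
next
  case False
  obtain w t where p: "p = (w, t)" by (cases p)
  have wt: "(norm w)\<^sup>2 + t\<^sup>2 = 1" using assms p by (simp add: norm_Pair real_sqrt_eq_1_iff)
  have t1: "t \<le> 1" using wt
    by (metis abs_le_D1 abs_square_le_1 le_add_same_cancel2 zero_le_power2)
  with False p have t: "1 - t > 0" by simp
  define a where "a = (1 / (1 - t)) *\<^sub>R w"
  have na: "(norm a)\<^sup>2 = (1 + t) / (1 - t)"
  proof -
    have "(norm a)\<^sup>2 = (1 - t\<^sup>2) / (1 - t)\<^sup>2"
      using wt t by (simp add: a_def power_divide)
    also have "\<dots> = ((1 + t) * (1 - t)) / ((1 - t) * (1 - t))"
      by (simp add: power2_eq_square algebra_simps)
    also have "\<dots> = (1 + t) / (1 - t)" using t by simp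
    finally show ?thesis .
  qed
  have n1: "1 + (norm a)\<^sup>2 = 2 / (1 - t)" using t by (simp add: na field_simps)
  have n2: "(norm a)\<^sup>2 - 1 = 2 * t / (1 - t)" using t by (simp add: na field_simps)
  have "stereo (Some a) = (w, t)"
    using t unfolding stereo.simps n1 n2 by (simp add: a_def)
  then show ?thesis using p by blast
qed

lemma chordal_Some_le: "chordal (Some a) (Some b) \<le> 2 * norm (a - b)"
proof -
  have "sqrt (1 + (norm a)\<^sup>2) * sqrt (1 + (norm b)\<^sup>2) \<ge> 1 * 1"
    by (intro mult_mono) (auto)
  then show ?thesis
    by (simp add: divide_le_eq) (metis mult_left_mono mult.right_neutral mult.assoc norm_ge_zero mult_nonneg_nonneg zero_le_numeral)
qed

lemma chordal_near_finite:
  assumes "norm b \<le> M" and e: "chordal x (Some b) < 1 / sqrt (1 + M\<^sup>2)"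
  obtains a where "x = Some a" "(norm a)\<^sup>2 \<le> 3 + 4 * M\<^sup>2"
    "norm (a - b) \<le> (1 + M\<^sup>2) * chordal x (Some b)"
proof -
  have M0: "M \<ge> 0" using assms(1) norm_ge_zero order_trans by blast
  define q where "q = sqrt (1 + M\<^sup>2)"
  have q: "q > 0" "q\<^sup>2 = 1 + M\<^sup>2" unfolding q_def by (auto simp: add_pos_nonneg)
  have qb: "sqrt (1 + (norm b)\<^sup>2) \<le> q"
    unfolding q_def using assms(1) by (simp add: power_mono)
  have c: "chordal (Some b) None \<ge> 2 / q"
    using qb by (simp add: frac_le)
  have "2 / q \<le> chordal x (Some b) + chordal x None"
    using c chordal_triangle[of "Some b" None x] by (simp add: chordal_commute)
  then have x: "chordal x None > 1 / q"
    using e by (simp add: q_def[symmetric])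
  then have "x \<noteq> None" using q by (intro notI) simp
  then obtain a where a: "x = Some a" by auto
  have sa: "sqrt (1 + (norm a)\<^sup>2) > 0" by simp
  have "1 / q < 2 / sqrt (1 + (norm a)\<^sup>2)" using x a by simp
  then have qa: "sqrt (1 + (norm a)\<^sup>2) < 2 * q"
    using q sa by (simp add: field_simps)
  then have "(sqrt (1 + (norm a)\<^sup>2))\<^sup>2 \<le> (2 * q)\<^sup>2"
    by (intro power_mono) auto
  then have n: "(norm a)\<^sup>2 \<le> 3 + 4 * M\<^sup>2" using q by (simp add: power_mult_distrib)
  have sb: "sqrt (1 + (norm b)\<^sup>2) > 0" by simp
  have "norm (a - b) = chordal x (Some b) * (sqrt (1 + (norm a)\<^sup>2) * sqrt (1 + (norm b)\<^sup>2)) / 2"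
    using a sa sb by (simp add: less_imp_neq[THEN not_sym])
  also have "\<dots> \<le> chordal x (Some b) * (2 * q * q) / 2"
    using q(1) less_imp_le[OF qa] qb less_imp_le[OF sb] by (intro divide_right_mono mult_left_mono mult_mono) simp_all
  also have "\<dots> = (1 + M\<^sup>2) * chordal x (Some b)"
    using q by (simp add: power2_eq_square)
  finally show ?thesis using that a n by blast
qed

section \<open>Sphere-valued holomorphic maps\<close>

text \<open>The chart may vary from point to point, and the map that is constantly
  \<open>None\<close> qualifies through the inverted chart. Hence the class is closed under locally
  uniform spherical limits, even degenerate ones.\<close>

definition shol :: "(complex \<Rightarrow> complex option) \<Rightarrow> complex set \<Rightarrow> bool" where
  "shol G S \<longleftrightarrow> (\<forall>z\<in>S. \<exists>\<phi>. \<phi> analytic_on {z} \<and>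
     ((\<forall>\<^sub>F w in nhds z. G w = Some (\<phi> w)) \<or> (\<forall>\<^sub>F w in nhds z. sinv (G w) = Some (\<phi> w))))"

text \<open>Defined as a limit of chordal difference quotients, the spherical derivative is visibly invariant
  under \<^const>\<open>sinv\<close>; in a finite chart it is \<open>2 \<bar>\<phi>'\<bar> / (1 + \<bar>\<phi>\<bar>\<^sup>2)\<close>.\<close>

definition sder :: "(complex \<Rightarrow> complex option) \<Rightarrow> complex \<Rightarrow> real" where
  "sder G z = Lim (at z) (\<lambda>w. chordal (G w) (G z) / norm (w - z))"

lemma shol_subset: "shol G S \<Longrightarrow> T \<subseteq> S \<Longrightarrow> shol G T"
  by (auto simp: shol_def)

lemma shol_sing: "shol G S \<longleftrightarrow> (\<forall>z\<in>S. shol G {z})"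
  by (auto simp: shol_def)

lemma sholI:
  assumes "\<phi> analytic_on {z}" "\<forall>\<^sub>F w in nhds z. G w = Some (\<phi> w)"
  shows "shol G {z}"
  using assms by (auto simp: shol_def)

lemma shol_sinv [simp]: "shol (\<lambda>w. sinv (G w)) S \<longleftrightarrow> shol G S"
  by (auto simp: shol_def)

lemma analytic_tendsto:
  assumes "f analytic_on {z}"
  shows "(f \<longlongrightarrow> f z) (nhds z)" "(f \<longlongrightarrow> f z) (at z)"
  using analytic_at_imp_isCont[OF assms] by (simp_all add: isCont_def tendsto_at_iff_tendsto_nhds)

lemma eventually_analytic_notin_finite:
  assumes "f analytic_on {z}" "finite T" "f z \<notin> T"
  shows "\<forall>\<^sub>F w in nhds z. f w \<notin> T"
  using topological_tendstoD[OF analytic_tendsto(1)[OF assms(1)], of "- T"] assms(2,3)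
  by (simp add: finite_imp_closed open_Compl)

text \<open>If only the inverted chart is given, its local function is nonzero at \<open>z\<close>
  because \<open>G z\<close> is finite, and its reciprocal is a finite chart. Thus
  \<open>the (G w)\<close> is a canonical local representative, free of choices.\<close>

lemma shol_chart:
  assumes "shol G {z}" "G z \<noteq> None"
  shows "(\<lambda>w. the (G w)) analytic_on {z}" "\<forall>\<^sub>F w in nhds z. G w = Some (the (G w))"
proof -
  have "\<exists>\<psi>. \<psi> analytic_on {z} \<and> (\<forall>\<^sub>F w in nhds z. G w = Some (\<psi> w))"
  proof -
    obtain \<phi> where \<phi>: "\<phi> analytic_on {z}" and
      c: "(\<forall>\<^sub>F w in nhds z. G w = Some (\<phi> w)) \<or> (\<forall>\<^sub>F w in nhds z. sinv (G w) = Some (\<phi> w))"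
      using assms(1) by (auto simp: shol_def)
    show ?thesis using c
    proof
      assume ev: "\<forall>\<^sub>F w in nhds z. sinv (G w) = Some (\<phi> w)"
      then have "sinv (G z) = Some (\<phi> z)" by (rule eventually_nhds_x_imp_x)
      with assms(2) have nz: "\<phi> z \<noteq> 0" by (auto simp: sinv_eq_iff)
      have "\<forall>\<^sub>F w in nhds z. \<phi> w \<noteq> 0"
        using tendsto_imp_eventually_ne[OF analytic_tendsto(1)[OF \<phi>] nz] .
      with ev have "\<forall>\<^sub>F w in nhds z. G w = Some (inverse (\<phi> w))"
        by eventually_elim (simp add: sinv_eq_iff)
      moreover have "(\<lambda>w. inverse (\<phi> w)) analytic_on {z}"
        using \<phi> nz by (auto intro!: analytic_intros)
      ultimately show ?thesis by blast
    qed (use \<phi> in blast)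
  qed
  then obtain \<psi> where \<psi>: "\<psi> analytic_on {z}" and ev: "\<forall>\<^sub>F w in nhds z. G w = Some (\<psi> w)" by blast
  have "\<forall>\<^sub>F w in nhds z. the (G w) = \<psi> w" using ev by eventually_elim simp
  then show "(\<lambda>w. the (G w)) analytic_on {z}"
    using \<psi> analytic_at_cong[OF _ refl] by simp
  show "\<forall>\<^sub>F w in nhds z. G w = Some (the (G w))"
    using ev by eventually_elim simp
qed

lemma eventually_nhds_analytic:
  assumes "f analytic_on {z}"
  shows "\<forall>\<^sub>F w in nhds z. f analytic_on {w}"
proof -
  obtain s where "open s" "z \<in> s" "f holomorphic_on s"
    using assms analytic_at by blast
  then show ?thesis
    by (auto simp: eventually_nhds intro!: exI[of _ s] holomorphic_on_imp_analytic_at)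
qed

lemma sder_lim_chart:
  assumes "\<phi> analytic_on {z}" "\<forall>\<^sub>F w in nhds z. G w = Some (\<phi> w)"
  shows "((\<lambda>w. chordal (G w) (G z) / norm (w - z)) \<longlongrightarrow> 2 * norm (deriv \<phi> z) / (1 + (norm (\<phi> z))\<^sup>2)) (at z)"
proof -
  have "(\<phi> has_field_derivative deriv \<phi> z) (at z)"
    using assms(1) by (rule analytic_derivI)
  then have 1: "((\<lambda>w. (\<phi> w - \<phi> z) / (w - z)) \<longlongrightarrow> deriv \<phi> z) (at z)"
    by (simp add: has_field_derivative_iff)
  have 2: "(\<phi> \<longlongrightarrow> \<phi> z) (at z)"
    using assms(1) by (rule analytic_tendsto)
  have z: "G z = Some (\<phi> z)" using assms(2) by (rule eventually_nhds_x_imp_x)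
  have "((\<lambda>w. 2 * norm ((\<phi> w - \<phi> z) / (w - z)) / (sqrt (1 + (norm (\<phi> w))\<^sup>2) * sqrt (1 + (norm (\<phi> z))\<^sup>2)))
     \<longlongrightarrow> 2 * norm (deriv \<phi> z) / (sqrt (1 + (norm (\<phi> z))\<^sup>2) * sqrt (1 + (norm (\<phi> z))\<^sup>2))) (at z)"
    by (intro tendsto_intros 1 2) auto
  also have "sqrt (1 + (norm (\<phi> z))\<^sup>2) * sqrt (1 + (norm (\<phi> z))\<^sup>2) = 1 + (norm (\<phi> z))\<^sup>2"
    by simp
  finally show ?thesis
  proof (rule Lim_transform_eventually)
    have "\<forall>\<^sub>F w in at z. G w = Some (\<phi> w)"
      using assms(2) by (auto simp: eventually_at_filter elim: eventually_mono)
    then show "\<forall>\<^sub>F w in at z. 2 * norm ((\<phi> w - \<phi> z) / (w - z)) / (sqrt (1 + (norm (\<phi> w))\<^sup>2) * sqrt (1 + (norm (\<phi> z))\<^sup>2))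
       = chordal (G w) (G z) / norm (w - z)"
      by eventually_elim (simp add: z norm_divide)
  qed
qed

lemma sder_chart:
  assumes "\<phi> analytic_on {z}" "\<forall>\<^sub>F w in nhds z. G w = Some (\<phi> w)"
  shows "sder G z = 2 * norm (deriv \<phi> z) / (1 + (norm (\<phi> z))\<^sup>2)"
  unfolding sder_def by (rule tendsto_Lim[OF _ sder_lim_chart[OF assms]]) simp

lemma sder_sinv [simp]: "sder (\<lambda>w. sinv (G w)) z = sder G z"
  by (simp add: sder_def)

text \<open>At each point \<open>G\<close> or its inversion is finite. A property that passes back
  from \<open>sinv\<close> therefore needs proof in a finite chart only, and poles require no
  separate case.\<close>

lemma shol_induct_chart:
  assumes "shol G {z}"
    and inv: "\<And>G. P (\<lambda>w. sinv (G w)) \<Longrightarrow> P G"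
    and fin: "\<And>G \<phi>. \<phi> analytic_on {z} \<Longrightarrow> \<forall>\<^sub>F w in nhds z. G w = Some (\<phi> w) \<Longrightarrow> P G"
  shows "P G"
proof (cases "G z = None")
  case True
  then have "shol (\<lambda>w. sinv (G w)) {z}" "sinv (G z) \<noteq> None" using assms(1) by auto
  show ?thesis by (rule inv, rule fin, rule shol_chart, fact+, rule shol_chart, fact+)
next
  case False
  show ?thesis by (rule fin[OF shol_chart[OF assms(1) False]])
qed

lemma sder_lim:
  assumes "shol G {z}"
  shows "((\<lambda>w. chordal (G w) (G z) / norm (w - z)) \<longlongrightarrow> sder G z) (at z)"
  using assms
proof (rule shol_induct_chart)
  fix G \<phi> assume "\<phi> analytic_on {z}" "\<forall>\<^sub>F w in nhds z. G w = Some (\<phi> w)"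
  from sder_lim_chart[OF this] sder_chart[OF this]
  show "((\<lambda>w. chordal (G w) (G z) / norm (w - z)) \<longlongrightarrow> sder G z) (at z)" by simp
qed simp

lemma sder_nonneg: assumes "shol G {z}" shows "sder G z \<ge> 0"
  by (rule tendsto_lowerbound[OF sder_lim[OF assms]]) auto

lemma isCont_sder:
  assumes "shol G {z}"
  shows "isCont (sder G) z"
  using assms
proof (rule shol_induct_chart)
  fix G \<phi> assume a: "\<phi> analytic_on {z}" and ev: "\<forall>\<^sub>F w in nhds z. G w = Some (\<phi> w)"
  have "\<forall>\<^sub>F w in nhds z. \<forall>\<^sub>F x in nhds w. G x = Some (\<phi> x)"
    using ev by (simp add: eventually_eventually)
  with eventually_nhds_analytic[OF a]
  have "\<forall>\<^sub>F w in nhds z. sder G w = 2 * norm (deriv \<phi> w) / (1 + (norm (\<phi> w))\<^sup>2)"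
    by eventually_elim (rule sder_chart)
  then have "isCont (sder G) z \<longleftrightarrow> isCont (\<lambda>w. 2 * norm (deriv \<phi> w) / (1 + (norm (\<phi> w))\<^sup>2)) z"
    by (rule isCont_cong)
  moreover have "isCont (\<lambda>w. 2 * norm (deriv \<phi> w) / (1 + (norm (\<phi> w))\<^sup>2)) z"
    using a by (intro continuous_intros analytic_at_imp_isCont analytic_deriv) auto
  ultimately show "isCont (sder G) z" by simp
qed (simp add: sder_def)

lemma shol_tendsto_chordal:
  assumes "shol G {z}"
  shows "((\<lambda>w. chordal (G w) (G z)) \<longlongrightarrow> 0) (nhds z)"
proof -
  have "((\<lambda>w. chordal (G w) (G z) / norm (w - z) * norm (w - z)) \<longlongrightarrow> sder G z * norm (z - z)) (at z)"
    by (intro tendsto_intros sder_lim assms)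
  then have "((\<lambda>w. chordal (G w) (G z) / norm (w - z) * norm (w - z)) \<longlongrightarrow> chordal (G z) (G z)) (at z)"
    by simp
  then have "((\<lambda>w. chordal (G w) (G z)) \<longlongrightarrow> chordal (G z) (G z)) (at z)"
    by (rule Lim_transform_eventually) (auto simp: eventually_at_filter)
  then show ?thesis using tendsto_at_iff_tendsto_nhds[of "\<lambda>w. chordal (G w) (G z)" z] by simp
qed

lemma shol_compose:
  assumes "h analytic_on {z}" "shol G {h z}"
  shows "shol (\<lambda>w. G (h w)) {z}" "sder (\<lambda>w. G (h w)) z = norm (deriv h z) * sder G (h z)"
proof -
  have ev: "\<forall>\<^sub>F w in nhds z. P (h w)" if "\<forall>\<^sub>F w in nhds (h z). P w" for P
    using eventually_compose_filterlim[OF that analytic_tendsto(1)[OF assms(1)]] .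
  have "shol (\<lambda>w. G (h w)) {z} \<and> sder (\<lambda>w. G (h w)) z = norm (deriv h z) * sder G (h z)"
    using assms(2)
  proof (rule shol_induct_chart)
    fix G assume "shol (\<lambda>w. sinv (G (h w))) {z} \<and> sder (\<lambda>w. sinv (G (h w))) z = norm (deriv h z) * sder (\<lambda>w. sinv (G w)) (h z)"
    then show "shol (\<lambda>w. G (h w)) {z} \<and> sder (\<lambda>w. G (h w)) z = norm (deriv h z) * sder G (h z)"
      by simp
  next
    fix G \<phi> assume a: "\<phi> analytic_on {h z}" "\<forall>\<^sub>F w in nhds (h z). G w = Some (\<phi> w)"
    have 1: "(\<lambda>w. \<phi> (h w)) analytic_on {z}"
      using analytic_on_compose[of h "{z}" \<phi>] assms(1) a(1) by (simp add: o_def)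
    have 2: "\<forall>\<^sub>F w in nhds z. G (h w) = Some (\<phi> (h w))" using ev[OF a(2)] .
    have 3: "deriv (\<lambda>w. \<phi> (h w)) z = deriv \<phi> (h z) * deriv h z"
      using deriv_chain[of h z \<phi>] assms(1) a(1) by (simp add: o_def analytic_on_imp_differentiable_at)
    show "shol (\<lambda>w. G (h w)) {z} \<and> sder (\<lambda>w. G (h w)) z = norm (deriv h z) * sder G (h z)"
      using sholI[OF 1 2] sder_chart[OF 1 2] sder_chart[OF a] 3 by (simp add: norm_mult)
  qed
  then show "shol (\<lambda>w. G (h w)) {z}" "sder (\<lambda>w. G (h w)) z = norm (deriv h z) * sder G (h z)"
    by auto
qed

text \<open>A mean value inequality obtained by bisection: close to each point of the segment the
  difference quotient is below \<open>M + e\<close>, and the estimate is additive over adjacent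
  intervals, so its local validity gives the global one. Then \<open>e\<close> tends to 0.\<close>

lemma chordal_le_sder:
  assumes G: "shol G S" and M: "\<And>z. z \<in> S \<Longrightarrow> sder G z \<le> M" and seg: "closed_segment x y \<subseteq> S"
  shows "chordal (G x) (G y) \<le> M * norm (x - y)"
proof (cases "x = y")
  case False
  define L where "L = norm (y - x)"
  have L: "L > 0" using False by (simp add: L_def)
  define p where "p = (\<lambda>t::real. x + t *\<^sub>R (y - x))"
  have pS: "p t \<in> S" if "0 \<le> t" "t \<le> 1" for t
    using seg that by (force simp: p_def closed_segment_def algebra_simps)
  have pd: "norm (p s - p t) = \<bar>s - t\<bar> * L" for s t
  proof -
    have "p s - p t = (s - t) *\<^sub>R (y - x)" by (simp add: p_def algebra_simps)
    then show ?thesis by (simp add: L_def)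
  qed
  have "chordal (G (p 0)) (G (p 1)) \<le> (M + e) * L * (1 - 0)" if "e > 0" for e
  proof (rule Bolzano[where P = "\<lambda>a b. chordal (G (p a)) (G (p b)) \<le> (M + e) * L * (b - a)" and a = 0 and b = 1])
    fix a b c :: real
    assume "chordal (G (p a)) (G (p b)) \<le> (M + e) * L * (b - a)" "chordal (G (p b)) (G (p c)) \<le> (M + e) * L * (c - b)"
    then have "chordal (G (p a)) (G (p c)) \<le> (M + e) * L * (b - a) + (M + e) * L * (c - b)"
      using chordal_triangle[of "G (p a)" "G (p c)" "G (p b)"] by linarith
    then show "chordal (G (p a)) (G (p c)) \<le> (M + e) * L * (c - a)" by (simp add: algebra_simps)
  next
    fix t :: real assume 3: "0 \<le> t" "t \<le> 1"
    have "shol G {p t}" using G pS[OF 3] by (auto simp: shol_def)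
    from sder_lim[OF this] have "\<forall>\<^sub>F w in at (p t). chordal (G w) (G (p t)) / norm (w - p t) < M + e"
      by (rule order_tendstoD) (use M[OF pS[OF 3]] \<open>e > 0\<close> in linarith)
    then obtain d where d: "d > 0" "\<And>w. w \<noteq> p t \<Longrightarrow> dist w (p t) < d \<Longrightarrow> chordal (G w) (G (p t)) / norm (w - p t) < M + e"
      by (auto simp: eventually_at)
    have key: "chordal (G (p s)) (G (p t)) \<le> (M + e) * L * \<bar>s - t\<bar>" if "\<bar>s - t\<bar> < d / L" for s
    proof (cases "s = t")
      case False
      then have "norm (p s - p t) > 0" using L by (simp add: pd)
      moreover have "dist (p s) (p t) < d" using that L by (simp add: dist_norm pd pos_less_divide_eq)
      ultimately have "chordal (G (p s)) (G (p t)) / norm (p s - p t) < M + e"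
        using d(2)[of "p s"] by auto
      with \<open>norm (p s - p t) > 0\<close> have "chordal (G (p s)) (G (p t)) < (M + e) * norm (p s - p t)"
        by (simp add: divide_less_eq)
      then show ?thesis by (simp add: pd mult_ac)
    qed simp
    show "\<exists>d>0. \<forall>a b. a \<le> t \<and> t \<le> b \<and> b - a < d \<longrightarrow> chordal (G (p a)) (G (p b)) \<le> (M + e) * L * (b - a)"
    proof (intro exI[of _ "d / L"] conjI allI impI)
      show "d / L > 0" using d L by simp
      fix a b assume ab: "a \<le> t \<and> t \<le> b \<and> b - a < d / L"
      have "chordal (G (p a)) (G (p b)) \<le> (M + e) * L * (t - a) + (M + e) * L * (b - t)"
        using chordal_triangle[of "G (p a)" "G (p b)" "G (p t)"] key[of a] key[of b] ab
        by (simp add: chordal_commute[of "G (p t)"])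
      then show "chordal (G (p a)) (G (p b)) \<le> (M + e) * L * (b - a)" by (simp add: algebra_simps)
    qed
  qed simp
  then have "chordal (G x) (G y) \<le> M * L + e" if "e > 0" for e
    using that[THEN divide_pos_pos, OF L] L by (force simp: p_def algebra_simps)
  then show ?thesis
    by (metis L_def field_le_epsilon norm_minus_commute)
qed simp

section \<open>Marty's criterion and locally uniform limits\<close>

text \<open>The sufficient half of Marty's criterion: derivative bounds give equicontinuity,
  Arzela-Ascoli gives limits on compact sets, and a diagonal sequence serves a whole exhaustion.
  Holomorphy and bound are demanded only for large \<open>n\<close>, depending on \<open>K\<close>,
  because rescaled functions are controlled on a fixed compact set only eventually.\<close>

lemma sder_bounded_imp_convergent_subsequence:
  fixes H :: "nat \<Rightarrow> complex \<Rightarrow> complex option"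
  assumes S: "open S"
    and bd: "\<And>K. compact K \<Longrightarrow> K \<subseteq> S \<Longrightarrow> \<exists>N M. \<forall>n\<ge>N. shol (H n) K \<and> (\<forall>z\<in>K. sder (H n) z \<le> M)"
  obtains k :: "nat \<Rightarrow> nat" and g where "strict_mono k"
    "\<And>K e. compact K \<Longrightarrow> K \<subseteq> S \<Longrightarrow> e > 0 \<Longrightarrow> \<exists>N. \<forall>n\<ge>N. \<forall>z\<in>K. chordal (H (k n) z) (g z) < e"
proof -
  obtain C where C: "\<And>n. compact (C n)" "\<And>n. C n \<subseteq> S" "\<And>n. C n \<subseteq> interior (C (Suc n))"
     "\<Union>(range C) = S" "\<And>K. \<lbrakk>compact K; K \<subseteq> S\<rbrakk> \<Longrightarrow> \<exists>N. \<forall>n\<ge>N. K \<subseteq> (C n)"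
    using open_Union_compact_subsets[OF S] by metis
  \<comment> \<open>Bounds are taken on \<open>C (Suc i)\<close>, whose interior contains
    \<open>C i\<close>: segments joining nearby points of \<open>C i\<close> may leave
    \<open>C i\<close>.\<close>
  have "\<forall>i. \<exists>N M. \<forall>n\<ge>N. shol (H n) (C (Suc i)) \<and> (\<forall>z\<in>C (Suc i). sder (H n) z \<le> M)"
    by (intro allI bd C)
  then obtain Nf Mf where NM: "\<And>i n. n \<ge> Nf i \<Longrightarrow> shol (H n) (C (Suc i))"
     "\<And>i n z. n \<ge> Nf i \<Longrightarrow> z \<in> C (Suc i) \<Longrightarrow> sder (H n) z \<le> Mf i" by metis
  define P where "P = (\<lambda>i (r :: nat \<Rightarrow> nat). \<exists>g. \<forall>e>0. \<exists>N. \<forall>n\<ge>N. \<forall>z\<in>C i. r n \<ge> Nf i \<longrightarrow> norm (stereo (H (r n) z) - g z) < e)"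
  obtain k :: "nat \<Rightarrow> nat" where k: "strict_mono k" "\<And>i. P i (id \<circ> k)"
  proof (rule subsequence_diagonalization_lemma[of P id])
    fix i and r :: "nat \<Rightarrow> nat"
    \<comment> \<open>Members too early to be controlled on \<open>C (Suc i)\<close> are replaced by
      the constant unit vector \<open>(0, 1)\<close>, so that equicontinuity holds for every
      index.\<close>
    define F where "F = (\<lambda>n z. if r n \<ge> Nf i then stereo (H (r n) z) else (0, 1))"
    have eq: "\<exists>d>0. \<forall>n y. y \<in> C i \<and> norm (x - y) < d \<longrightarrow> norm (F n x - F n y) < e"
      if x: "x \<in> C i" "e > 0" for x e
    proof -
      obtain d where d: "d > 0" "ball x d \<subseteq> C (Suc i)"
        using x C(3) by (meson mem_interior subsetD)
      define M where "M = max 1 (Mf i)"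
      have M: "M > 0" by (simp add: M_def)
      show ?thesis
      proof (intro exI[of _ "min d (e / M)"] conjI allI impI)
        show "min d (e / M) > 0" using d x M by simp
        fix n y assume y: "y \<in> C i \<and> norm (x - y) < min d (e / M)"
        show "norm (F n x - F n y) < e"
        proof (cases "r n \<ge> Nf i")
          case True
          have "chordal (H (r n) x) (H (r n) y) \<le> M * norm (x - y)"
          proof (rule chordal_le_sder[where S = "ball x d"])
            show "shol (H (r n)) (ball x d)" using NM(1)[OF True] d shol_subset by blast
            show "sder (H (r n)) z \<le> M" if "z \<in> ball x d" for z
              using NM(2)[OF True, of z] d that by (auto simp: M_def)
            show "closed_segment x y \<subseteq> ball x d"
              using y d by (intro closed_segment_subset) (auto simp: dist_norm)
          qed
          also have "\<dots> < e" using y M by (simp add: pos_less_divide_eq mult.commute)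
          finally show ?thesis using True by (simp add: F_def chordal_stereo dist_norm)
        qed (use x in \<open>simp add: F_def\<close>)
      qed
    qed
    obtain g q where "continuous_on (C i) g" and q: "strict_mono (q :: nat \<Rightarrow> nat)"
       "\<And>e. 0 < e \<Longrightarrow> \<exists>N. \<forall>n x. n \<ge> N \<and> x \<in> C i \<longrightarrow> norm (F (q n) x - g x) < e"
      by (rule Arzela_Ascoli[of "C i" F 1, OF C(1) _ eq]) (auto simp: F_def norm_Pair)
    have "P i (r \<circ> q)"
      unfolding P_def
    proof (intro exI[of _ g] allI impI)
      fix e :: real assume "e > 0"
      then obtain N where N: "\<forall>n x. n \<ge> N \<and> x \<in> C i \<longrightarrow> norm (F (q n) x - g x) < e" using q(2) by blast
      show "\<exists>N. \<forall>n\<ge>N. \<forall>z\<in>C i. Nf i \<le> (r \<circ> q) n \<longrightarrow> norm (stereo (H ((r \<circ> q) n) z) - g z) < e"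
      proof (intro exI[of _ N] allI impI ballI)
        fix n z assume "n \<ge> N" "z \<in> C i" "Nf i \<le> (r \<circ> q) n"
        then show "norm (stereo (H ((r \<circ> q) n) z) - g z) < e"
          using N[rule_format, of n z] by (simp add: F_def)
      qed
    qed
    with q(1) show "\<exists>k. strict_mono k \<and> P i (r \<circ> k)" by blast
  next
    fix i N and r k1 k2 :: "nat \<Rightarrow> nat"
    assume "P i (r \<circ> k1)" and sub: "\<And>j. N \<le> j \<Longrightarrow> \<exists>j'\<ge>j. k2 j = k1 j'"
    then obtain g where g: "\<forall>e>0. \<exists>N. \<forall>n\<ge>N. \<forall>z\<in>C i. r (k1 n) \<ge> Nf i \<longrightarrow> norm (stereo (H (r (k1 n)) z) - g z) < e"
      by (auto simp: P_def)
    have "\<exists>N. \<forall>n\<ge>N. \<forall>z\<in>C i. r (k2 n) \<ge> Nf i \<longrightarrow> norm (stereo (H (r (k2 n)) z) - g z) < e" if e: "e > 0" for e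
    proof -
      obtain N1 where N1: "\<forall>n\<ge>N1. \<forall>z\<in>C i. r (k1 n) \<ge> Nf i \<longrightarrow> norm (stereo (H (r (k1 n)) z) - g z) < e"
        using g e by blast
      show ?thesis
      proof (intro exI[of _ "max N N1"] allI impI)
        fix n assume n: "n \<ge> max N N1"
        then obtain j where "j \<ge> n" "k2 n = k1 j" using sub[of n] by auto
        then show "\<forall>z\<in>C i. r (k2 n) \<ge> Nf i \<longrightarrow> norm (stereo (H (r (k2 n)) z) - g z) < e"
          using N1 n by auto
      qed
    qed
    then show "P i (r \<circ> k2)" unfolding P_def by auto
  qed (rule that)
  \<comment> \<open>The limits on the different \<open>C i\<close> agree, since each is the
    pointwise limit; a pointwise choice therefore gives one \<open>g\<close> for all of
    them.\<close>
  define g where "g = (\<lambda>z. SOME x. (\<lambda>n. stereo (H (k n) z)) \<longlonglongrightarrow> stereo x)"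
  have main: "\<exists>N. \<forall>n\<ge>N. \<forall>z\<in>C i. chordal (H (k n) z) (g z) < e" if e: "e > 0" for i e
  proof -
    obtain h where h: "\<forall>e>0. \<exists>N. \<forall>n\<ge>N. \<forall>z\<in>C i. k n \<ge> Nf i \<longrightarrow> norm (stereo (H (k n) z) - h z) < e"
      using k(2)[of i] by (auto simp: P_def)
    have h': "\<exists>N. \<forall>n\<ge>N. \<forall>z\<in>C i. norm (stereo (H (k n) z) - h z) < e" if e: "e > 0" for e
    proof -
      obtain N where N: "\<forall>n\<ge>N. \<forall>z\<in>C i. k n \<ge> Nf i \<longrightarrow> norm (stereo (H (k n) z) - h z) < e"
        using h e by blast
      have "k n \<ge> Nf i" if "n \<ge> Nf i" for n
        using seq_suble[OF k(1), of n] that by linarith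
      with N show ?thesis by (intro exI[of _ "max N (Nf i)"]) auto
    qed
    have "h z = stereo (g z)" if z: "z \<in> C i" for z
    proof -
      have l: "(\<lambda>n. stereo (H (k n) z)) \<longlonglongrightarrow> h z"
        unfolding lim_sequentially dist_norm using h' z by blast
      then have "(\<lambda>n. norm (stereo (H (k n) z))) \<longlonglongrightarrow> norm (h z)" by (rule tendsto_norm)
      then have "norm (h z) = 1" by (simp add: LIMSEQ_const_iff)
      then obtain x where "stereo x = h z" using surj_stereo by blast
      with l have "(\<lambda>n. stereo (H (k n) z)) \<longlonglongrightarrow> stereo x" by simp
      then have "(\<lambda>n. stereo (H (k n) z)) \<longlonglongrightarrow> stereo (g z)"
        unfolding g_def by (rule someI)
      with l show ?thesis using LIMSEQ_unique by blast
    qed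
    then show ?thesis using h'[OF e] by (simp add: chordal_stereo dist_norm)
  qed
  show ?thesis
  proof (rule that[of k g])
    fix K and e :: real assume K: "compact K" "K \<subseteq> S" "e > 0"
    then obtain i where "K \<subseteq> C i" using C(5)[OF K(1,2)] by blast
    then show "\<exists>N. \<forall>n\<ge>N. \<forall>z\<in>K. chordal (H (k n) z) (g z) < e"
      using main[OF K(3), of i] by blast
  qed (rule k)
qed

text \<open>Holomorphy is required only from an index depending on the compact set, since rescaled
  functions are known to be holomorphic only on discs that grow with \<open>n\<close>.\<close>

definition sconv :: "(nat \<Rightarrow> complex \<Rightarrow> complex option) \<Rightarrow> (complex \<Rightarrow> complex option) \<Rightarrow> complex set \<Rightarrow> bool" where
  "sconv H g S \<longleftrightarrow> (\<forall>K. compact K \<and> K \<subseteq> S \<longrightarrow> (\<exists>N. \<forall>n\<ge>N. shol (H n) K) \<and>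
     (\<forall>e>0. \<exists>N. \<forall>n\<ge>N. \<forall>z\<in>K. chordal (H n z) (g z) < e))"

lemma sconv_sinv: "sconv H g S \<Longrightarrow> sconv (\<lambda>n w. sinv (H n w)) (\<lambda>w. sinv (g w)) S"
  by (simp add: sconv_def)

text \<open>From spherical to Euclidean convergence near a point where the limit is finite. On a
  small disc \<open>g\<close> and all late \<open>H n\<close> stay in a bounded region, where the
  two distances are comparable; Weierstrass' theorem then makes \<open>g\<close>
  holomorphic.\<close>

lemma sconv_chart:
  assumes S: "open S" and lim: "sconv H g S" and z: "z \<in> S" "g z \<noteq> None"
  obtains d N where "d > 0" "ball z d \<subseteq> S"
    "\<And>n. n \<ge> N \<Longrightarrow> (\<lambda>w. the (H n w)) holomorphic_on ball z d"
    "\<And>n w. n \<ge> N \<Longrightarrow> w \<in> ball z d \<Longrightarrow> H n w = Some (the (H n w))"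
    "\<And>w. w \<in> ball z d \<Longrightarrow> g w = Some (the (g w))"
    "(\<lambda>w. the (g w)) holomorphic_on ball z d"
    "uniform_limit (ball z d) (\<lambda>n w. the (H n w)) (\<lambda>w. the (g w)) sequentially"
proof -
  obtain b where b: "g z = Some b" using z by auto
  obtain d0 where d0: "d0 > 0" "cball z d0 \<subseteq> S" using S z open_contains_cball by blast
  define e0 where "e0 = 1 / sqrt (1 + (norm b)\<^sup>2)"
  have e0: "e0 > 0" by (simp add: e0_def)
  obtain N1 where N1: "\<And>n. n \<ge> N1 \<Longrightarrow> shol (H n) (cball z d0)"
    using lim d0 unfolding sconv_def by (meson compact_cball)
  have cv: "\<exists>N. \<forall>n\<ge>N. \<forall>w\<in>cball z d0. chordal (H n w) (g w) < e" if "e > 0" for e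
    using lim d0 that unfolding sconv_def by (meson compact_cball)
  obtain N2 where N2': "\<forall>n\<ge>N2. \<forall>w\<in>cball z d0. chordal (H n w) (g w) < e0 / 4"
    using cv[of "e0 / 4"] e0 by auto
  note N2 = N2'[rule_format]
  define n0 where "n0 = max N1 N2"
  \<comment> \<open>Continuity of \<open>g\<close> is not yet known; it is borrowed from the single
    function \<open>H n0\<close>, each of three passages costing a quarter of
    \<open>e0\<close>.\<close>
  have "shol (H n0) {z}" using N1[of n0] d0 by (auto simp: n0_def intro: shol_subset)
  from shol_tendsto_chordal[OF this] have "\<forall>\<^sub>F w in nhds z. chordal (H n0 w) (H n0 z) < e0 / 4"
    by (rule order_tendstoD) (use e0 in simp)
  then obtain d1 where d1: "d1 > 0" "\<And>w. dist w z < d1 \<Longrightarrow> chordal (H n0 w) (H n0 z) < e0 / 4"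
    by (auto simp: eventually_nhds_metric)
  define d where "d = min d0 d1"
  have d: "d > 0" "ball z d \<subseteq> cball z d0" using d0 d1 by (auto simp: d_def)
  define M where "M = sqrt (3 + 4 * (norm b)\<^sup>2)"
  have M2: "M\<^sup>2 = 3 + 4 * (norm b)\<^sup>2" unfolding M_def by (subst real_sqrt_pow2) auto
  have M0: "M \<ge> 0" by (simp add: M_def)
  have g: "\<exists>a. g w = Some a \<and> norm a \<le> M" if w: "w \<in> ball z d" for w
  proof -
    have "w \<in> cball z d0" using d w by auto
    have "chordal (g w) (Some b) \<le> chordal (H n0 w) (g w) + chordal (H n0 w) (H n0 z) + chordal (H n0 z) (g z)"
      using chordal_triangle[of "g w" "Some b" "H n0 w"] chordal_triangle[of "H n0 w" "Some b" "H n0 z"] b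
      by (simp add: chordal_commute[of "g w"])
    moreover have "chordal (H n0 w) (g w) < e0 / 4" "chordal (H n0 z) (g z) < e0 / 4"
      using N2[of n0] \<open>w \<in> cball z d0\<close> d0 by (auto simp: n0_def)
    moreover have "chordal (H n0 w) (H n0 z) < e0 / 4"
      using d1 w by (auto simp: d_def dist_commute)
    ultimately have "chordal (g w) (Some b) < e0" using e0 by linarith
    then obtain a where "g w = Some a" "(norm a)\<^sup>2 \<le> 3 + 4 * (norm b)\<^sup>2"
      using chordal_near_finite[of b "norm b" "g w"] unfolding e0_def by auto
    then show ?thesis using M2 M0 power2_le_imp_le[of "norm a" M] by auto
  qed
  define e1 where "e1 = 1 / sqrt (1 + M\<^sup>2)"
  have e1: "e1 > 0" by (simp add: e1_def add_pos_nonneg)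
  have near: "\<exists>a. H n w = Some a \<and> norm (a - the (g w)) \<le> (1 + M\<^sup>2) * chordal (H n w) (g w)"
    if w: "w \<in> ball z d" and c: "chordal (H n w) (g w) < e1" for n w
  proof -
    obtain a where a: "g w = Some a" "norm a \<le> M" using g w by blast
    have "chordal (H n w) (Some a) < 1 / sqrt (1 + M\<^sup>2)" using a c by (simp only: e1_def)
    from chordal_near_finite[OF a(2) this] show ?thesis using a(1) by (metis option.sel)
  qed
  obtain N3 where N3': "\<forall>n\<ge>N3. \<forall>w\<in>cball z d0. chordal (H n w) (g w) < e1"
    using cv[of e1] e1 by auto
  note N3 = N3'[rule_format]
  define N where "N = max N1 N3"
  have some: "H n w = Some (the (H n w))" if "n \<ge> N" "w \<in> ball z d" for n w
    using near[of w n] N3[of n w] that d unfolding N_def by fastforce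
  have holH: "(\<lambda>w. the (H n w)) holomorphic_on ball z d" if n: "n \<ge> N" for n
  proof -
    have "(\<lambda>w. the (H n w)) analytic_on {w}" if "w \<in> ball z d" for w
    proof (rule shol_chart)
      show "shol (H n) {w}" using N1[of n] n d that by (auto simp: N_def intro: shol_subset)
      show "H n w \<noteq> None" using some[OF n that] by auto
    qed
    then show ?thesis using analytic_imp_holomorphic analytic_on_analytic_at by blast
  qed
  have ul: "\<exists>n0. \<forall>n\<ge>n0. \<forall>w\<in>ball z d. dist (the (H n w)) (the (g w)) < e" if "e > 0" for e
  proof -
    have pos: "1 + M\<^sup>2 > 0" by (simp add: add_pos_nonneg)
    obtain n1 where n1': "\<forall>n\<ge>n1. \<forall>w\<in>cball z d0. chordal (H n w) (g w) < e / (1 + M\<^sup>2)"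
      using cv[of "e / (1 + M\<^sup>2)"] \<open>e > 0\<close> pos by auto
    note n1 = n1'[rule_format]
    show ?thesis
    proof (intro exI[of _ "max N n1"] allI impI ballI)
      fix n w assume n: "n \<ge> max N n1" and w: "w \<in> ball z d"
      then obtain a where a: "H n w = Some a" "norm (a - the (g w)) \<le> (1 + M\<^sup>2) * chordal (H n w) (g w)"
        using near[OF w N3] d by (force simp: N_def)
      have "chordal (H n w) (g w) < e / (1 + M\<^sup>2)" using n1[of n w] n w d by auto
      then have "(1 + M\<^sup>2) * chordal (H n w) (g w) < e" using pos by (simp add: pos_less_divide_eq mult.commute)
      then show "dist (the (H n w)) (the (g w)) < e" using a by (simp add: dist_norm)
    qed
  qed
  show ?thesis
  proof (rule that[of d N])
    show "uniform_limit (ball z d) (\<lambda>n w. the (H n w)) (\<lambda>w. the (g w)) sequentially"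
      unfolding uniform_limit_sequentially_iff using ul by blast
    show "(\<lambda>w. the (g w)) holomorphic_on ball z d"
    proof (rule holomorphic_uniform_sequence[where f = "\<lambda>n w. the (H (n + N) w)"])
      fix x assume x: "x \<in> ball z d"
      then obtain r where r: "r > 0" "cball x r \<subseteq> ball z d" using open_contains_cball open_ball by blast
      have "uniform_limit (cball x r) (\<lambda>n w. the (H (n + N) w)) (\<lambda>w. the (g w)) sequentially"
        unfolding uniform_limit_sequentially_iff
      proof (intro allI impI)
        fix e :: real assume "e > 0"
        then obtain n0 where "\<forall>n\<ge>n0. \<forall>w\<in>ball z d. dist (the (H n w)) (the (g w)) < e" using ul by blast
        then show "\<exists>n0. \<forall>n\<ge>n0. \<forall>w\<in>cball x r. dist (the (H (n + N) w)) (the (g w)) < e"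
          using r by (intro exI[of _ n0]) (auto dest!: subsetD)
      qed
      then show "\<exists>r>0. cball x r \<subseteq> ball z d \<and> uniform_limit (cball x r) (\<lambda>n w. the (H (n + N) w)) (\<lambda>w. the (g w)) sequentially"
        using r by blast
    qed (use holH in auto)
    show "ball z d \<subseteq> S" using d d0 by auto
    show "g w = Some (the (g w))" if "w \<in> ball z d" for w using g[OF that] by auto
    show "H n w = Some (the (H n w))" if "n \<ge> N" "w \<in> ball z d" for n w using that by (rule some)
    show "(\<lambda>w. the (H n w)) holomorphic_on ball z d" if "n \<ge> N" for n using that by (rule holH)
  qed (rule d)
qed

lemma sconv_shol:
  assumes S: "open S" and lim: "sconv H g S"
  shows "shol g S"
proof -
  have *: "shol g {z}" if lim: "sconv H g S" and z: "z \<in> S" "g z \<noteq> None" for H g z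
  proof -
    obtain d where "d > 0" "\<And>w. w \<in> ball z d \<Longrightarrow> g w = Some (the (g w))" "(\<lambda>w. the (g w)) holomorphic_on ball z d"
      using sconv_chart[OF S lim z] by metis
    then show ?thesis
      by (intro sholI[of "\<lambda>w. the (g w)"])
         (auto simp: analytic_at_ball eventually_nhds_metric dist_commute)
  qed
  have "shol g {z}" if z: "z \<in> S" for z
  proof (cases "g z = None")
    case True
    then show ?thesis using *[OF sconv_sinv[OF lim] z] by simp
  qed (rule *[OF lim z])
  then show ?thesis by (subst shol_sing) blast
qed

section \<open>The identity theorem for sphere-valued holomorphic maps\<close>

lemma shol_frequently_eq:
  assumes "shol G {z}" and "\<exists>\<^sub>F w in at z. G w = v"
  shows "\<forall>\<^sub>F w in nhds z. G w = v"
proof -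
  have "\<forall>v. (\<exists>\<^sub>F w in at z. G w = v) \<longrightarrow> (\<forall>\<^sub>F w in nhds z. G w = v)"
    using assms(1)
  proof (rule shol_induct_chart)
    fix G assume "\<forall>v. (\<exists>\<^sub>F w in at z. sinv (G w) = v) \<longrightarrow> (\<forall>\<^sub>F w in nhds z. sinv (G w) = v)"
    then have "(\<exists>\<^sub>F w in at z. sinv (G w) = sinv v) \<longrightarrow> (\<forall>\<^sub>F w in nhds z. sinv (G w) = sinv v)" for v
      by blast
    then show "\<forall>v. (\<exists>\<^sub>F w in at z. G w = v) \<longrightarrow> (\<forall>\<^sub>F w in nhds z. G w = v)"
      by (simp add: sinv_eq_iff)
  next
    fix G \<phi> assume a: "\<phi> analytic_on {z}" and ev: "\<forall>\<^sub>F w in nhds z. G w = Some (\<phi> w)"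
    show "\<forall>v. (\<exists>\<^sub>F w in at z. G w = v) \<longrightarrow> (\<forall>\<^sub>F w in nhds z. G w = v)"
    proof (intro allI impI)
      fix v assume fr: "\<exists>\<^sub>F w in at z. G w = v"
      obtain e where e: "e > 0" "\<phi> holomorphic_on ball z e" using a analytic_at_ball by blast
      obtain e' where e': "e' > 0" "\<And>w. dist w z < e' \<Longrightarrow> G w = Some (\<phi> w)"
        using ev by (auto simp: eventually_nhds_metric)
      define d where "d = min e e'"
      have d: "d > 0" using e e' by (simp add: d_def)
      define U where "U = {w \<in> ball z d. G w = v}"
      have "\<forall>\<^sub>F w in at z. w \<in> ball z d"
        using d by (intro eventually_at_in_open') auto
      then have "\<exists>\<^sub>F w in at z. w \<in> U"
        using fr unfolding U_def by (rule_tac frequently_rev_mp[OF fr]) (auto elim: eventually_mono)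
      then have lp: "z islimpt U" by (simp add: islimpt_conv_frequently_at)
      then have "U \<noteq> {}" by auto
      then obtain u where "u \<in> U" by auto
      then have v: "v = Some (\<phi> u)" using e' by (auto simp: U_def d_def dist_commute)
      have "\<phi> w - \<phi> u = 0" if "w \<in> ball z d" for w
      proof (rule analytic_continuation[of "\<lambda>w. \<phi> w - \<phi> u" "ball z d" U z])
        show "(\<lambda>w. \<phi> w - \<phi> u) holomorphic_on ball z d"
          using e by (intro holomorphic_intros) (auto simp: d_def elim: holomorphic_on_subset)
        show "\<phi> x - \<phi> u = 0" if "x \<in> U" for x
          using that v e'(2)[of x] by (auto simp: U_def d_def dist_commute)
      qed (use d lp that in \<open>auto simp: U_def\<close>)
      then show "\<forall>\<^sub>F w in nhds z. G w = v"
        using d e' v unfolding eventually_nhds_metric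
        by (intro exI[of _ d]) (auto simp: d_def dist_commute)
    qed
  qed
  with assms(2) show ?thesis by blast
qed

lemma shol_identity:
  assumes G: "shol G S" and S: "open S" "connected S" and z: "z \<in> S" and fr: "\<exists>\<^sub>F w in at z. G w = v"
  shows "\<forall>w\<in>S. G w = v"
proof -
  define T where "T = {x \<in> S. \<forall>\<^sub>F w in nhds x. G w = v}"
  have "open T"
  proof (subst open_subopen, intro ballI)
    fix x assume "x \<in> T"
    then have x: "x \<in> S" "\<forall>\<^sub>F w in nhds x. G w = v" by (auto simp: T_def)
    then obtain U where "open U" "x \<in> U" "\<forall>w\<in>U. G w = v" by (auto simp: eventually_nhds)
    then show "\<exists>V. open V \<and> x \<in> V \<and> V \<subseteq> T"
      using x S by (intro exI[of _ "U \<inter> S"]) (auto simp: eventually_nhds T_def)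
  qed
  moreover have "open (S - T)"
  proof (subst open_subopen, intro ballI)
    fix x assume x: "x \<in> S - T"
    have "shol G {x}" using G x by (auto intro: shol_subset)
    then have "\<forall>\<^sub>F w in at x. G w \<noteq> v"
      using x shol_frequently_eq by (auto simp: T_def frequently_def)
    then obtain U where U: "open U" "x \<in> U" "\<And>w. w \<in> U \<Longrightarrow> w \<noteq> x \<Longrightarrow> G w \<noteq> v"
      by (auto simp: eventually_at_topological)
    have "U \<inter> S \<subseteq> S - T"
    proof
      fix y assume y: "y \<in> U \<inter> S"
      show "y \<in> S - T"
      proof (cases "y = x")
        case False
        then have "G y \<noteq> v" using U y by auto
        then show ?thesis using y eventually_nhds_x_imp_x by (fastforce simp: T_def)
      qed (use x in auto)
    qed
    then show "\<exists>V. open V \<and> x \<in> V \<and> V \<subseteq> S - T"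
      using U x S by (intro exI[of _ "U \<inter> S"]) auto
  qed
  moreover have "z \<in> T" using shol_frequently_eq[OF _ fr] G z by (auto simp: T_def intro: shol_subset)
  moreover have "T \<subseteq> S" by (auto simp: T_def)
  ultimately have "T = S"
    using connectedD[OF S(2), of T "S - T"] by auto
  then show ?thesis unfolding T_def using eventually_nhds_x_imp_x by fastforce
qed

section \<open>Zalcman's lemma\<close>

text \<open>Weierstrass' theorem on derivatives, read in a finite chart. It preserves the
  normalisation of the rescaled functions in the limit and so detects that the limit is
  nonconstant.\<close>

lemma sconv_sder:
  assumes S: "open S" and lim: "sconv H g S" and z: "z \<in> S"
  shows "(\<lambda>n. sder (H n) z) \<longlonglongrightarrow> sder g z"
proof -
  have *: "(\<lambda>n. sder (H n) z) \<longlonglongrightarrow> sder g z" if lim: "sconv H g S" and gz: "g z \<noteq> None" for H g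
  proof -
    obtain d N where d: "d > 0" "ball z d \<subseteq> S"
      and hol: "\<And>n. n \<ge> N \<Longrightarrow> (\<lambda>w. the (H n w)) holomorphic_on ball z d"
      and some: "\<And>n w. n \<ge> N \<Longrightarrow> w \<in> ball z d \<Longrightarrow> H n w = Some (the (H n w))"
      and gsome: "\<And>w. w \<in> ball z d \<Longrightarrow> g w = Some (the (g w))"
      and holg: "(\<lambda>w. the (g w)) holomorphic_on ball z d"
      and ul: "uniform_limit (ball z d) (\<lambda>n w. the (H n w)) (\<lambda>w. the (g w)) sequentially"
      by (rule sconv_chart[OF S lim z gz]; rule that; blast)
    have zin: "z \<in> ball z d" using d by simp
    have nb: "\<forall>\<^sub>F w in nhds z. w \<in> ball z d" using d by (intro eventually_nhds_in_open) auto
    have ev: "\<forall>\<^sub>F n in sequentially. (\<lambda>w. the (H n w)) holomorphic_on ball z d"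
      using hol eventually_sequentially by blast
    have 1: "(\<lambda>n. the (H n z)) \<longlonglongrightarrow> the (g z)"
      by (rule tendsto_uniform_limitI[OF ul zin])
    have 2: "(\<lambda>n. deriv (\<lambda>w. the (H n w)) z) \<longlonglongrightarrow> deriv (\<lambda>w. the (g w)) z"
      using higher_deriv_complex_uniform_limit[OF ul ev _ open_ball zin, of 1] by simp
    have "(\<lambda>n. 2 * norm (deriv (\<lambda>w. the (H n w)) z) / (1 + (norm (the (H n z)))\<^sup>2))
          \<longlonglongrightarrow> 2 * norm (deriv (\<lambda>w. the (g w)) z) / (1 + (norm (the (g z)))\<^sup>2)"
      by (intro tendsto_intros 1 2) auto
    also have "2 * norm (deriv (\<lambda>w. the (g w)) z) / (1 + (norm (the (g z)))\<^sup>2) = sder g z"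
    proof (rule sder_chart[symmetric])
      show "(\<lambda>w. the (g w)) analytic_on {z}" using holg d analytic_at_ball by blast
      show "\<forall>\<^sub>F w in nhds z. g w = Some (the (g w))" using nb by (rule eventually_mono) (rule gsome)
    qed
    finally show ?thesis
    proof (rule Lim_transform_eventually)
      have "2 * norm (deriv (\<lambda>w. the (H n w)) z) / (1 + (norm (the (H n z)))\<^sup>2) = sder (H n) z" if n: "n \<ge> N" for n
      proof (rule sder_chart[symmetric])
        show "(\<lambda>w. the (H n w)) analytic_on {z}" using hol[OF n] d analytic_at_ball by blast
        show "\<forall>\<^sub>F w in nhds z. H n w = Some (the (H n w))" using nb by (rule eventually_mono) (rule some[OF n])
      qed
      then show "\<forall>\<^sub>F n in sequentially. 2 * norm (deriv (\<lambda>w. the (H n w)) z) / (1 + (norm (the (H n z)))\<^sup>2) = sder (H n) z"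
        using eventually_sequentially by blast
    qed
  qed
  show ?thesis
  proof (cases "g z = None")
    case True
    then show ?thesis using *[OF sconv_sinv[OF lim]] by simp
  next
    case False
    then show ?thesis by (rule *[OF lim])
  qed
qed

text \<open>The given points are replaced by points where a weighted spherical derivative is
  maximal. Rescaling by the reciprocal of the derivative there gives derivative 1 at the origin and
  the bound 2 on discs whose radii tend to infinity, so Marty's criterion applies on the whole plane
  and the limit has derivative 1 at 0.\<close>

lemma zalcman_rescaling:
  fixes Fs :: "nat \<Rightarrow> complex \<Rightarrow> complex option" and x :: "nat \<Rightarrow> complex"
  assumes D: "open D" and hol: "\<And>n. shol (Fs n) D"
    and K: "compact K" "K \<subseteq> D" and xK: "\<And>n. x n \<in> K" and unb: "\<And>n. sder (Fs n) (x n) \<ge> real n"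
  obtains k :: "nat \<Rightarrow> nat" and a :: "nat \<Rightarrow> complex" and \<rho> :: "nat \<Rightarrow> real" and g z0
  where "z0 \<in> D" "a \<longlonglongrightarrow> z0" "\<rho> \<longlonglongrightarrow> 0" "\<And>n. \<rho> n > 0"
    "sconv (\<lambda>n \<zeta>. Fs (k n) (a n + of_real (\<rho> n) * \<zeta>)) g UNIV" "\<not> (\<exists>v. \<forall>z. g z = v)"
proof -
  obtain y l where y: "y \<in> K" and l: "strict_mono (l :: nat \<Rightarrow> nat)" and xl: "(x \<circ> l) \<longlonglongrightarrow> y"
    using K(1) xK unfolding compact_def by metis
  obtain r where r: "r > 0" "cball y r \<subseteq> D" using y K D open_contains_cball by blast
  \<comment> \<open>The weight \<open>r - dist y z\<close> vanishes on the boundary circle, so a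
    positive maximum over the closed disc lies inside. Its value \<open>R n\<close> will be exactly
    the distance of \<open>a n\<close> from the circle in units of \<open>\<rho> n\<close>.\<close>
  define q where "q = (\<lambda>n z. (r - dist y z) * sder (Fs (l n)) z)"
  have sh: "shol (Fs n) {z}" if "z \<in> cball y r" for n z
    using hol[of n] r that by (auto intro: shol_subset)
  have "\<exists>z\<in>cball y r. \<forall>w\<in>cball y r. q n w \<le> q n z" for n
  proof (rule continuous_attains_sup)
    show "continuous_on (cball y r) (q n)"
      unfolding q_def by (intro continuous_intros continuous_at_imp_continuous_on ballI isCont_sder sh)
  qed (use r in auto)
  then obtain w where w: "\<And>n. w n \<in> cball y r" "\<And>n v. v \<in> cball y r \<Longrightarrow> q n v \<le> q n (w n)" by metis
  have "\<forall>\<^sub>F n in sequentially. dist ((x \<circ> l) n) y < r / 2"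
    using tendstoD[OF xl, of "r / 2"] r(1) by simp
  then obtain N0 where N0: "\<And>n. n \<ge> N0 \<Longrightarrow> dist (x (l n)) y < r / 2"
    by (auto simp: eventually_sequentially)
  have big: "q n (w n) \<ge> r / 2 * real n" if "n \<ge> N0" for n
  proof -
    have d: "dist y (x (l n)) < r / 2" using N0[OF that] by (simp add: dist_commute)
    have "real n \<le> sder (Fs (l n)) (x (l n))"
      using unb[of "l n"] seq_suble[OF l, of n] by linarith
    then have "r / 2 * real n \<le> q n (x (l n))"
      unfolding q_def using d r by (intro mult_mono) auto
    also have "\<dots> \<le> q n (w n)" using d r by (intro w) auto
    finally show ?thesis .
  qed
  obtain z0 j where z0: "z0 \<in> cball y r" and j: "strict_mono (j :: nat \<Rightarrow> nat)" and wj: "(w \<circ> j) \<longlonglongrightarrow> z0"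
    using compact_cball[of y r] w(1) unfolding compact_def by metis
  \<comment> \<open>The shift by \<open>Suc N0\<close> makes the lower bound
    \<open>r / 2 * real (Suc n)\<close> for \<open>R n\<close> valid and positive for every
    \<open>n\<close>, the first indices included.\<close>
  define J where "J = (\<lambda>n. j (n + Suc N0))"
  have J: "J n \<ge> n + Suc N0" for n using seq_suble[OF j, of "n + Suc N0"] by (simp add: J_def)
  define a where "a = (\<lambda>n. w (J n))"
  define s where "s = (\<lambda>n. sder (Fs (l (J n))) (a n))"
  define R where "R = (\<lambda>n. q (J n) (w (J n)))"
  have R_eq: "R n = (r - dist y (a n)) * s n" for n by (simp add: R_def q_def s_def a_def)
  have Rbig: "R n \<ge> r / 2 * real (Suc n)" for n
  proof -
    have "r / 2 * real (Suc n) \<le> r / 2 * real (J n)" using J[of n] r by (intro mult_left_mono) auto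
    also have "\<dots> \<le> R n" unfolding R_def using J[of n] by (intro big) auto
    finally show ?thesis .
  qed
  have Rpos: "R n > 0" for n
    using Rbig[of n] r by (smt (verit) divide_pos_pos mult_pos_pos of_nat_0_less_iff zero_less_Suc)
  have acb: "a n \<in> cball y r" for n by (simp add: a_def w(1)[unfolded mem_cball])
  have spos: "s n > 0" for n
    using Rpos[of n] acb[of n] unfolding R_eq by (simp add: zero_less_mult_iff)
  define \<rho> where "\<rho> = (\<lambda>n. 1 / s n)"
  have \<rho>pos: "\<rho> n > 0" for n using spos by (simp add: \<rho>_def)
  have \<rho>R: "\<rho> n * R n = r - dist y (a n)" for n
    using spos[of n] by (simp add: \<rho>_def R_eq)
  have Rlim: "filterlim R at_top sequentially"
  proof (rule filterlim_at_top_mono)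
    show "filterlim (\<lambda>n. r / 2 * real (Suc n)) at_top sequentially"
      using r by (intro filterlim_tendsto_pos_mult_at_top[OF tendsto_const]
         filterlim_compose[OF filterlim_real_sequentially] filterlim_Suc) auto
  qed (use Rbig in auto)
  have \<rho>lim: "\<rho> \<longlonglongrightarrow> 0"
  proof (rule tendsto_sandwich[of "\<lambda>_. 0" _ _ "\<lambda>n. r / R n"])
    have "\<rho> n \<le> r / R n" for n
      using \<rho>R[of n] Rpos[of n] by (simp add: pos_le_divide_eq)
    then show "\<forall>\<^sub>F n in sequentially. \<rho> n \<le> r / R n" by simp
    show "(\<lambda>n. r / R n) \<longlonglongrightarrow> 0"
      using Rlim by (intro tendsto_divide_0[OF tendsto_const] filterlim_at_top_imp_at_infinity)
  qed (use \<rho>pos in \<open>auto simp: less_imp_le\<close>)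
  define G where "G = (\<lambda>n \<zeta>. Fs (l (J n)) (a n + of_real (\<rho> n) * \<zeta>))"
  have inball: "a n + of_real (\<rho> n) * \<zeta> \<in> cball y r" "r - dist y (a n + of_real (\<rho> n) * \<zeta>) \<ge> \<rho> n * (R n - norm \<zeta>)"
    if "norm \<zeta> \<le> R n" for n \<zeta>
  proof -
    have "dist y (a n + of_real (\<rho> n) * \<zeta>) \<le> dist y (a n) + norm (of_real (\<rho> n) * \<zeta>)"
      using dist_triangle[of y "a n + of_real (\<rho> n) * \<zeta>" "a n"] by (simp add: dist_norm)
    also have "norm (of_real (\<rho> n) * \<zeta>) = \<rho> n * norm \<zeta>"
      using \<rho>pos[of n] by (simp add: norm_mult)
    finally show *: "r - dist y (a n + of_real (\<rho> n) * \<zeta>) \<ge> \<rho> n * (R n - norm \<zeta>)"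
      using \<rho>R[of n] by (simp add: right_diff_distrib)
    have "\<rho> n * (R n - norm \<zeta>) \<ge> 0" using that \<rho>pos[of n] by simp
    with * have "dist y (a n + of_real (\<rho> n) * \<zeta>) \<le> r" by linarith
    then show "a n + of_real (\<rho> n) * \<zeta> \<in> cball y r" by simp
  qed
  have GG: "shol (G n) {\<zeta>}" "sder (G n) \<zeta> = \<rho> n * sder (Fs (l (J n))) (a n + of_real (\<rho> n) * \<zeta>)"
    if "norm \<zeta> \<le> R n" for n \<zeta>
  proof -
    have an: "(\<lambda>\<zeta>. a n + of_real (\<rho> n) * \<zeta>) analytic_on {\<zeta>}" by (intro analytic_intros)
    have "((\<lambda>\<zeta>. a n + of_real (\<rho> n) * \<zeta>) has_field_derivative of_real (\<rho> n)) (at \<zeta>)"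
      by (auto intro!: derivative_eq_intros)
    then have de: "deriv (\<lambda>\<zeta>. a n + of_real (\<rho> n) * \<zeta>) \<zeta> = of_real (\<rho> n)" by (rule DERIV_imp_deriv)
    show "shol (G n) {\<zeta>}" "sder (G n) \<zeta> = \<rho> n * sder (Fs (l (J n))) (a n + of_real (\<rho> n) * \<zeta>)"
      using shol_compose[OF an, of "Fs (l (J n))"] sh[OF inball(1)[OF that]] de \<rho>pos[of n]
      by (simp_all add: G_def)
  qed
  \<comment> \<open>For \<open>norm \<zeta> \<le> R n / 2\<close> the point is still at least half
    as far from the circle as \<open>a n\<close>; maximality of \<open>q\<close> then bounds the
    derivative by twice its value at \<open>a n\<close>.\<close>
  have Gbd: "sder (G n) \<zeta> \<le> 2" if "norm \<zeta> \<le> R n / 2" for n \<zeta>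
  proof -
    define p where "p = a n + of_real (\<rho> n) * \<zeta>"
    have n1: "norm \<zeta> \<le> R n" using that Rpos[of n] by linarith
    have p: "p \<in> cball y r" "r - dist y p \<ge> \<rho> n * (R n - norm \<zeta>)"
      using inball[OF n1] by (auto simp: p_def)
    have "\<rho> n * (R n / 2) \<le> \<rho> n * (R n - norm \<zeta>)"
      using that \<rho>pos[of n] by (intro mult_left_mono) auto
    with p(2) have 1: "\<rho> n * (R n / 2) \<le> r - dist y p" by linarith
    have "\<rho> n * (R n / 2) * sder (Fs (l (J n))) p \<le> (r - dist y p) * sder (Fs (l (J n))) p"
      using 1 sder_nonneg[OF sh[OF p(1)]] by (intro mult_right_mono) auto
    also have "\<dots> \<le> R n" using w(2)[OF p(1), of "J n"] by (simp add: q_def R_def)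
    finally have "R n * (\<rho> n * sder (Fs (l (J n))) p) \<le> R n * 2" by (simp add: mult_ac)
    then have "\<rho> n * sder (Fs (l (J n))) p \<le> 2" using Rpos[of n] by (simp only: mult_le_cancel_left_pos)
    then show ?thesis using GG(2)[OF n1] by (simp add: p_def)
  qed
  have cpt: "\<exists>N. \<forall>n\<ge>N. shol (G n) L \<and> (\<forall>z\<in>L. sder (G n) z \<le> 2)" if L: "compact L" for L
  proof -
    obtain B where B: "\<And>z. z \<in> L \<Longrightarrow> norm z \<le> B"
      using compact_imp_bounded[OF L] bounded_iff by metis
    have "\<forall>\<^sub>F n in sequentially. R n \<ge> 2 * \<bar>B\<bar>" using Rlim by (simp add: filterlim_at_top)
    then obtain N where N: "\<And>n. n \<ge> N \<Longrightarrow> R n \<ge> 2 * \<bar>B\<bar>" by (auto simp: eventually_sequentially)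
    show ?thesis
    proof (intro exI[of _ N] allI impI conjI ballI)
      fix n assume n: "n \<ge> N"
      have *: "norm z \<le> R n / 2" if "z \<in> L" for z
        using B[OF that] N[OF n] by linarith
      then show "sder (G n) z \<le> 2" if "z \<in> L" for z using Gbd that by blast
      show "shol (G n) L"
        by (subst shol_sing, intro ballI GG(1)) (use * Rpos[of n] in force)
    qed
  qed
  obtain p g where p: "strict_mono (p :: nat \<Rightarrow> nat)"
    and pg: "\<And>K e. compact K \<Longrightarrow> K \<subseteq> UNIV \<Longrightarrow> e > 0 \<Longrightarrow> \<exists>N. \<forall>n\<ge>N. \<forall>z\<in>K. chordal (G (p n) z) (g z) < e"
    by (rule sder_bounded_imp_convergent_subsequence[of UNIV G]) (use cpt in blast)+
  have sc: "sconv (\<lambda>n. G (p n)) g UNIV"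
    unfolding sconv_def
  proof (intro allI impI conjI)
    fix L :: "complex set" assume L: "compact L \<and> L \<subseteq> UNIV"
    then obtain N where N: "\<forall>n\<ge>N. shol (G n) L" using cpt[of L] by blast
    have "p n \<ge> N" if "n \<ge> N" for n using seq_suble[OF p, of n] that by linarith
    with N show "\<exists>N. \<forall>n\<ge>N. shol (G (p n)) L" by blast
    fix e :: real assume "e > 0"
    then show "\<exists>N. \<forall>n\<ge>N. \<forall>z\<in>L. chordal (G (p n) z) (g z) < e" using pg L by blast
  qed
  have "sder (G n) 0 = 1" for n
    using GG(2)[of 0 n] Rpos[of n] spos[of n] by (simp add: \<rho>_def s_def)
  then have g1: "sder g 0 = 1"
    using sconv_sder[OF open_UNIV sc, of 0] by (simp add: LIMSEQ_const_iff)
  show ?thesis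
  proof (rule that[of z0 "\<lambda>n. a (p n)" "\<lambda>n. \<rho> (p n)" "\<lambda>n. l (J (p n))" g])
    show "z0 \<in> D" using z0 r by auto
    have "(\<lambda>n. (w \<circ> j) (n + Suc N0)) \<longlonglongrightarrow> z0"
      using wj by (rule LIMSEQ_ignore_initial_segment)
    then have "a \<longlonglongrightarrow> z0" by (simp add: a_def J_def o_def)
    then show "(\<lambda>n. a (p n)) \<longlonglongrightarrow> z0" using LIMSEQ_subseq_LIMSEQ[OF _ p, of a z0] by (simp add: o_def)
    show "(\<lambda>n. \<rho> (p n)) \<longlonglongrightarrow> 0" using LIMSEQ_subseq_LIMSEQ[OF \<rho>lim p] by (simp add: o_def)
    show "sconv (\<lambda>n \<zeta>. Fs (l (J (p n))) (a (p n) + of_real (\<rho> (p n)) * \<zeta>)) g UNIV"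
      using sc by (simp add: G_def)
    show "\<not> (\<exists>v. \<forall>z. g z = v)"
    proof
      assume "\<exists>v. \<forall>z. g z = v"
      then obtain v where "\<And>z. g z = v" by blast
      then have "sder g 0 = Lim (at 0) (\<lambda>w::complex. 0::real)" by (simp add: sder_def)
      also have "\<dots> = 0" by (rule tendsto_Lim) auto
      finally show False using g1 by simp
    qed
  qed (rule \<rho>pos)
qed

section \<open>Pointwise Laplacians\<close>

text \<open>A second-order expansion at the single point \<open>z\<close>: a harmonic polynomial plus \<open>L \<bar>w - z\<bar>\<^sup>2\<close>, so \<open>L\<close> is a quarter of
  the Laplacian. Averaging over the points \<open>z \<plusminus> r\<close>, \<open>z \<plusminus> \<i> r\<close> cancels the harmonic part.\<close>

definition lapl :: "(complex \<Rightarrow> real) \<Rightarrow> complex \<Rightarrow> real \<Rightarrow> bool" where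
  "lapl f z L \<longleftrightarrow> (\<exists>c q p. isCont q z \<and> isCont p z \<and> p z = L \<and>
     (\<forall>\<^sub>F w in nhds z. f w = f z + Re ((w - z) * c + (w - z)\<^sup>2 * q w) + (norm (w - z))\<^sup>2 * p w))"

lemma laplI:
  assumes "isCont q z" "isCont p z" "p z = L"
    "\<forall>\<^sub>F w in nhds z. f w = f z + Re ((w - z) * c + (w - z)\<^sup>2 * q w) + (norm (w - z))\<^sup>2 * p w"
  shows "lapl f z L"
  using assms unfolding lapl_def by blast

lemma lapl_const: "lapl (\<lambda>_. k) z 0"
  by (rule laplI[where q = "\<lambda>_. 0" and p = "\<lambda>_. 0" and c = 0]) auto

lemma lapl_add:
  assumes "lapl f z L" "lapl g z M"
  shows "lapl (\<lambda>w. f w + g w) z (L + M)"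
proof -
  obtain c q p where 1: "isCont q z" "isCont p z" "p z = L"
    "\<forall>\<^sub>F w in nhds z. f w = f z + Re ((w - z) * c + (w - z)\<^sup>2 * q w) + (norm (w - z))\<^sup>2 * p w"
    using assms(1) unfolding lapl_def by blast
  obtain c' q' p' where 2: "isCont q' z" "isCont p' z" "p' z = M"
    "\<forall>\<^sub>F w in nhds z. g w = g z + Re ((w - z) * c' + (w - z)\<^sup>2 * q' w) + (norm (w - z))\<^sup>2 * p' w"
    using assms(2) unfolding lapl_def by blast
  show ?thesis
  proof (rule laplI)
    show "isCont (\<lambda>w. q w + q' w) z" "isCont (\<lambda>w. p w + p' w) z" "p z + p' z = L + M"
      using 1 2 by (auto intro: continuous_intros)
    show "\<forall>\<^sub>F w in nhds z. f w + g w = f z + g z + Re ((w - z) * (c + c') + (w - z)\<^sup>2 * (q w + q' w)) + (norm (w - z))\<^sup>2 * (p w + p' w)"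
      using 1(4) 2(4) by eventually_elim (simp add: algebra_simps)
  qed
qed

lemma lapl_cmult:
  assumes "lapl f z L"
  shows "lapl (\<lambda>w. k * f w) z (k * L)"
proof -
  obtain c q p where 1: "isCont q z" "isCont p z" "p z = L"
    "\<forall>\<^sub>F w in nhds z. f w = f z + Re ((w - z) * c + (w - z)\<^sup>2 * q w) + (norm (w - z))\<^sup>2 * p w"
    using assms(1) unfolding lapl_def by blast
  show ?thesis
  proof (rule laplI)
    show "isCont (\<lambda>w. of_real k * q w) z" "isCont (\<lambda>w. k * p w) z" "k * p z = k * L"
      using 1 by (auto intro: continuous_intros)
    show "\<forall>\<^sub>F w in nhds z. k * f w = k * f z + Re ((w - z) * (of_real k * c) + (w - z)\<^sup>2 * (of_real k * q w)) + (norm (w - z))\<^sup>2 * (k * p w)"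
      using 1(4)
    proof eventually_elim
      case (elim w)
      have "Re ((w - z) * (of_real k * c) + (w - z)\<^sup>2 * (of_real k * q w)) = Re (of_real k * ((w - z) * c + (w - z)\<^sup>2 * q w))"
        by (simp only: algebra_simps)
      also have "\<dots> = k * Re ((w - z) * c + (w - z)\<^sup>2 * q w)" by (simp only: Re_complex_of_real Im_complex_of_real times_complex.sel)
      finally show ?case using elim by (simp only: algebra_simps)
    qed
  qed
qed

lemma lapl_sum:
  assumes "finite T" "\<And>a. a \<in> T \<Longrightarrow> lapl (f a) z (L a)"
  shows "lapl (\<lambda>w. \<Sum>a\<in>T. f a w) z (\<Sum>a\<in>T. L a)"
  using assms by (induction T rule: finite_induct) (auto intro: lapl_add lapl_const)

lemma lapl_cong:
  assumes "lapl f z L" "\<forall>\<^sub>F w in nhds z. g w = f w"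
  shows "lapl g z L"
proof -
  obtain c q p where 1: "isCont q z" "isCont p z" "p z = L"
    "\<forall>\<^sub>F w in nhds z. f w = f z + Re ((w - z) * c + (w - z)\<^sup>2 * q w) + (norm (w - z))\<^sup>2 * p w"
    using assms(1) unfolding lapl_def by blast
  have gz: "g z = f z" using assms(2) by (rule eventually_nhds_x_imp_x)
  have "\<forall>\<^sub>F w in nhds z. g w = g z + Re ((w - z) * c + (w - z)\<^sup>2 * q w) + (norm (w - z))\<^sup>2 * p w"
    using 1(4) assms(2) by eventually_elim (simp add: gz)
  then show ?thesis using 1 laplI by blast
qed

lemma lapl_max:
  assumes "lapl f z L" "\<forall>\<^sub>F w in nhds z. f w \<le> f z"
  shows "L \<le> 0"
proof -
  obtain c q p where 1: "isCont q z" "isCont p z" "p z = L"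
    "\<forall>\<^sub>F w in nhds z. f w = f z + Re ((w - z) * c + (w - z)\<^sup>2 * q w) + (norm (w - z))\<^sup>2 * p w"
    using assms(1) unfolding lapl_def by blast
  have le: "\<forall>\<^sub>F w in nhds z. Re ((w - z) * c + (w - z)\<^sup>2 * q w) + (norm (w - z))\<^sup>2 * p w \<le> 0"
    using 1(4) assms(2) by eventually_elim linarith
  have lim: "((\<lambda>r::real. z + u * of_real r) \<longlongrightarrow> z) (at_right 0)" for u :: complex
    by (rule tendsto_eq_intros refl | simp)+
  \<comment> \<open>The sum of the second-order terms at the four points, divided by r^2. The
    squared increments are r^2 and -r^2, which gives the signs of the \<open>q\<close>-terms; in the
    limit these cancel and \<open>4 * L\<close> remains.\<close>
  define S where "S = (\<lambda>r::real. Re (q (z + of_real r) + q (z + (-1) * of_real r) - q (z + \<i> * of_real r) - q (z + (-\<i>) * of_real r))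
     + (p (z + of_real r) + p (z + (-1) * of_real r) + p (z + \<i> * of_real r) + p (z + (-\<i>) * of_real r)))"
  have ql: "((\<lambda>r::real. q (z + u * of_real r)) \<longlongrightarrow> q z) (at_right 0)" for u
    using isCont_tendsto_compose[OF 1(1) lim] .
  have pl: "((\<lambda>r::real. p (z + u * of_real r)) \<longlongrightarrow> p z) (at_right 0)" for u
    using isCont_tendsto_compose[OF 1(2) lim] .
  have "(S \<longlongrightarrow> Re (q z + q z - q z - q z) + (p z + p z + p z + p z)) (at_right 0)"
    unfolding S_def using ql[of 1] pl[of 1] by (intro tendsto_intros ql pl) auto
  moreover have "\<forall>\<^sub>F r in at_right 0. S r \<le> 0"
  proof -
    have ev: "\<forall>\<^sub>F r in at_right (0::real). Re ((u * of_real r) * c + (u * of_real r)\<^sup>2 * q (z + u * of_real r)) + (norm (u * of_real r))\<^sup>2 * p (z + u * of_real r) \<le> 0" for u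
      using eventually_compose_filterlim[OF le lim[of u]] by simp
    show ?thesis
      using ev[of 1] ev[of "-1"] ev[of "\<i>"] ev[of "-\<i>"] eventually_at_right_less[of 0]
    proof eventually_elim
      case (elim r)
      have "r\<^sup>2 * S r \<le> 0"
        using elim(1-4) by (simp add: S_def power_mult_distrib norm_mult algebra_simps flip: of_real_power)
      then show ?case using elim(5) by (simp add: mult_le_0_iff)
    qed
  qed
  ultimately have "Re (q z + q z - q z - q z) + (p z + p z + p z + p z) \<le> 0"
    by (rule tendsto_upperbound) simp
  then show ?thesis using 1(3) by simp
qed

lemma analytic_divide_diff:
  assumes "f analytic_on {z}"
  obtains g where "g analytic_on {z}" "g z = deriv f z" "\<And>w. f w = f z + (w - z) * g w"
proof -
  obtain e where e: "e > 0" "f holomorphic_on ball z e" using assms analytic_at_ball by blast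
  define g where "g = (\<lambda>w. if w = z then deriv f z else (f w - f z) / (w - z))"
  have "g holomorphic_on ball z e"
    unfolding g_def using e by (intro pole_lemma_open) auto
  then show ?thesis using e by (intro that[of g]) (auto simp: g_def analytic_at_ball)
qed

lemma lapl_Re:
  assumes "f analytic_on {z}"
  shows "lapl (\<lambda>w. Re (f w)) z 0"
proof -
  obtain g where g: "g analytic_on {z}" "\<And>w. f w = f z + (w - z) * g w"
    using analytic_divide_diff[OF assms] by metis
  obtain h where h: "h analytic_on {z}" "\<And>w. g w = g z + (w - z) * h w"
    using analytic_divide_diff[OF g(1)] by metis
  have "f w = f z + ((w - z) * g z + (w - z)\<^sup>2 * h w)" for w
    using g(2)[of w] h(2)[of w] by (simp add: algebra_simps power2_eq_square)
  then have eq: "Re (f w) = Re (f z) + Re ((w - z) * g z + (w - z)\<^sup>2 * h w) + (norm (w - z))\<^sup>2 * 0" for w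
    by (metis add.right_neutral mult_zero_right plus_complex.sel(1))
  show ?thesis
  proof (rule laplI[where q = h and p = "\<lambda>_. 0" and c = "g z"])
    show "isCont h z" using h(1) by (rule analytic_at_imp_isCont)
    show "\<forall>\<^sub>F w in nhds z. Re (f w) = Re (f z) + Re ((w - z) * g z + (w - z)\<^sup>2 * h w) + (norm (w - z))\<^sup>2 * 0"
      by (intro always_eventually allI eq)
  qed simp_all
qed

text \<open>Because \<open>H\<close> vanishes at \<open>z\<close>, its squared norm is already of
  second order, so only the first derivative of \<psi> at 0 enters and the harmonic part is zero. It
  is applied to ln (1 + t) and ln (1 - t), after a Moebius map has moved the value to 0.\<close>

lemma lapl_normsq:
  assumes "(\<psi> has_real_derivative k) (at 0)" "\<psi> 0 = 0" and H: "H analytic_on {z}" "H z = 0"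
  shows "lapl (\<lambda>w. \<psi> ((norm (H w))\<^sup>2)) z (k * (norm (deriv H z))\<^sup>2)"
proof -
  obtain g where g: "g analytic_on {z}" "g z = deriv H z" "\<And>w. H w = H z + (w - z) * g w"
    using analytic_divide_diff[OF H(1)] by metis
  obtain \<kappa> where \<kappa>: "\<And>t. \<psi> t - \<psi> 0 = \<kappa> t * (t - 0)" "isCont \<kappa> 0" "\<kappa> 0 = k"
    using CARAT_DERIV[of \<psi> k 0] assms(1) by metis
  have cg: "isCont g z" using g(1) by (rule analytic_at_imp_isCont)
  have cH: "isCont H z" using H(1) by (rule analytic_at_imp_isCont)
  have cn: "isCont (\<lambda>w. (norm (H w))\<^sup>2) z" by (intro continuous_intros cH)
  have c\<kappa>: "isCont (\<lambda>w. \<kappa> ((norm (H w))\<^sup>2)) z"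
    by (rule isCont_o2[OF cn]) (simp add: H(2) \<kappa>(2))
  show ?thesis
  proof (rule laplI[where q = "\<lambda>_. 0" and p = "\<lambda>w. \<kappa> ((norm (H w))\<^sup>2) * (norm (g w))\<^sup>2" and c = 0])
    show "isCont (\<lambda>w. \<kappa> ((norm (H w))\<^sup>2) * (norm (g w))\<^sup>2) z"
      by (intro continuous_intros c\<kappa> cg)
    have "\<psi> ((norm (H w))\<^sup>2) = \<kappa> ((norm (H w))\<^sup>2) * (norm (H w))\<^sup>2" for w
      using \<kappa>(1)[of "(norm (H w))\<^sup>2"] assms(2) by simp
    moreover have "(norm (H w))\<^sup>2 = (norm (w - z))\<^sup>2 * (norm (g w))\<^sup>2" for w
      using g(3)[of w] H(2) by (simp add: norm_mult power_mult_distrib)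
    ultimately have "\<psi> ((norm (H w))\<^sup>2) = (norm (w - z))\<^sup>2 * (\<kappa> ((norm (H w))\<^sup>2) * (norm (g w))\<^sup>2)" for w
      by (metis mult.left_commute)
    then show "\<forall>\<^sub>F w in nhds z. \<psi> ((norm (H w))\<^sup>2) = \<psi> ((norm (H z))\<^sup>2) + Re ((w - z) * 0 + (w - z)\<^sup>2 * 0) + (norm (w - z))\<^sup>2 * (\<kappa> ((norm (H w))\<^sup>2) * (norm (g w))\<^sup>2)"
      using assms(2) H(2) by simp
  qed (use \<kappa> g H in auto)
qed

lemma eventually_nhds_not_nonpos:
  assumes "f analytic_on {z}" "f z \<noteq> 0"
  shows "\<forall>\<^sub>F w in nhds z. f w / f z \<notin> \<real>\<^sub>\<le>\<^sub>0" "\<forall>\<^sub>F w in nhds z. f w \<noteq> 0"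
proof -
  note f = analytic_tendsto(1)[OF assms(1)]
  then show "\<forall>\<^sub>F w in nhds z. f w \<noteq> 0" using assms(2) tendsto_imp_eventually_ne by blast
  have "((\<lambda>w. f w / f z) \<longlongrightarrow> f z / f z) (nhds z)" using f assms by (intro tendsto_intros) auto
  then have "((\<lambda>w. f w / f z) \<longlongrightarrow> 1) (nhds z)" using assms by simp
  moreover have "open (- \<real>\<^sub>\<le>\<^sub>0 :: complex set)" by (simp add: open_Compl)
  ultimately have "\<forall>\<^sub>F w in nhds z. f w / f z \<in> - \<real>\<^sub>\<le>\<^sub>0"
    by (rule topological_tendstoD) auto
  then show "\<forall>\<^sub>F w in nhds z. f w / f z \<notin> \<real>\<^sub>\<le>\<^sub>0" by simp
qed

lemma analytic_Ln_quotient: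
  assumes "f analytic_on {z}" "f z \<noteq> 0"
  shows "(\<lambda>w. Ln (f w / f z)) analytic_on {z}"
    "((\<lambda>w. Ln (f w / f z)) has_field_derivative deriv f z / f z) (at z)"
proof -
  show "(\<lambda>w. Ln (f w / f z)) analytic_on {z}"
    using assms by (intro analytic_intros) auto
  have "((\<lambda>w. f w / f z) has_field_derivative deriv f z / f z) (at z)"
    using analytic_derivI[OF assms(1)] assms(2) by (auto intro!: derivative_eq_intros)
  then show "((\<lambda>w. Ln (f w / f z)) has_field_derivative deriv f z / f z) (at z)"
    using DERIV_chain2[where f = Ln and g = "\<lambda>w. f w / f z" and x = z and Da = 1] has_field_derivative_Ln[of 1] assms(2) by simp
qed

lemma lapl_ln_norm:
  assumes "f analytic_on {z}" "f z \<noteq> 0"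
  shows "lapl (\<lambda>w. ln (norm (f w))) z 0"
proof (rule lapl_cong)
  show "lapl (\<lambda>w. Re (Ln (f w / f z)) + ln (norm (f z))) z 0"
    using lapl_add[OF lapl_Re[OF analytic_Ln_quotient(1)[OF assms]] lapl_const] by simp
  show "\<forall>\<^sub>F w in nhds z. ln (norm (f w)) = Re (Ln (f w / f z)) + ln (norm (f z))"
    using eventually_nhds_not_nonpos(2)[OF assms]
    by eventually_elim (use assms in \<open>simp add: norm_divide ln_div\<close>)
qed

text \<open>A rotation of the sphere, \<open>H = (F - c) / E\<close> with \<open>c = F z\<close>,
  moves the value to 0, where the expansion is immediate. The functions ln (1 + |F|^2) and ln (1 +
  |H|^2) differ by the harmonic function 2 ln |E| and a constant.\<close>

lemma lapl_ln_one_plus: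
  assumes F: "F analytic_on {z}"
  shows "lapl (\<lambda>w. ln (1 + (norm (F w))\<^sup>2)) z ((norm (deriv F z))\<^sup>2 / (1 + (norm (F z))\<^sup>2)\<^sup>2)"
proof -
  define c where "c = F z"
  define E where "E = (\<lambda>w. 1 + cnj c * F w)"
  define H where "H = (\<lambda>w. (F w - c) / E w)"
  have E: "E analytic_on {z}" unfolding E_def using F by (intro analytic_intros) auto
  have Ez: "E z = of_real (1 + (norm c)\<^sup>2)"
    unfolding of_real_add of_real_1 complex_norm_square by (simp add: E_def c_def mult.commute)
  have Ez0: "E z \<noteq> 0" unfolding Ez using one_plus_norm_neq[of c] by (simp only: of_real_eq_0_iff not_False_eq_True)
  have H: "H analytic_on {z}" unfolding H_def using F E Ez0 by (intro analytic_intros) auto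
  have Hz: "H z = 0" by (simp add: H_def c_def)
  have "(H has_field_derivative deriv F z / E z) (at z)"
    unfolding H_def using analytic_derivI[OF F] analytic_derivI[OF E] Ez0
    by (auto intro!: derivative_eq_intros simp: c_def field_simps)
  then have dH: "deriv H z = deriv F z / E z" by (rule DERIV_imp_deriv)
  have nE: "norm (E z) = 1 + (norm c)\<^sup>2" unfolding Ez by (simp only: norm_of_real abs_of_pos one_plus_norm_pos)
  have id: "(1 + (norm (F w))\<^sup>2) * (1 + (norm c)\<^sup>2) = (norm (E w))\<^sup>2 + (norm (F w - c))\<^sup>2" for w
  proof -
    have "complex_of_real ((1 + (norm (F w))\<^sup>2) * (1 + (norm c)\<^sup>2)) = of_real ((norm (E w))\<^sup>2 + (norm (F w - c))\<^sup>2)"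
      unfolding of_real_add of_real_mult of_real_1 complex_norm_square E_def by (simp add: algebra_simps)
    then show ?thesis by (simp only: of_real_eq_iff)
  qed
  show ?thesis
  proof (rule lapl_cong)
    have "((\<lambda>t::real. ln (1 + t)) has_real_derivative 1) (at 0)"
      by (auto intro!: derivative_eq_intros)
    from lapl_normsq[OF this _ H Hz]
    have "lapl (\<lambda>w. ln (1 + (norm (H w))\<^sup>2)) z ((norm (deriv H z))\<^sup>2)" by simp
    from lapl_add[OF lapl_add[OF lapl_cmult[OF lapl_ln_norm[OF E Ez0], of 2] this] lapl_const[of "- ln (1 + (norm c)\<^sup>2)"]]
    show "lapl (\<lambda>w. 2 * ln (norm (E w)) + ln (1 + (norm (H w))\<^sup>2) + - ln (1 + (norm c)\<^sup>2)) z
        ((norm (deriv F z))\<^sup>2 / (1 + (norm (F z))\<^sup>2)\<^sup>2)"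
      by (simp add: dH norm_divide nE power_divide c_def)
    show "\<forall>\<^sub>F w in nhds z. ln (1 + (norm (F w))\<^sup>2) = 2 * ln (norm (E w)) + ln (1 + (norm (H w))\<^sup>2) + - ln (1 + (norm c)\<^sup>2)"
      using eventually_nhds_not_nonpos(2)[OF E Ez0]
    proof eventually_elim
      case (elim w)
      have "1 + (norm (F w))\<^sup>2 = (norm (E w))\<^sup>2 * (1 + (norm (H w))\<^sup>2) / (1 + (norm c)\<^sup>2)"
      proof -
        have "(norm (E w))\<^sup>2 * (1 + (norm (H w))\<^sup>2) = (norm (E w))\<^sup>2 + (norm (F w - c))\<^sup>2"
          using elim by (simp add: H_def norm_divide power_divide distrib_left)
        then show ?thesis using id[of w] by (simp add: eq_divide_eq)
      qed
      then show ?case using elim by (simp add: ln_div ln_mult ln_realpow add_pos_nonneg)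
    qed
  qed
qed

text \<open>Near \<open>z\<close> there is a branch of the power of \<open>f\<close> with exponent
  \<beta>, up to a constant of modulus one; this is \<open>F\<close>, and
  \<open>lapl_ln_one_plus\<close> applies to it.\<close>

lemma lapl_ln_one_plus_powr:
  assumes f: "f analytic_on {z}" "f z \<noteq> 0"
  shows "lapl (\<lambda>w. ln (1 + norm (f w) powr (2 * \<beta>))) z
     ((\<beta> * norm (f z) powr (\<beta> - 1) * norm (deriv f z) / (1 + norm (f z) powr (2 * \<beta>)))\<^sup>2)"
proof -
  define l where "l = (\<lambda>w. Ln (f w / f z))"
  have l: "l analytic_on {z}" "(l has_field_derivative deriv f z / f z) (at z)"
    using analytic_Ln_quotient[OF f] by (simp_all add: l_def)
  define F where "F = (\<lambda>w. exp (of_real \<beta> * (l w + of_real (ln (norm (f z))))))"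
  have F: "F analytic_on {z}" unfolding F_def using l(1) by (intro analytic_intros) auto
  have Fn: "norm (F w) = norm (f w) powr \<beta>" if "f w \<noteq> 0" for w
    using that f(2) by (simp add: F_def l_def norm_exp_eq_Re norm_divide ln_div powr_def)
  have sq: "(norm (f w) powr \<beta>)\<^sup>2 = norm (f w) powr (2 * \<beta>)" for w
    by (simp add: power2_eq_square powr_add[symmetric])
  have "(F has_field_derivative F z * (of_real \<beta> * (deriv f z / f z))) (at z)"
    unfolding F_def using l(2) by (auto intro!: derivative_eq_intros)
  then have dF: "deriv F z = F z * (of_real \<beta> * (deriv f z / f z))" by (rule DERIV_imp_deriv)
  have "norm (deriv F z) = \<bar>\<beta>\<bar> * norm (f z) powr (\<beta> - 1) * norm (deriv f z)"
    using f(2) by (simp add: dF norm_mult norm_divide Fn powr_diff)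
  then have dn: "(norm (deriv F z))\<^sup>2 / (1 + (norm (F z))\<^sup>2)\<^sup>2 = (\<beta> * norm (f z) powr (\<beta> - 1) * norm (deriv f z) / (1 + norm (f z) powr (2 * \<beta>)))\<^sup>2"
    using f(2) by (simp add: Fn sq power_divide power_mult_distrib)
  show ?thesis
  proof (rule lapl_cong)
    show "lapl (\<lambda>w. ln (1 + (norm (F w))\<^sup>2)) z ((\<beta> * norm (f z) powr (\<beta> - 1) * norm (deriv f z) / (1 + norm (f z) powr (2 * \<beta>)))\<^sup>2)"
      using lapl_ln_one_plus[OF F] unfolding dn .
    show "\<forall>\<^sub>F w in nhds z. ln (1 + norm (f w) powr (2 * \<beta>)) = ln (1 + (norm (F w))\<^sup>2)"
      using eventually_nhds_not_nonpos(2)[OF f] by eventually_elim (simp add: Fn sq)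
  qed
qed

text \<open>The hyperbolic counterpart of \<open>lapl_ln_one_plus\<close>: the Moebius map
  \<open>H\<close> of the disc of radius \<open>R\<close> onto the unit disc moves \<open>z\<close>
  to 0. The negative value reflects the curvature of the Poincare metric, whose density is a
  multiple of the reciprocal of \<open>R\<^sup>2 - (norm w)\<^sup>2\<close>.\<close>

lemma lapl_ln_disc:
  assumes R: "norm z < R"
  shows "lapl (\<lambda>w. ln (R\<^sup>2 - (norm w)\<^sup>2)) z (- ((R / (R\<^sup>2 - (norm z)\<^sup>2))\<^sup>2))"
proof -
  have R0: "R > 0" using R norm_ge_zero[of z] by linarith
  have pos: "R\<^sup>2 - (norm w)\<^sup>2 > 0" if "norm w < R" for w :: complex
    using power_strict_mono[OF that norm_ge_zero, of 2] by simp
  define E where "E = (\<lambda>w. of_real (R\<^sup>2) - cnj z * w)"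
  define H where "H = (\<lambda>w. of_real R * (w - z) / E w)"
  have E: "E analytic_on {z}" unfolding E_def by (intro analytic_intros)
  have Ez: "E z = of_real (R\<^sup>2 - (norm z)\<^sup>2)"
    unfolding E_def of_real_diff complex_norm_square by (simp add: mult.commute)
  have Ez0: "E z \<noteq> 0" unfolding Ez of_real_eq_0_iff using pos[OF R] by linarith
  have H: "H analytic_on {z}" unfolding H_def using E Ez0 by (intro analytic_intros) auto
  have Hz: "H z = 0" by (simp add: H_def)
  have "(H has_field_derivative of_real R / E z) (at z)"
    unfolding H_def using analytic_derivI[OF E] Ez0
    by (auto intro!: derivative_eq_intros simp: field_simps)
  then have dH: "deriv H z = of_real R / E z" by (rule DERIV_imp_deriv)
  have nE: "norm (E z) = R\<^sup>2 - (norm z)\<^sup>2" unfolding Ez norm_of_real using pos[OF R] by linarith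
  have id: "(R\<^sup>2 - (norm w)\<^sup>2) * (R\<^sup>2 - (norm z)\<^sup>2) = (norm (E w))\<^sup>2 - R\<^sup>2 * (norm (w - z))\<^sup>2" for w
  proof -
    have "complex_of_real ((R\<^sup>2 - (norm w)\<^sup>2) * (R\<^sup>2 - (norm z)\<^sup>2)) = of_real ((norm (E w))\<^sup>2 - R\<^sup>2 * (norm (w - z))\<^sup>2)"
      unfolding of_real_diff of_real_mult complex_norm_square E_def by (simp add: algebra_simps)
    then show ?thesis by (simp only: of_real_eq_iff)
  qed
  show ?thesis
  proof (rule lapl_cong)
    have "((\<lambda>t::real. ln (1 - t)) has_real_derivative -1) (at 0)"
      by (auto intro!: derivative_eq_intros)
    from lapl_normsq[OF this _ H Hz]
    have "lapl (\<lambda>w. ln (1 - (norm (H w))\<^sup>2)) z (- (norm (deriv H z))\<^sup>2)" by simp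
    from lapl_add[OF lapl_add[OF lapl_cmult[OF lapl_ln_norm[OF E Ez0], of 2] this] lapl_const[of "- ln (R\<^sup>2 - (norm z)\<^sup>2)"]]
    show "lapl (\<lambda>w. 2 * ln (norm (E w)) + ln (1 - (norm (H w))\<^sup>2) + - ln (R\<^sup>2 - (norm z)\<^sup>2)) z (- ((R / (R\<^sup>2 - (norm z)\<^sup>2))\<^sup>2))"
      by (simp add: dH norm_divide nE power_divide)
    have "\<forall>\<^sub>F w in nhds z. w \<in> ball 0 R" using R by (intro eventually_nhds_in_open) auto
    then show "\<forall>\<^sub>F w in nhds z. ln (R\<^sup>2 - (norm w)\<^sup>2) = 2 * ln (norm (E w)) + ln (1 - (norm (H w))\<^sup>2) + - ln (R\<^sup>2 - (norm z)\<^sup>2)"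
      using eventually_nhds_not_nonpos(2)[OF E Ez0]
    proof eventually_elim
      case (elim w)
      define A where "A = R\<^sup>2 - (norm w)\<^sup>2"
      define B where "B = R\<^sup>2 - (norm z)\<^sup>2"
      have AB: "A > 0" "B > 0" using pos[OF R] pos[of w] elim by (auto simp: A_def B_def)
      have En: "(norm (E w))\<^sup>2 > 0" using elim by simp
      have *: "1 - (norm (H w))\<^sup>2 = A * B / (norm (E w))\<^sup>2"
      proof -
        have "(norm (H w))\<^sup>2 = R\<^sup>2 * (norm (w - z))\<^sup>2 / (norm (E w))\<^sup>2"
          by (simp add: H_def norm_divide norm_mult power_divide power_mult_distrib)
        then show ?thesis using id[of w] En unfolding A_def B_def by (simp add: diff_divide_distrib)
      qed
      have "ln (1 - (norm (H w))\<^sup>2) = ln A + ln B - 2 * ln (norm (E w))"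
        unfolding * using AB En elim by (simp add: ln_div ln_mult ln_realpow)
      then show ?case unfolding A_def B_def by simp
    qed
  qed
qed

section \<open>A Picard theorem for ramified values\<close>

text \<open>The powers with exponent \<open>- \<alpha> a\<close> have harmonic logarithm off
  \<open>T\<close> and fix the cone order at \<open>a\<close>; by themselves they form a flat
  metric. The factors containing \<open>2 * \<beta>\<close> carry all the curvature.\<close>

definition cone_density :: "complex set \<Rightarrow> (complex \<Rightarrow> real) \<Rightarrow> real \<Rightarrow> complex \<Rightarrow> real" where
  "cone_density T \<alpha> \<beta> w = (\<Prod>a\<in>T. norm (w - a) powr - \<alpha> a * (1 + norm (w - a) powr (2 * \<beta>)))"

text \<open>Both comparisons are made with \<open>1 + norm (w - a)\<close>, which behaves like a
  constant near \<open>T\<close> and like \<open>norm w\<close> at infinity, so one pair of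
  constants covers the plane. They come from the least and greatest distance within
  \<open>T\<close>; the 1 included in \<open>P\<close> caps the former, bounds the latter below and
  keeps \<open>P\<close> nonempty when \<open>T\<close> is a singleton.\<close>

lemma finite_separation:
  fixes T :: "complex set"
  assumes "finite T"
  obtains c C :: real where "0 < c" "c \<le> 1" "1 \<le> C"
    "\<And>a b w. a \<in> T \<Longrightarrow> b \<in> T \<Longrightarrow> a \<noteq> b \<Longrightarrow> norm (w - a) \<le> norm (w - b) \<Longrightarrow> c * (1 + norm (w - a)) \<le> norm (w - b)"
    "\<And>a b w. a \<in> T \<Longrightarrow> b \<in> T \<Longrightarrow> norm (w - b) \<le> C * (1 + norm (w - a))"
proof -
  define P where "P = insert 1 ((\<lambda>(a, b). norm (a - b)) ` {(a, b). a \<in> T \<and> b \<in> T \<and> a \<noteq> b})"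
  have "finite {(a, b). a \<in> T \<and> b \<in> T \<and> a \<noteq> b}"
    by (rule finite_subset[of _ "T \<times> T"]) (use assms in auto)
  then have P: "finite P" "P \<noteq> {}" by (auto simp: P_def)
  have Ppos: "p > 0" if "p \<in> P" for p using that by (auto simp: P_def)
  define \<delta> where "\<delta> = Min P"
  define \<Delta> where "\<Delta> = Max P"
  have \<delta>: "\<delta> > 0" "\<delta> \<le> 1" using P Ppos Min_in[OF P] by (auto simp: \<delta>_def P_def)
  have \<Delta>: "\<Delta> \<ge> 1" using P by (auto simp: \<Delta>_def P_def)
  have ab: "\<delta> \<le> norm (a - b)" "norm (a - b) \<le> \<Delta>" if "a \<in> T" "b \<in> T" "a \<noteq> b" for a b
  proof -
    have "norm (a - b) \<in> P" using that by (force simp: P_def)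
    then show "\<delta> \<le> norm (a - b)" "norm (a - b) \<le> \<Delta>" using P by (auto simp: \<delta>_def \<Delta>_def)
  qed
  show ?thesis
  proof (rule that[of "\<delta> / 4" \<Delta>])
    fix a b w assume h: "a \<in> T" "b \<in> T" "a \<noteq> b" "norm (w - a) \<le> norm (w - b)"
    have tri: "norm (a - b) \<le> norm (w - a) + norm (w - b)"
      using norm_triangle_ineq4[of "w - b" "w - a"] by (simp add: norm_minus_commute)
    have hb: "\<delta> / 2 \<le> norm (w - b)" using tri ab(1)[OF h(1-3)] h(4) by linarith
    show "\<delta> / 4 * (1 + norm (w - a)) \<le> norm (w - b)"
    proof (cases "norm (w - a) \<le> 1")
      case True
      then have "\<delta> / 4 * (1 + norm (w - a)) \<le> \<delta> / 4 * 2" using \<delta> by (intro mult_left_mono) auto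
      then show ?thesis using hb by linarith
    next
      case False
      then have "\<delta> / 4 * (1 + norm (w - a)) \<le> 1 / 4 * (1 + norm (w - a))" using \<delta> by (intro mult_right_mono) auto
      also have "1 / 4 * (1 + norm (w - a)) \<le> norm (w - b)"
      proof -
        have "1 < norm (w - a)" using False by simp
        then have "1 + norm (w - a) \<le> 4 * norm (w - b)" using h(4) by simp
        then show ?thesis by simp
      qed
      finally show ?thesis .
    qed
  next
    fix a b w assume h: "a \<in> T" "b \<in> T"
    have "norm (w - b) \<le> norm (w - a) + norm (a - b)"
      using norm_triangle_ineq[of "w - a" "a - b"] by simp
    also have "norm (a - b) \<le> \<Delta>" using ab(2)[OF h] \<Delta> by (cases "a = b") auto
    finally have "norm (w - b) \<le> 1 * norm (w - a) + \<Delta>" by simp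
    also have "\<dots> \<le> \<Delta> * norm (w - a) + \<Delta>" using \<Delta> by (intro add_right_mono mult_right_mono) auto
    finally show "norm (w - b) \<le> \<Delta> * (1 + norm (w - a))" by (simp add: algebra_simps)
  qed (use \<delta> \<Delta> in auto)
qed

text \<open>Compares the density with the curvature terms of \<open>ahlfors_maximum\<close>, taking
  for \<open>a\<close> the point of \<open>T\<close> nearest to \<open>w\<close>. Near
  \<open>a\<close> the density has order \<open>- \<alpha> a\<close> and the term order
  \<open>\<beta> - 1\<close>, whence the assumption \<open>\<alpha> a + \<beta> \<le> 1\<close>. At
  infinity the density has order \<open>2 * \<beta> * card T\<close> minus the sum of the
  \<open>\<alpha> a\<close> and the term has order \<open>- 1 - \<beta>\<close>, whence the
  assumption on the sum.\<close>

lemma cone_density_bound: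
  fixes T :: "complex set"
  assumes T: "finite T" "T \<noteq> {}" and \<alpha>: "\<And>a. a \<in> T \<Longrightarrow> 0 < \<alpha> a" "\<And>a. a \<in> T \<Longrightarrow> \<alpha> a + \<beta> \<le> 1"
    and \<beta>: "\<beta> > 0" and sum: "(\<Sum>a\<in>T. \<alpha> a) \<ge> 1 + \<beta> + 2 * \<beta> * real (card T)"
  obtains K where "K > 0"
    "\<And>w. w \<notin> T \<Longrightarrow> \<exists>a\<in>T. cone_density T \<alpha> \<beta> w \<le> K * (norm (w - a) powr (\<beta> - 1) / (1 + norm (w - a) powr (2 * \<beta>)))"
proof -
  obtain c C where c: "0 < c" "c \<le> 1" and C: "1 \<le> C"
    and lo: "\<And>a b w. a \<in> T \<Longrightarrow> b \<in> T \<Longrightarrow> a \<noteq> b \<Longrightarrow> norm (w - a) \<le> norm (w - b) \<Longrightarrow> c * (1 + norm (w - a)) \<le> norm (w - b)"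
    and hi: "\<And>a b w. a \<in> T \<Longrightarrow> b \<in> T \<Longrightarrow> norm (w - b) \<le> C * (1 + norm (w - a))"
    using finite_separation[OF T(1)] by metis
  define K1 where "K1 = (1 / c) * (1 + C powr (2 * \<beta>))"
  have CC: "1 + C powr (2 * \<beta>) \<ge> 1" by simp
  have K1c: "1 + C powr (2 * \<beta>) \<le> K1"
    using c CC mult_right_mono[of 1 "1 / c" "1 + C powr (2 * \<beta>)"] by (simp add: K1_def)
  have K1: "K1 \<ge> 1" using K1c CC by linarith
  define K where "K = 2 * K1 ^ card T"
  show ?thesis
  proof (rule that[of K])
    show "K > 0" using K1 by (simp add: K_def)
    fix w assume w: "w \<notin> T"
    define a where "a = arg_min_on (\<lambda>b. norm (w - b)) T"
    have a: "a \<in> T" "\<And>b. b \<in> T \<Longrightarrow> norm (w - a) \<le> norm (w - b)"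
      using arg_min_if_finite[OF T, of "\<lambda>b. norm (w - b)"] by (auto simp: a_def not_less)
    define d where "d = norm (w - a)"
    have d: "d > 0" using w a by (auto simp: d_def)
    \<comment> \<open>\<open>e\<close> corrects the nearest factor: all other distances are
      comparable with \<open>1 + d\<close>, whereas \<open>d\<close> itself may be tiny.\<close>
    define e where "e = (1 + d) powr \<alpha> a * d powr - \<alpha> a"
    have one: "1 + norm (w - b) powr (2 * \<beta>) \<le> (1 + C powr (2 * \<beta>)) * (1 + d) powr (2 * \<beta>)" if b: "b \<in> T" for b
    proof -
      have "norm (w - b) powr (2 * \<beta>) \<le> (C * (1 + d)) powr (2 * \<beta>)"
        using hi[OF a(1) b, of w] \<beta> by (intro powr_mono2) (auto simp: d_def)
      also have "\<dots> = C powr (2 * \<beta>) * (1 + d) powr (2 * \<beta>)" using C d by (simp add: powr_mult)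
      finally have "norm (w - b) powr (2 * \<beta>) \<le> C powr (2 * \<beta>) * (1 + d) powr (2 * \<beta>)" .
      moreover have "1 \<le> (1 + d) powr (2 * \<beta>)" using d \<beta> by (intro ge_one_powr_ge_zero) auto
      ultimately show ?thesis by (simp add: distrib_right)
    qed
    have fac: "norm (w - b) powr - \<alpha> b * (1 + norm (w - b) powr (2 * \<beta>))
        \<le> K1 * (1 + d) powr (2 * \<beta> - \<alpha> b) * (if b = a then e else 1)" if b: "b \<in> T" for b
    proof (cases "b = a")
      case True
      have "norm (w - b) powr - \<alpha> b * (1 + norm (w - b) powr (2 * \<beta>)) \<le> d powr - \<alpha> a * (K1 * (1 + d) powr (2 * \<beta>))"
        unfolding True d_def[symmetric]
      proof (intro mult_left_mono)
        have "1 + d powr (2 * \<beta>) \<le> (1 + C powr (2 * \<beta>)) * (1 + d) powr (2 * \<beta>)" using one[OF a(1)] by (simp add: d_def)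
        also have "\<dots> \<le> K1 * (1 + d) powr (2 * \<beta>)" using K1c by (intro mult_right_mono) auto
        finally show "1 + d powr (2 * \<beta>) \<le> K1 * (1 + d) powr (2 * \<beta>)" .
      qed simp
      also have "\<dots> = K1 * (1 + d) powr (2 * \<beta> - \<alpha> b) * e"
        using d by (simp add: True e_def powr_diff)
      finally show ?thesis using True by simp
    next
      case False
      have "norm (w - b) powr - \<alpha> b \<le> (c * (1 + d)) powr - \<alpha> b"
        using lo[OF a(1) b _ a(2)[OF b]] False \<alpha>(1)[OF b] c d by (intro powr_mono2') (auto simp: d_def intro!: mult_pos_pos add_pos_nonneg)
      also have "\<dots> = c powr - \<alpha> b * (1 + d) powr - \<alpha> b" using c d by (simp add: powr_mult)
      also have "\<dots> \<le> (1 / c) * (1 + d) powr - \<alpha> b"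
      proof (intro mult_right_mono)
        have "c powr - \<alpha> b \<le> c powr -1" using c \<alpha>(2)[OF b] \<beta> by (intro powr_mono') auto
        also have "\<dots> = 1 / c" using c by (simp add: powr_minus_divide)
        finally show "c powr - \<alpha> b \<le> 1 / c" .
      qed simp
      finally have "norm (w - b) powr - \<alpha> b * (1 + norm (w - b) powr (2 * \<beta>))
         \<le> (1 / c * (1 + d) powr - \<alpha> b) * ((1 + C powr (2 * \<beta>)) * (1 + d) powr (2 * \<beta>))"
        using one[OF b] c by (intro mult_mono) auto
      also have "\<dots> = K1 * (1 + d) powr (2 * \<beta> - \<alpha> b)"
        using d by (simp add: K1_def powr_diff powr_minus_divide)
      finally show ?thesis using False by simp
    qed
    have "cone_density T \<alpha> \<beta> w \<le> (\<Prod>b\<in>T. K1 * (1 + d) powr (2 * \<beta> - \<alpha> b) * (if b = a then e else 1))"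
      unfolding cone_density_def by (intro prod_mono conjI fac) (auto intro: add_nonneg_nonneg)
    also have "\<dots> = K1 ^ card T * (1 + d) powr (\<Sum>b\<in>T. 2 * \<beta> - \<alpha> b) * e"
      using T a d by (simp add: prod.distrib powr_sum)
    also have "(\<Sum>b\<in>T. 2 * \<beta> - \<alpha> b) = 2 * \<beta> * real (card T) - (\<Sum>b\<in>T. \<alpha> b)"
      by (simp add: sum_subtractf)
    also have "K1 ^ card T * (1 + d) powr (2 * \<beta> * real (card T) - (\<Sum>b\<in>T. \<alpha> b)) * e
        \<le> K1 ^ card T * (1 + d) powr (- 1 - \<beta>) * e"
      using sum d K1 by (intro mult_right_mono mult_left_mono powr_mono) (auto simp: e_def)
    also have "\<dots> = K1 ^ card T * ((1 + d) powr (\<alpha> a - 1 - \<beta>) * d powr - \<alpha> a)"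
      by (simp add: e_def powr_add[symmetric] algebra_simps)
    also have "\<dots> \<le> K1 ^ card T * ((1 + d) powr (-2 * \<beta>) * d powr (\<beta> - 1))"
    proof (intro mult_left_mono)
      \<comment> \<open>The factor split off is \<open>d / (1 + d)\<close> to the power
        \<open>1 - \<beta> - \<alpha> a\<close>, at most 1 because this exponent is
        nonnegative.\<close>
      have "(1 + d) powr (\<alpha> a - 1 - \<beta>) * d powr - \<alpha> a = ((1 + d) powr (-2 * \<beta>) * d powr (\<beta> - 1)) * ((1 + d) powr - (1 - \<beta> - \<alpha> a) * d powr (1 - \<beta> - \<alpha> a))"
        using d by (simp add: powr_add[symmetric] algebra_simps)
      also have "\<dots> \<le> ((1 + d) powr (-2 * \<beta>) * d powr (\<beta> - 1)) * 1"
      proof (intro mult_left_mono)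
        have "d powr (1 - \<beta> - \<alpha> a) \<le> (1 + d) powr (1 - \<beta> - \<alpha> a)" using d \<alpha>(2)[OF a(1)] by (intro powr_mono2) auto
        then show "(1 + d) powr - (1 - \<beta> - \<alpha> a) * d powr (1 - \<beta> - \<alpha> a) \<le> 1"
          unfolding powr_minus_divide using d by simp
      qed simp
      finally show "(1 + d) powr (\<alpha> a - 1 - \<beta>) * d powr - \<alpha> a \<le> (1 + d) powr (-2 * \<beta>) * d powr (\<beta> - 1)" by simp
    qed (use K1 in simp)
    also have "\<dots> \<le> K1 ^ card T * (2 / (1 + d powr (2 * \<beta>)) * d powr (\<beta> - 1))"
    proof (intro mult_left_mono mult_right_mono)
      have "d powr (2 * \<beta>) \<le> (1 + d) powr (2 * \<beta>)" using d \<beta> by (intro powr_mono2) auto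
      moreover have "1 \<le> (1 + d) powr (2 * \<beta>)" using d \<beta> by (intro ge_one_powr_ge_zero) auto
      ultimately have "1 + d powr (2 * \<beta>) \<le> 2 * (1 + d) powr (2 * \<beta>)" by linarith
      then have "1 / (1 + d) powr (2 * \<beta>) \<le> 2 / (1 + d powr (2 * \<beta>))"
        using d by (simp add: field_simps add_pos_nonneg)
      then show "(1 + d) powr (-2 * \<beta>) \<le> 2 / (1 + d powr (2 * \<beta>))" by (simp add: powr_minus_divide)
    qed (use K1 in auto)
    finally have "cone_density T \<alpha> \<beta> w \<le> K * (d powr (\<beta> - 1) / (1 + d powr (2 * \<beta>)))"
      by (simp add: K_def mult_ac)
    then show "\<exists>a\<in>T. cone_density T \<alpha> \<beta> w \<le> K * (norm (w - a) powr (\<beta> - 1) / (1 + norm (w - a) powr (2 * \<beta>)))"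
      using a(1) unfolding d_def by blast
  qed
qed

section \<open>Limits of the pulled-back density at special points\<close>

lemma zero_factorization:
  assumes h: "h analytic_on {z}" "h z = 0" and nz: "\<forall>\<^sub>F w in at z. h w \<noteq> 0"
  shows "\<exists>(k::nat) r \<psi>. 0 < k \<and> 0 < r \<and> \<psi> holomorphic_on ball z r \<and>
    (\<forall>w\<in>ball z r. h w = (w - z) ^ k * \<psi> w \<and> \<psi> w \<noteq> 0 \<and>
       deriv h w = (w - z) ^ (k - 1) * (of_nat k * \<psi> w + (w - z) * deriv \<psi> w))"
proof -
  obtain e where e: "e > 0" "h holomorphic_on ball z e" using h analytic_at_ball by blast
  have "\<not> h constant_on ball z e"
  proof
    assume "h constant_on ball z e"
    then have "h w = 0" if "w \<in> ball z e" for w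
      using that h(2) e(1) unfolding constant_on_def by (metis centre_in_ball)
    then have "\<forall>\<^sub>F w in at z. h w = 0" using eventually_at_in_open'[of "ball z e" z] e(1)
      by (auto elim: eventually_mono)
    with nz have "\<forall>\<^sub>F w in at z. False" by eventually_elim simp
    then show False by simp
  qed
  then obtain \<psi> r k where k: "0 < k" and r: "0 < r" "ball z r \<subseteq> ball z e" and \<psi>: "\<psi> holomorphic_on ball z r"
    and fac: "\<And>w. w \<in> ball z r \<Longrightarrow> h w = (w - z) ^ k * \<psi> w" and \<psi>0: "\<And>w. w \<in> ball z r \<Longrightarrow> \<psi> w \<noteq> 0"
    using holomorphic_factor_zero_nonconstant[OF e(2) open_ball connected_ball, of z] h(2) e(1) by (metis centre_in_ball)
  have dh: "deriv h w = (w - z) ^ (k - 1) * (of_nat k * \<psi> w + (w - z) * deriv \<psi> w)" if w: "w \<in> ball z r" for w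
  proof -
    have "(\<psi> has_field_derivative deriv \<psi> w) (at w)" using \<psi> w by (intro holomorphic_derivI[of _ "ball z r"]) auto
    then have "((\<lambda>w. (w - z) ^ k * \<psi> w) has_field_derivative (of_nat k * (w - z) ^ (k - 1)) * \<psi> w + (w - z) ^ k * deriv \<psi> w) (at w)"
      by (auto intro!: derivative_eq_intros)
    then have "(h has_field_derivative (of_nat k * (w - z) ^ (k - 1)) * \<psi> w + (w - z) ^ k * deriv \<psi> w) (at w)"
      by (rule has_field_derivative_transform_within_open[of _ _ _ "ball z r"]) (use w fac in auto)
    then have "deriv h w = (of_nat k * (w - z) ^ (k - 1)) * \<psi> w + (w - z) ^ k * deriv \<psi> w"
      by (rule DERIV_imp_deriv)
    also have "(w - z) ^ k = (w - z) ^ (k - 1) * (w - z)" using k by (metis Suc_diff_1 power_Suc2)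
    finally show ?thesis by (simp add: algebra_simps)
  qed
  show ?thesis
    by (intro exI[of _ k] exI[of _ r] exI[of _ \<psi>] conjI ballI k r(1) \<psi> fac \<psi>0 dh)
qed

text \<open>If \<open>h\<close> has a zero of order \<open>k\<close>, then
  \<open>norm (deriv h w) * norm (h w) powr p\<close> is at most of the order of |w - z| to the
  power k (1 + p) - 1. The order stays abstract: the second property bounds it below by any order of
  contact already known. The exponent \<open>p\<close> will be \<open>- \<alpha> a\<close> at cone
  points and \<open>s - 2\<close> at poles.\<close>

lemma zero_weight_limit:
  assumes h: "h analytic_on {z}" "h z = 0" and nz: "\<forall>\<^sub>F w in at z. h w \<noteq> 0"
  obtains k :: nat where
    "\<And>p Y l. real k * (1 + p) > 1 \<Longrightarrow> (Y \<longlongrightarrow> l) (at z) \<Longrightarrow> ((\<lambda>w. norm (deriv h w) * norm (h w) powr p * Y w) \<longlongrightarrow> 0) (at z)"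
    "\<And>m C. \<forall>\<^sub>F w in at z. norm (h w) \<le> C * norm (w - z) ^ m \<Longrightarrow> m \<le> k"
    "k > 0"
proof -
  obtain k r \<psi> where k: "0 < (k::nat)" and r: "0 < r" and \<psi>: "\<psi> holomorphic_on ball z r"
    and fac': "\<forall>w\<in>ball z r. h w = (w - z) ^ k * \<psi> w \<and> \<psi> w \<noteq> 0 \<and>
       deriv h w = (w - z) ^ (k - 1) * (of_nat k * \<psi> w + (w - z) * deriv \<psi> w)"
    using zero_factorization[OF h nz] by blast
  note fac = fac'[rule_format, THEN conjunct1]
    and \<psi>0 = fac'[rule_format, THEN conjunct2, THEN conjunct1]
    and dh0 = fac'[rule_format, THEN conjunct2, THEN conjunct2]
  have \<psi>z: "\<psi> analytic_on {z}" using \<psi> r analytic_at_ball by blast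
  note c\<psi> = analytic_tendsto(2)[OF \<psi>z] and c\<psi>' = analytic_tendsto(2)[OF analytic_deriv[OF \<psi>z]]
  have \<psi>z0: "\<psi> z \<noteq> 0" using \<psi>0 r by simp
  have inb: "\<forall>\<^sub>F w in at z. w \<in> ball z r \<and> w \<noteq> z"
    using r eventually_at_in_open[of "ball z r" z] by (auto elim: eventually_mono)
  define \<theta> where "\<theta> = (\<lambda>w. of_nat k * \<psi> w + (w - z) * deriv \<psi> w)"
  have dh: "deriv h w = (w - z) ^ (k - 1) * \<theta> w" if w: "w \<in> ball z r" for w
    using dh0[OF w] by (simp add: \<theta>_def)
  show ?thesis
  proof (rule that[of k])
    fix p l :: real and Y assume p: "real k * (1 + p) > 1" and Y: "(Y \<longlongrightarrow> l) (at z)"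
    define s where "s = real k * (1 + p) - 1"
    have s: "s > 0" using p by (simp add: s_def)
    have "((\<lambda>w. norm (w - z)) \<longlongrightarrow> norm (z - z)) (at z)" by (intro tendsto_intros)
    then have n0: "((\<lambda>w. norm (w - z)) \<longlongrightarrow> 0) (at z)" by simp
    have "((\<lambda>w. norm (w - z) powr s) \<longlongrightarrow> 0 powr s) (at z)"
      using s by (intro tendsto_powr2[OF n0 tendsto_const]) auto
    then have 1: "((\<lambda>w. norm (w - z) powr s) \<longlongrightarrow> 0) (at z)" using s by simp
    have "((\<lambda>w. norm (w - z) powr s * (norm (\<theta> w) * norm (\<psi> w) powr p * Y w)) \<longlongrightarrow>
        0 * (norm (of_nat k * \<psi> z + (z - z) * deriv \<psi> z) * norm (\<psi> z) powr p * l)) (at z)"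
      unfolding \<theta>_def using \<psi>z0 by (intro tendsto_intros 1 Y c\<psi> c\<psi>') auto
    then have "((\<lambda>w. norm (w - z) powr s * (norm (\<theta> w) * norm (\<psi> w) powr p * Y w)) \<longlongrightarrow> 0) (at z)" by simp
    then show "((\<lambda>w. norm (deriv h w) * norm (h w) powr p * Y w) \<longlongrightarrow> 0) (at z)"
    proof (rule Lim_transform_eventually)
      show "\<forall>\<^sub>F w in at z. norm (w - z) powr s * (norm (\<theta> w) * norm (\<psi> w) powr p * Y w) = norm (deriv h w) * norm (h w) powr p * Y w"
        using inb
      proof eventually_elim
        case (elim w)
        define t where "t = norm (w - z)"
        have t: "t > 0" using elim by (simp add: t_def)
        have "norm (deriv h w) = t ^ (k - 1) * norm (\<theta> w)" "norm (h w) = t ^ k * norm (\<psi> w)"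
          using dh fac elim by (auto simp: norm_mult norm_power t_def)
        moreover have "t ^ (k - 1) = t powr (real k - 1)" using t k by (simp add: powr_realpow[symmetric])
        moreover have "(t ^ k * norm (\<psi> w)) powr p = t powr (real k * p) * norm (\<psi> w) powr p"
          using t by (simp add: powr_mult powr_powr powr_realpow[symmetric])
        moreover have "t powr s = t powr (real k - 1) * t powr (real k * p)"
          by (simp add: s_def powr_add[symmetric] algebra_simps)
        ultimately show ?case by (simp add: t_def[symmetric])
      qed
    qed
  next
    fix m C assume le: "\<forall>\<^sub>F w in at z. norm (h w) \<le> C * norm (w - z) ^ m"
    show "m \<le> k"
    proof (rule ccontr)
      assume "\<not> m \<le> k"
      then have mk: "m = k + (m - k)" "m - k > 0" by auto
      have "\<forall>\<^sub>F w in at z. norm (\<psi> w) \<le> C * norm (w - z) ^ (m - k)"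
        using le inb
      proof eventually_elim
        case (elim w)
        have "norm (w - z) ^ k * norm (\<psi> w) \<le> C * norm (w - z) ^ (k + (m - k))"
          using elim fac mk by (simp add: norm_mult norm_power)
        then have "norm (w - z) ^ k * norm (\<psi> w) \<le> norm (w - z) ^ k * (C * norm (w - z) ^ (m - k))"
          by (simp add: power_add mult_ac)
        then show ?case using elim by (subst (asm) mult_le_cancel_left_pos) auto
      qed
      moreover have "((\<lambda>w. norm (\<psi> w)) \<longlongrightarrow> norm (\<psi> z)) (at z)" by (intro tendsto_intros c\<psi>)
      moreover have "((\<lambda>w. C * norm (w - z) ^ (m - k)) \<longlongrightarrow> C * norm (z - z) ^ (m - k)) (at z)"
        by (intro tendsto_intros)
      ultimately have "norm (\<psi> z) \<le> C * norm (z - z) ^ (m - k)"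
        by (intro tendsto_le[of "at z"]) auto
      then show False using mk(2) \<psi>z0 by (simp add: power_0_left)
    qed
  qed (rule k)
qed

lemma eventually_at_eventually_nhds:
  fixes z :: "'a :: t1_space"
  assumes "\<forall>\<^sub>F w in at z. P w"
  shows "\<forall>\<^sub>F w in at z. \<forall>\<^sub>F x in nhds w. P x"
proof -
  obtain U where U: "open U" "z \<in> U" "\<And>w. w \<in> U \<Longrightarrow> w \<noteq> z \<Longrightarrow> P w"
    using assms by (auto simp: eventually_at_topological)
  have "\<forall>\<^sub>F x in nhds w. P x" if "w \<in> U" "w \<noteq> z" for w
    unfolding eventually_nhds
    by (intro exI[of _ "U - {z}"]) (use U that in auto)
  then show ?thesis using U by (auto simp: eventually_at_topological)
qed

lemma eventually_nhds_imp_at: "\<forall>\<^sub>F w in nhds z. P w \<Longrightarrow> \<forall>\<^sub>F w in at z. P w"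
  by (auto simp: eventually_at_filter elim: eventually_mono)

lemma chordal_bound_chart:
  assumes G: "shol G {z}" "G z = Some a" and bd: "\<forall>\<^sub>F w in nhds z. chordal (G w) (Some a) \<le> C * norm (w - z) ^ m"
  shows "\<forall>\<^sub>F w in nhds z. norm (the (G w) - a) \<le> ((1 + (norm a)\<^sup>2) * C) * norm (w - z) ^ m"
proof -
  have "\<forall>\<^sub>F w in nhds z. chordal (G w) (G z) < 1 / sqrt (1 + (norm a)\<^sup>2)"
    by (rule order_tendstoD(2)[OF shol_tendsto_chordal[OF G(1)]]) simp
  with bd show ?thesis
  proof eventually_elim
    case (elim w)
    then obtain b where b: "G w = Some b" "norm (b - a) \<le> (1 + (norm a)\<^sup>2) * chordal (G w) (Some a)"
      using chordal_near_finite[of a "norm a" "G w"] G(2) by (metis order_refl)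
    note b(2)
    also have "(1 + (norm a)\<^sup>2) * chordal (G w) (Some a) \<le> (1 + (norm a)\<^sup>2) * (C * norm (w - z) ^ m)"
      using elim by (intro mult_left_mono) auto
    finally show ?case using b(1) by (simp add: mult_ac)
  qed
qed

lemma cone_density_tendsto:
  assumes "finite T" "\<phi> \<midarrow>z\<rightarrow> w" "w \<notin> T"
  shows "((\<lambda>x. cone_density T \<alpha> \<beta> (\<phi> x)) \<longlongrightarrow> cone_density T \<alpha> \<beta> w) (at z)"
  unfolding cone_density_def using assms by (intro tendsto_intros) auto

text \<open>The value \<open>a\<close> is taken with some order \<open>k \<ge> m\<close>, so
  derivative times density vanishes to order k (1 - \<alpha> a) - 1. Since 1 - \<alpha> a is
  positive, the assumption on \<open>m\<close> passes to \<open>k\<close> and makes this exponent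
  positive.\<close>

lemma cone_density_at_cone_point:
  assumes G: "shol G {z}" "G z = Some a" and T: "finite T" "a \<in> T" and \<beta>: "\<beta> > 0"
    and nz: "\<forall>\<^sub>F w in at z. G w \<noteq> Some a"
    and m: "real m * (1 - \<alpha> a) > 1" and \<alpha>: "\<alpha> a < 1"
    and bd: "\<forall>\<^sub>F w in nhds z. chordal (G w) (Some a) \<le> C * norm (w - z) ^ m"
  shows "((\<lambda>w. norm (deriv (\<lambda>w. the (G w)) w) * cone_density T \<alpha> \<beta> (the (G w))) \<longlongrightarrow> 0) (at z)"
proof -
  define \<phi> where "\<phi> = (\<lambda>w. the (G w))"
  have \<phi>: "\<phi> analytic_on {z}" "\<forall>\<^sub>F w in nhds z. G w = Some (\<phi> w)"
    using shol_chart[OF G(1)] G(2) by (auto simp: \<phi>_def)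
  have \<phi>z: "\<phi> z = a" using G(2) by (simp add: \<phi>_def)
  have c\<phi>: "(\<phi> \<longlongrightarrow> a) (at z)" using analytic_tendsto(2)[OF \<phi>(1)] \<phi>z by simp
  define h where "h = (\<lambda>w. \<phi> w - a)"
  have h: "h analytic_on {z}" unfolding h_def using \<phi>(1) by (intro analytic_intros) auto
  have hz: "h z = 0" by (simp add: h_def \<phi>z)
  have hnz: "\<forall>\<^sub>F w in at z. h w \<noteq> 0"
    using nz eventually_nhds_imp_at[OF \<phi>(2)] by eventually_elim (auto simp: h_def)
  obtain k :: nat where
    k: "\<And>p Y l. real k * (1 + p) > 1 \<Longrightarrow> (Y \<longlongrightarrow> l) (at z) \<Longrightarrow> ((\<lambda>w. norm (deriv h w) * norm (h w) powr p * Y w) \<longlongrightarrow> 0) (at z)"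
    and mk: "\<And>m C. \<forall>\<^sub>F w in at z. norm (h w) \<le> C * norm (w - z) ^ m \<Longrightarrow> m \<le> k"
    by (rule zero_weight_limit[OF h hz hnz]; rule that; blast)
  have "m \<le> k"
  proof (rule mk)
    show "\<forall>\<^sub>F w in at z. norm (h w) \<le> ((1 + (norm a)\<^sup>2) * C) * norm (w - z) ^ m"
      using eventually_nhds_imp_at[OF chordal_bound_chart[OF G bd]] by (simp add: h_def \<phi>_def)
  qed
  then have "real m * (1 - \<alpha> a) \<le> real k * (1 - \<alpha> a)" using \<alpha> by (intro mult_right_mono) auto
  with m have km: "real k * (1 + - \<alpha> a) > 1" by simp
  define A where "A = (\<lambda>w. norm (\<phi> w - a) powr (2 * \<beta>))"
  define Y where "Y = (\<lambda>w. (1 + A w) *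
     (\<Prod>b\<in>T - {a}. norm (\<phi> w - b) powr - \<alpha> b * (1 + norm (\<phi> w - b) powr (2 * \<beta>))))"
  have n0: "((\<lambda>w. norm (\<phi> w - a)) \<longlongrightarrow> 0) (at z)"
    using tendsto_norm[OF tendsto_diff[OF c\<phi> tendsto_const[of a]]] by simp
  have "(A \<longlongrightarrow> 0 powr (2 * \<beta>)) (at z)"
    unfolding A_def using \<beta> by (intro tendsto_powr2[OF n0 tendsto_const]) auto
  then have "(Y \<longlongrightarrow> (1 + 0 powr (2 * \<beta>)) * (\<Prod>b\<in>T - {a}. norm (a - b) powr - \<alpha> b * (1 + norm (a - b) powr (2 * \<beta>)))) (at z)"
    unfolding Y_def by (intro tendsto_intros c\<phi>) auto
  from k[OF km this]
  have "((\<lambda>w. norm (deriv h w) * norm (h w) powr - \<alpha> a * Y w) \<longlongrightarrow> 0) (at z)" .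
  then show ?thesis
  proof (rule Lim_transform_eventually)
    show "\<forall>\<^sub>F w in at z. norm (deriv h w) * norm (h w) powr - \<alpha> a * Y w
       = norm (deriv (\<lambda>w. the (G w)) w) * cone_density T \<alpha> \<beta> (the (G w))"
      using eventually_nhds_imp_at[OF eventually_nhds_analytic[OF \<phi>(1)]]
    proof eventually_elim
      case (elim w)
      have "deriv h w = deriv \<phi> w"
        unfolding h_def using elim by (subst deriv_diff) (auto simp: analytic_on_imp_differentiable_at)
      moreover have "cone_density T \<alpha> \<beta> (\<phi> w) = norm (h w) powr - \<alpha> a * Y w"
        unfolding cone_density_def Y_def A_def h_def using T by (simp add: prod.remove[of T a])
      ultimately show ?case by (simp add: \<phi>_def)
    qed
  qed
qed

text \<open>With h = 1 / \<phi> the derivative of \<phi> has modulus |h'| / |h|^2, and the density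
  is |h|^s times a factor with a finite limit, where \<open>s\<close> is the sum of the
  \<open>\<alpha> a - 2 * \<beta>\<close>. The decay at infinity thus acts like a cone exponent,
  with \<open>s - 1\<close> in the place of \<open>1 - \<alpha> a\<close>.\<close>

lemma cone_density_at_pole:
  assumes G: "shol G {z}" "G z = None" and T: "finite T" and \<beta>: "\<beta> > 0"
    and nz: "\<forall>\<^sub>F w in at z. G w \<noteq> None"
    and m: "real m * ((\<Sum>a\<in>T. \<alpha> a - 2 * \<beta>) - 1) > 1" and s1: "(\<Sum>a\<in>T. \<alpha> a - 2 * \<beta>) > 1"
    and bd: "\<forall>\<^sub>F w in nhds z. chordal (G w) None \<le> C * norm (w - z) ^ m"
  shows "((\<lambda>w. norm (deriv (\<lambda>w. the (G w)) w) * cone_density T \<alpha> \<beta> (the (G w))) \<longlongrightarrow> 0) (at z)"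
proof -
  define s where "s = (\<Sum>a\<in>T. \<alpha> a - 2 * \<beta>)"
  define h where "h = (\<lambda>w. the (sinv (G w)))"
  have G': "shol (\<lambda>w. sinv (G w)) {z}" "sinv (G z) = Some 0" using G by auto
  have h: "h analytic_on {z}" and hev: "\<forall>\<^sub>F w in nhds z. sinv (G w) = Some (h w)"
    using shol_chart[OF G'(1)] G'(2) by (auto simp: h_def)
  have hz: "h z = 0" using G'(2) by (simp add: h_def)
  have ch: "(h \<longlongrightarrow> 0) (at z)" using analytic_tendsto(2)[OF h] hz by simp
  have Gh: "\<forall>\<^sub>F w in at z. h w \<noteq> 0 \<and> the (G w) = inverse (h w)"
    using nz eventually_nhds_imp_at[OF hev] by eventually_elim (auto simp: sinv_eq_iff split: if_splits)
  then have hnz: "\<forall>\<^sub>F w in at z. h w \<noteq> 0" by eventually_elim simp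
  obtain k :: nat where
    k: "\<And>p Y l. real k * (1 + p) > 1 \<Longrightarrow> (Y \<longlongrightarrow> l) (at z) \<Longrightarrow> ((\<lambda>w. norm (deriv h w) * norm (h w) powr p * Y w) \<longlongrightarrow> 0) (at z)"
    and mk: "\<And>m C. \<forall>\<^sub>F w in at z. norm (h w) \<le> C * norm (w - z) ^ m \<Longrightarrow> m \<le> k"
    by (rule zero_weight_limit[OF h hz hnz]; rule that; blast)
  have "m \<le> k"
  proof (rule mk)
    have "\<forall>\<^sub>F w in nhds z. chordal (sinv (G w)) (Some 0) \<le> C * norm (w - z) ^ m"
      using bd
    proof eventually_elim
      case (elim w)
      have "chordal (sinv (G w)) (Some 0) = chordal (sinv (G w)) (sinv None)" by (simp only: sinv.simps)
      with elim show ?case by (simp only: chordal_sinv)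
    qed
    from eventually_nhds_imp_at[OF chordal_bound_chart[OF G' this]]
    show "\<forall>\<^sub>F w in at z. norm (h w) \<le> ((1 + (norm 0)\<^sup>2) * C) * norm (w - z) ^ m"
      by (simp add: h_def)
  qed
  then have "real m * (s - 1) \<le> real k * (s - 1)" using s1 by (intro mult_right_mono) (auto simp: s_def)
  with m have km: "real k * (1 + (s - 2)) > 1" by (simp add: s_def)
  define A where "A = (\<lambda>w. norm (h w) powr (2 * \<beta>))"
  define Y where "Y = (\<lambda>w. \<Prod>a\<in>T. norm (1 - a * h w) powr - \<alpha> a * (A w + norm (1 - a * h w) powr (2 * \<beta>)))"
  have n0: "((\<lambda>w. norm (h w)) \<longlongrightarrow> 0) (at z)" using tendsto_norm[OF ch] by simp
  have "(A \<longlongrightarrow> 0 powr (2 * \<beta>)) (at z)"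
    unfolding A_def using \<beta> by (intro tendsto_powr2[OF n0 tendsto_const]) auto
  then have "(Y \<longlongrightarrow> (\<Prod>a\<in>T. norm (1 - a * 0) powr - \<alpha> a * (0 powr (2 * \<beta>) + norm (1 - a * 0) powr (2 * \<beta>)))) (at z)"
    unfolding Y_def by (intro tendsto_intros ch) auto
  from k[OF km this]
  have "((\<lambda>w. norm (deriv h w) * norm (h w) powr (s - 2) * Y w) \<longlongrightarrow> 0) (at z)" .
  then show ?thesis
  proof (rule Lim_transform_eventually)
    show "\<forall>\<^sub>F w in at z. norm (deriv h w) * norm (h w) powr (s - 2) * Y w
       = norm (deriv (\<lambda>w. the (G w)) w) * cone_density T \<alpha> \<beta> (the (G w))"
      using eventually_nhds_imp_at[OF eventually_nhds_analytic[OF h]] Gh eventually_at_eventually_nhds[OF Gh]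
    proof eventually_elim
      case (elim w)
      define u where "u = norm (h w)"
      have u: "u > 0" using elim by (simp add: u_def)
      have "\<forall>\<^sub>F x in nhds w. the (G x) = inverse (h x)" using elim(3) by eventually_elim simp
      then have "deriv (\<lambda>w. the (G w)) w = deriv (\<lambda>x. inverse (h x)) w" by (rule deriv_cong_ev) simp
      also have "((\<lambda>x. inverse (h x)) has_field_derivative - (inverse (h w) * deriv h w * inverse (h w))) (at w)"
        using analytic_derivI[OF elim(1)] elim(2) by (intro DERIV_inverse') auto
      then have "deriv (\<lambda>x. inverse (h x)) w = - (inverse (h w) * deriv h w * inverse (h w))" by (rule DERIV_imp_deriv)
      finally have d: "norm (deriv (\<lambda>w. the (G w)) w) = norm (deriv h w) * u powr - 2"
        using u by (simp add: norm_mult norm_inverse u_def powr_minus powr_numeral power2_eq_square)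
      have "cone_density T \<alpha> \<beta> (inverse (h w)) = (\<Prod>a\<in>T. u powr (\<alpha> a - 2 * \<beta>) *
          (norm (1 - a * h w) powr - \<alpha> a * (u powr (2 * \<beta>) + norm (1 - a * h w) powr (2 * \<beta>))))"
        unfolding cone_density_def
      proof (rule prod.cong)
        fix a assume "a \<in> T"
        define t where "t = norm (1 - a * h w)"
        have t: "t \<ge> 0" by (simp add: t_def)
        have "inverse (h w) - a = (1 - a * h w) / h w" using elim by (simp add: field_simps)
        then have nn: "norm (inverse (h w) - a) = t / u" by (simp add: norm_divide t_def u_def)
        have f1: "(t / u) powr - \<alpha> a = t powr - \<alpha> a * u powr \<alpha> a"
          using t u by (simp add: powr_divide powr_minus_divide)
        have f2: "1 + (t / u) powr (2 * \<beta>) = (u powr (2 * \<beta>) + t powr (2 * \<beta>)) / u powr (2 * \<beta>)"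
          using t u by (simp add: powr_divide add_divide_distrib)
        show "norm (inverse (h w) - a) powr - \<alpha> a * (1 + norm (inverse (h w) - a) powr (2 * \<beta>)) =
          u powr (\<alpha> a - 2 * \<beta>) * (norm (1 - a * h w) powr - \<alpha> a * (u powr (2 * \<beta>) + norm (1 - a * h w) powr (2 * \<beta>)))"
          unfolding nn f1 f2 t_def[symmetric] powr_diff by simp
      qed simp
      also have "\<dots> = u powr s * Y w"
        using u by (simp add: prod.distrib s_def powr_sum Y_def A_def u_def)
      finally have e: "cone_density T \<alpha> \<beta> (inverse (h w)) = u powr s * Y w" .
      have "u powr (s - 2) = u powr - 2 * u powr s" by (simp add: powr_add[symmetric])
      then show ?case using d e elim(2) by (simp add: u_def[symmetric])
    qed
  qed
qed

section \<open>The Ahlfors-Schwarz estimate and the Picard theorem\<close>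

lemma cone_density_pos:
  assumes "finite T" "w \<notin> T" shows "cone_density T \<alpha> \<beta> w > 0"
  unfolding cone_density_def using assms by (intro prod_pos mult_pos_pos) (auto simp: add_pos_nonneg)

lemma cone_density_nonneg: "cone_density T \<alpha> \<beta> w \<ge> 0"
  unfolding cone_density_def by (intro prod_nonneg mult_nonneg_nonneg) (auto simp: add_nonneg_nonneg)

text \<open>At an interior maximum of the pulled-back density times the reciprocal of the Poincare density, the
  Laplacian of the logarithm is nonpositive; this is Ahlfors' form of the Schwarz lemma.\<close>

lemma ahlfors_maximum:
  assumes T: "finite T" and \<phi>: "\<phi> analytic_on {z}" and d0: "deriv \<phi> z \<noteq> 0" and zT: "\<phi> z \<notin> T"
    and \<beta>: "\<beta> > 0" and R: "norm z < R"
    and mx: "\<forall>\<^sub>F w in nhds z. norm (deriv \<phi> w) * cone_density T \<alpha> \<beta> (\<phi> w) * (R\<^sup>2 - (norm w)\<^sup>2)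
       \<le> norm (deriv \<phi> z) * cone_density T \<alpha> \<beta> (\<phi> z) * (R\<^sup>2 - (norm z)\<^sup>2)"
    and a: "a \<in> T"
  shows "\<beta> * norm (deriv \<phi> z) * (norm (\<phi> z - a) powr (\<beta> - 1) / (1 + norm (\<phi> z - a) powr (2 * \<beta>))) \<le> R / (R\<^sup>2 - (norm z)\<^sup>2)"
proof -
  define f where "f = (\<lambda>w. ln (norm (deriv \<phi> w)) + (\<Sum>a\<in>T. - \<alpha> a * ln (norm (\<phi> w - a)) + ln (1 + norm (\<phi> w - a) powr (2 * \<beta>))) + ln (R\<^sup>2 - (norm w)\<^sup>2))"
  have R0: "R > 0" using R norm_ge_zero[of z] by linarith
  have pos: "R\<^sup>2 - (norm w)\<^sup>2 > 0" if "norm w < R" for w :: complex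
    using power_strict_mono[OF that norm_ge_zero, of 2] by simp
  define X where "X = (\<lambda>a. \<beta> * norm (\<phi> z - a) powr (\<beta> - 1) * norm (deriv \<phi> z) / (1 + norm (\<phi> z - a) powr (2 * \<beta>)))"
  have diffa: "(\<lambda>w. \<phi> w - a) analytic_on {z}" for a using \<phi> by (intro analytic_intros) auto
  have dd: "deriv (\<lambda>w. \<phi> w - a) z = deriv \<phi> z" for a
    using \<phi> by (subst deriv_diff) (auto simp: analytic_on_imp_differentiable_at)
  have "lapl (\<lambda>w. - \<alpha> a * ln (norm (\<phi> w - a)) + ln (1 + norm (\<phi> w - a) powr (2 * \<beta>))) z ((X a)\<^sup>2)" if "a \<in> T" for a
  proof -
    have nz: "\<phi> z - a \<noteq> 0" using that zT by auto
    show ?thesis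
      using lapl_add[OF lapl_cmult[OF lapl_ln_norm[OF diffa[of a] nz], of "- \<alpha> a"] lapl_ln_one_plus_powr[OF diffa[of a] nz, of \<beta>]]
      by (simp add: X_def dd)
  qed
  then have "lapl f z (0 + (\<Sum>a\<in>T. (X a)\<^sup>2) + - ((R / (R\<^sup>2 - (norm z)\<^sup>2))\<^sup>2))"
    unfolding f_def using T \<phi> d0 R
    by (intro lapl_add lapl_sum lapl_ln_norm lapl_ln_disc analytic_deriv) auto
  moreover have "\<forall>\<^sub>F w in nhds z. f w \<le> f z"
  proof -
    have fe: "f w = ln (norm (deriv \<phi> w) * cone_density T \<alpha> \<beta> (\<phi> w) * (R\<^sup>2 - (norm w)\<^sup>2))"
      if "deriv \<phi> w \<noteq> 0" "\<phi> w \<notin> T" "norm w < R" for w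
    proof -
      have one: "1 + x powr (2 * \<beta>) \<noteq> 0" for x :: real using powr_ge_zero[of x "2 * \<beta>"] by linarith
      have "ln (cone_density T \<alpha> \<beta> (\<phi> w)) = (\<Sum>a\<in>T. ln (norm (\<phi> w - a) powr - \<alpha> a * (1 + norm (\<phi> w - a) powr (2 * \<beta>))))"
        unfolding cone_density_def using T that one by (subst ln_prod) auto
      also have "\<dots> = (\<Sum>a\<in>T. - \<alpha> a * ln (norm (\<phi> w - a)) + ln (1 + norm (\<phi> w - a) powr (2 * \<beta>)))"
      proof (rule sum.cong)
        fix a assume "a \<in> T"
        then have "\<phi> w - a \<noteq> 0" using that by auto
        then show "ln (norm (\<phi> w - a) powr - \<alpha> a * (1 + norm (\<phi> w - a) powr (2 * \<beta>))) = - \<alpha> a * ln (norm (\<phi> w - a)) + ln (1 + norm (\<phi> w - a) powr (2 * \<beta>))"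
          using one by (simp add: ln_mult ln_powr)
      qed simp
      finally have "ln (cone_density T \<alpha> \<beta> (\<phi> w)) = (\<Sum>a\<in>T. - \<alpha> a * ln (norm (\<phi> w - a)) + ln (1 + norm (\<phi> w - a) powr (2 * \<beta>)))" .
      then show ?thesis
        unfolding f_def using that cone_density_pos[OF T that(2), of \<alpha> \<beta>] pos[OF that(3)] by (simp add: ln_mult)
    qed
    have "\<forall>\<^sub>F w in nhds z. deriv \<phi> w \<noteq> 0"
      using eventually_nhds_not_nonpos(2)[OF analytic_deriv[OF \<phi>] d0] .
    moreover note eventually_analytic_notin_finite[OF \<phi> T zT]
    moreover have "\<forall>\<^sub>F w in nhds z. w \<in> ball 0 R" using R by (intro eventually_nhds_in_open) auto
    ultimately show ?thesis using mx
    proof eventually_elim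
      case (elim w)
      have "0 < norm (deriv \<phi> w) * cone_density T \<alpha> \<beta> (\<phi> w) * (R\<^sup>2 - (norm w)\<^sup>2)"
        using elim cone_density_pos[OF T, of "\<phi> w" \<alpha> \<beta>] pos[of w] by (intro mult_pos_pos) auto
      then show ?case using elim fe[of w] fe[of z] d0 zT R by (simp add: ln_mono)
    qed
  qed
  ultimately have "(\<Sum>a\<in>T. (X a)\<^sup>2) \<le> (R / (R\<^sup>2 - (norm z)\<^sup>2))\<^sup>2"
    using lapl_max by fastforce
  \<comment> \<open>The summands are squares, so any single one may be kept; the caller chooses the
    one that dominates the density.\<close>
  moreover have "(X a)\<^sup>2 \<le> (\<Sum>a\<in>T. (X a)\<^sup>2)" using T a by (intro member_le_sum) auto
  ultimately have "(X a)\<^sup>2 \<le> (R / (R\<^sup>2 - (norm z)\<^sup>2))\<^sup>2" by linarith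
  then have "X a \<le> R / (R\<^sup>2 - (norm z)\<^sup>2)"
    by (rule power2_le_imp_le) (intro divide_nonneg_pos less_imp_le[OF R0] pos[OF R])
  then show ?thesis by (simp add: X_def mult_ac)
qed

text \<open>Only \<open>real m * (1 - \<alpha> v) > 1\<close> links the weights with multiplicities,
  so an omitted value, for which \<open>ram\<close> is void, may have any weight below 1. Infinity
  contributes no factor to the density: its weight is the amount by which the finite weights may
  fall short of 2, and it acts through the order of decay.\<close>

theorem picard_ramified:
  fixes G :: "complex \<Rightarrow> complex option" and \<alpha> :: "complex option \<Rightarrow> real"
  assumes G: "shol G UNIV" and S: "finite S"
    and \<alpha>: "\<And>v. v \<in> S \<Longrightarrow> 0 < \<alpha> v" "\<And>v. v \<in> S \<Longrightarrow> \<alpha> v < 1" and sum: "(\<Sum>v\<in>S. \<alpha> v) > 2"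
    and ram: "\<And>v z. v \<in> S \<Longrightarrow> G z = v \<Longrightarrow>
      \<exists>m C. real m * (1 - \<alpha> v) > 1 \<and> (\<forall>\<^sub>F w in nhds z. chordal (G w) v \<le> C * norm (w - z) ^ m)"
  shows "\<exists>v. \<forall>z. G z = v"
proof (rule ccontr)
  assume nc: "\<not> (\<exists>v. \<forall>z. G z = v)"
  have shz: "shol G {z}" for z using G by (rule shol_subset) simp
  have ne: "\<forall>\<^sub>F w in at z. G w \<noteq> v" for z v
    using shol_identity[OF G open_UNIV connected_UNIV, of z v] nc by (auto simp: frequently_def)
  define T where "T = {a. Some a \<in> S}"
  define \<alpha>' where "\<alpha>' = (\<lambda>a. \<alpha> (Some a))"
  define \<alpha>i where "\<alpha>i = (if None \<in> S then \<alpha> None else 0)"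
  have finT: "finite T" unfolding T_def using S by (intro finite_vimageI[of S Some, unfolded vimage_def]) auto
  have sumS: "(\<Sum>v\<in>S. \<alpha> v) = (\<Sum>a\<in>T. \<alpha>' a) + \<alpha>i"
  proof -
    have "S = Some ` T \<union> (S \<inter> {None})"
    proof (intro equalityI subsetI)
      fix x assume "x \<in> S" then show "x \<in> Some ` T \<union> (S \<inter> {None})" by (cases x) (auto simp: T_def)
    qed (auto simp: T_def)
    then have "(\<Sum>v\<in>S. \<alpha> v) = (\<Sum>v\<in>Some ` T \<union> (S \<inter> {None}). \<alpha> v)" by simp
    also have "\<dots> = (\<Sum>v\<in>Some ` T. \<alpha> v) + (\<Sum>v\<in>S \<inter> {None}. \<alpha> v)"
      using S finT by (intro sum.union_disjoint) auto
    also have "(\<Sum>v\<in>Some ` T. \<alpha> v) = (\<Sum>a\<in>T. \<alpha>' a)" by (simp add: sum.reindex \<alpha>'_def)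
    also have "(\<Sum>v\<in>S \<inter> {None}. \<alpha> v) = \<alpha>i" by (auto simp: \<alpha>i_def)
    finally show ?thesis .
  qed
  define N where "N = real (card T)"
  define \<gamma> where "\<gamma> = (\<Sum>a\<in>T. \<alpha>' a) + \<alpha>i - 2"
  have \<gamma>: "\<gamma> > 0" using sum sumS by (simp add: \<gamma>_def)
  define P where "P = insert 1 ((\<lambda>v. 1 - \<alpha> v) ` S)"
  have P: "finite P" "P \<noteq> {}" using S by (auto simp: P_def)
  have Ppos: "p > 0" if "p \<in> P" for p using that \<alpha>(2) by (auto simp: P_def)
  \<comment> \<open>The first bound gives \<open>\<alpha> v + \<beta> \<le> 1\<close> at every
    special value, infinity included; the second makes the loss \<open>2 * \<beta> * N\<close>
    caused by the curvature factors smaller than the excess \<gamma>. The 2 added to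
    \<open>2 * N\<close> avoids division by zero and makes that inequality strict.\<close>
  define \<beta> where "\<beta> = min (Min P) (\<gamma> / (2 * N + 2))"
  have \<beta>P: "\<beta> \<le> p" if "p \<in> P" for p using Min_le[OF P(1) that] by (simp add: \<beta>_def)
  have N0: "N \<ge> 0" by (simp add: N_def)
  have \<beta>: "\<beta> > 0" using Ppos[OF Min_in[OF P]] \<gamma> N0 by (simp add: \<beta>_def)
  have \<beta>1: "\<alpha>' a + \<beta> \<le> 1" if "a \<in> T" for a
    using \<beta>P[of "1 - \<alpha> (Some a)"] that by (auto simp: P_def T_def \<alpha>'_def)
  have \<beta>2: "\<alpha>i + \<beta> \<le> 1"
    using \<beta>P[of "1 - \<alpha> None"] \<beta>P[of 1] by (auto simp: P_def \<alpha>i_def)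
  have \<beta>3: "2 * \<beta> * N < \<gamma>"
  proof -
    have "\<beta> * (2 * N + 2) \<le> \<gamma>" using N0 by (simp add: \<beta>_def pos_le_divide_eq[symmetric])
    then show ?thesis using \<beta> by (simp add: algebra_simps)
  qed
  define s where "s = (\<Sum>a\<in>T. \<alpha>' a - 2 * \<beta>)"
  have s: "s = (\<Sum>a\<in>T. \<alpha>' a) - 2 * \<beta> * N" by (simp add: s_def sum_subtractf N_def)
  have s2: "s > 2 - \<alpha>i" using \<beta>3 s by (simp add: \<gamma>_def)
  have s1: "s > 1" using s2 \<beta>2 \<beta> by linarith
  have Tne: "T \<noteq> {}" using s1 by (auto simp: s_def)
  have \<alpha>'0: "0 < \<alpha>' a" "\<alpha>' a < 1" if "a \<in> T" for a using that \<alpha> by (auto simp: T_def \<alpha>'_def)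
  obtain K where K: "K > 0"
    "\<And>w. w \<notin> T \<Longrightarrow> \<exists>a\<in>T. cone_density T \<alpha>' \<beta> w \<le> K * (norm (w - a) powr (\<beta> - 1) / (1 + norm (w - a) powr (2 * \<beta>)))"
  proof (rule cone_density_bound[OF finT Tne, of \<alpha>' \<beta>])
    show "1 + \<beta> + 2 * \<beta> * real (card T) \<le> sum \<alpha>' T" using s2 \<beta>2 s by (simp add: N_def)
  qed (use \<alpha>'0 \<beta>1 \<beta> in blast)+
  define \<phi> where "\<phi> = (\<lambda>w. the (G w))"
  define dens where "dens = (\<lambda>z. norm (deriv \<phi> z) * cone_density T \<alpha>' \<beta> (\<phi> z))"
  \<comment> \<open>At a pole \<phi> has the arbitrary value \<open>the None\<close>, so
    \<open>dens\<close> is meaningless there; special points receive the limit value 0.\<close>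
  define lam where "lam = (\<lambda>z. if G z = None \<or> G z \<in> S then 0 else dens z)"
  have dens0: "dens z \<ge> 0" for z by (simp add: dens_def cone_density_nonneg)
  have lam0: "lam z \<ge> 0" "lam z \<le> dens z" for z using dens0 by (auto simp: lam_def)
  have chart: "\<phi> analytic_on {z}" "\<forall>\<^sub>F w in nhds z. G w = Some (\<phi> w)" if "G z \<noteq> None" for z
    using shol_chart[OF shz that] by (auto simp: \<phi>_def)
  have regular: "\<forall>\<^sub>F w in nhds z. lam w = dens w" if z: "G z \<noteq> None" "G z \<notin> S" for z
  proof -
    have "\<phi> z \<notin> T" using z by (auto simp: T_def \<phi>_def)
    from eventually_analytic_notin_finite[OF chart(1)[OF z(1)] finT this] chart(2)[OF z(1)] show ?thesis by eventually_elim (auto simp: lam_def T_def)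
  qed
  have dens_lim: "(dens \<longlongrightarrow> 0) (at z)" if z: "G z = None \<or> G z \<in> S" for z
  proof (cases "G z")
    case (Some a)
    then have aT: "a \<in> T" using z by (auto simp: T_def)
    obtain m C where m: "real m * (1 - \<alpha>' a) > 1" and bd: "\<forall>\<^sub>F w in nhds z. chordal (G w) (Some a) \<le> C * norm (w - z) ^ m"
      using ram[of "Some a" z] Some z by (auto simp: \<alpha>'_def)
    show ?thesis unfolding dens_def \<phi>_def
      by (rule cone_density_at_cone_point[where \<alpha> = \<alpha>' and m = m, OF shz Some finT aT \<beta> ne m \<alpha>'0(2)[OF aT] bd])
  next
    case None
    have "\<exists>m C. real m * (s - 1) > 1 \<and> (\<forall>\<^sub>F w in nhds z. chordal (G w) None \<le> C * norm (w - z) ^ m)"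
    proof (cases "None \<in> S")
      case True
      then obtain m C where m: "real m * (1 - \<alpha> None) > 1" "\<forall>\<^sub>F w in nhds z. chordal (G w) None \<le> C * norm (w - z) ^ m"
        using ram[OF True None] by auto
      have "real m * (1 - \<alpha> None) \<le> real m * (s - 1)" using s2 True by (intro mult_left_mono) (auto simp: \<alpha>i_def)
      with m show ?thesis by (intro exI[of _ m] exI[of _ C]) auto
    next
      \<comment> \<open>At an unweighted pole the finite spherical derivative supplies contact of
        order 1, and this suffices because here \<open>s > 2\<close>.\<close>
      case False
      have "\<forall>\<^sub>F w in at z. chordal (G w) (G z) / norm (w - z) < sder G z + 1"
        by (rule order_tendstoD(2)[OF sder_lim[OF shz]]) simp
      then have "\<forall>\<^sub>F w in nhds z. w \<noteq> z \<longrightarrow> chordal (G w) (G z) / norm (w - z) < sder G z + 1"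
        by (simp add: eventually_at_filter)
      then have "\<forall>\<^sub>F w in nhds z. chordal (G w) None \<le> (sder G z + 1) * norm (w - z) ^ 1"
      proof eventually_elim
        case (elim w)
        show ?case
        proof (cases "w = z")
          case False
          then show ?thesis using elim None by (simp add: divide_less_eq)
        qed (use None in simp)
      qed
      moreover have "real 1 * (s - 1) > 1" using s2 False by (simp add: \<alpha>i_def)
      ultimately show ?thesis by blast
    qed
    then obtain m C where m: "real m * (s - 1) > 1" and bd: "\<forall>\<^sub>F w in nhds z. chordal (G w) None \<le> C * norm (w - z) ^ m" by blast
    show ?thesis unfolding dens_def \<phi>_def
      by (rule cone_density_at_pole[where \<alpha> = \<alpha>' and m = m, OF shz None finT \<beta> ne m[unfolded s_def] s1[unfolded s_def] bd])
  qed
  have cont: "isCont lam z" for z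
  proof (cases "G z = None \<or> G z \<in> S")
    case True
    have "(lam \<longlongrightarrow> 0) (at z)"
      by (rule tendsto_sandwich[OF _ _ tendsto_const dens_lim[OF True]]) (use lam0 in auto)
    then show ?thesis using True by (simp add: isCont_def lam_def)
  next
    case False
    then have z: "G z \<noteq> None" "G z \<notin> S" by auto
    have "\<phi> z \<notin> T" using z by (auto simp: T_def \<phi>_def)
    note \<phi>z = analytic_tendsto(2)[OF chart(1)[OF z(1)]]
      and d\<phi> = analytic_tendsto(2)[OF analytic_deriv[OF chart(1)[OF z(1)]]]
    have "dens \<midarrow>z\<rightarrow> dens z"
      unfolding dens_def by (intro tendsto_intros d\<phi> cone_density_tendsto[OF finT \<phi>z \<open>\<phi> z \<notin> T\<close>])
    then have "isCont dens z" by (simp add: isCont_def)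
    then show ?thesis using isCont_cong[OF regular[OF z]] by simp
  qed
  \<comment> \<open>The factor \<open>R\<^sup>2 - (norm z)\<^sup>2\<close> vanishes on the boundary
    and \<open>lam\<close> at the special points, so a positive maximum is attained inside and at a
    regular point, where \<open>ahlfors_maximum\<close> applies.\<close>
  have schwarz: "lam z * (R\<^sup>2 - (norm z)\<^sup>2) \<le> K / \<beta> * R" if z: "norm z < R" for z R
  proof -
    have R0: "R > 0" using z norm_ge_zero[of z] by linarith
    have "\<exists>x\<in>cball 0 R. \<forall>y\<in>cball 0 R. lam y * (R\<^sup>2 - (norm y)\<^sup>2) \<le> lam x * (R\<^sup>2 - (norm x)\<^sup>2)"
      by (rule continuous_attains_sup)
         (use R0 in \<open>auto intro!: continuous_at_imp_continuous_on continuous_intros cont\<close>)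
    then obtain x where x: "x \<in> cball 0 R" "\<And>y. y \<in> cball 0 R \<Longrightarrow> lam y * (R\<^sup>2 - (norm y)\<^sup>2) \<le> lam x * (R\<^sup>2 - (norm x)\<^sup>2)"
      by blast
    have KR: "0 \<le> K / \<beta> * R" using K \<beta> R0 by simp
    have "lam x * (R\<^sup>2 - (norm x)\<^sup>2) \<le> K / \<beta> * R"
    proof (cases "lam x * (R\<^sup>2 - (norm x)\<^sup>2) > 0")
      case True
      have lx: "lam x > 0" using True lam0(1)[of x] by (cases "lam x = 0") auto
      have Rx: "R\<^sup>2 - (norm x)\<^sup>2 > 0" using True lx by (simp add: zero_less_mult_iff)
      then have xR: "norm x < R" using R0 by (simp add: power2_less_imp_less)
      have xG: "G x \<noteq> None" "G x \<notin> S" using lx by (auto simp: lam_def split: if_splits)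
      have xT: "\<phi> x \<notin> T" using xG by (auto simp: T_def \<phi>_def)
      have ld: "lam x = dens x" using xG by (auto simp: lam_def)
      have dx: "deriv \<phi> x \<noteq> 0" using lx ld by (auto simp: dens_def)
      have "\<forall>\<^sub>F y in nhds x. y \<in> ball 0 R" using xR by (intro eventually_nhds_in_open) auto
      with regular[OF xG] have mx: "\<forall>\<^sub>F y in nhds x. norm (deriv \<phi> y) * cone_density T \<alpha>' \<beta> (\<phi> y) * (R\<^sup>2 - (norm y)\<^sup>2)
          \<le> norm (deriv \<phi> x) * cone_density T \<alpha>' \<beta> (\<phi> x) * (R\<^sup>2 - (norm x)\<^sup>2)"
      proof eventually_elim
        case (elim y)
        then show ?case using x(2)[of y] ld by (simp add: dens_def)
      qed
      obtain a where a: "a \<in> T" "cone_density T \<alpha>' \<beta> (\<phi> x) \<le> K * (norm (\<phi> x - a) powr (\<beta> - 1) / (1 + norm (\<phi> x - a) powr (2 * \<beta>)))"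
        using K(2)[OF xT] by blast
      define X where "X = norm (\<phi> x - a) powr (\<beta> - 1) / (1 + norm (\<phi> x - a) powr (2 * \<beta>))"
      have "\<beta> * norm (deriv \<phi> x) * X \<le> R / (R\<^sup>2 - (norm x)\<^sup>2)"
        unfolding X_def by (rule ahlfors_maximum[OF finT chart(1)[OF xG(1)] dx xT \<beta> xR mx a(1)])
      then have 1: "norm (deriv \<phi> x) * X \<le> R / (R\<^sup>2 - (norm x)\<^sup>2) / \<beta>"
        using \<beta> by - (rule mult_imp_le_div_pos, simp_all add: mult_ac)
      have "lam x \<le> norm (deriv \<phi> x) * (K * X)"
        unfolding ld dens_def using a(2) by (intro mult_left_mono) (auto simp: X_def)
      also have "\<dots> \<le> K * (R / (R\<^sup>2 - (norm x)\<^sup>2) / \<beta>)"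
        using mult_left_mono[OF 1, of K] K(1) by (simp add: mult_ac)
      finally have "lam x * (R\<^sup>2 - (norm x)\<^sup>2) \<le> K * (R / (R\<^sup>2 - (norm x)\<^sup>2) / \<beta>) * (R\<^sup>2 - (norm x)\<^sup>2)"
        using Rx by (intro mult_right_mono) auto
      also have "\<dots> = K / \<beta> * R" using Rx by simp
      finally show ?thesis .
    qed (use KR in linarith)
    then show ?thesis using x(2)[of z] z by auto
  qed
  have lz: "lam z = 0" for z
  proof (rule ccontr)
    assume "lam z \<noteq> 0"
    then have lp: "lam z > 0" using lam0(1)[of z] by linarith
    \<comment> \<open>Chosen so that \<open>lam z * (R - norm z)\<close> exceeds
      \<open>K / \<beta>\<close> by 1, whereas R^2 - |z|^2 \<ge> (R - |z|) R turns the Schwarz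
      estimate into the opposite bound.\<close>
    define R where "R = norm z + (K / \<beta> + 1) / lam z"
    have d: "(K / \<beta> + 1) / lam z > 0" using K \<beta> lp by (simp add: add_pos_pos)
    have zR: "norm z < R" using d by (simp add: R_def)
    then have R0: "R > 0" using norm_ge_zero[of z] by linarith
    have "(R - norm z) * R \<le> (R - norm z) * (R + norm z)" using zR by (intro mult_left_mono) auto
    also have "\<dots> = R\<^sup>2 - (norm z)\<^sup>2" by (simp add: power2_eq_square algebra_simps)
    finally have "lam z * ((R - norm z) * R) \<le> lam z * (R\<^sup>2 - (norm z)\<^sup>2)" using lp by (intro mult_left_mono) auto
    also have "\<dots> \<le> K / \<beta> * R" by (rule schwarz[OF zR])
    finally have "(lam z * (R - norm z)) * R \<le> K / \<beta> * R" by (simp add: mult_ac)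
    then have "lam z * (R - norm z) \<le> K / \<beta>" using R0 by (simp only: mult_le_cancel_right_pos)
    moreover have "lam z * (R - norm z) = K / \<beta> + 1" using lp by (simp add: R_def)
    ultimately show False by linarith
  qed
  have "\<forall>\<^sub>F w in at (0::complex). \<forall>v\<in>insert None S. G w \<noteq> v"
    using S by (intro eventually_ball_finite ballI ne) auto
  from eventually_happens'[OF at_neq_bot this]
  obtain z where z: "G z \<noteq> None" "G z \<notin> S" by blast
  have zT: "\<phi> z \<notin> T" using z by (auto simp: T_def \<phi>_def)
  from eventually_analytic_notin_finite[OF chart(1)[OF z(1)] finT zT] regular[OF z] eventually_nhds_analytic[OF chart(1)[OF z(1)]] chart(2)[OF z(1)]
  have "\<forall>\<^sub>F w in nhds z. (\<phi> has_field_derivative 0) (at w) \<and> G w = Some (\<phi> w)"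
  proof eventually_elim
    case (elim w)
    have "dens w = 0" using elim(2) lz by simp
    moreover have "cone_density T \<alpha>' \<beta> (\<phi> w) > 0" using elim(1) by (intro cone_density_pos finT)
    ultimately have "deriv \<phi> w = 0" by (simp add: dens_def)
    then show ?case using analytic_derivI[OF elim(3), of UNIV] elim(4) by simp
  qed
  then obtain e where e: "e > 0" "\<And>w. dist w z < e \<Longrightarrow> (\<phi> has_field_derivative 0) (at w) \<and> G w = Some (\<phi> w)"
    by (auto simp: eventually_nhds_metric)
  have "\<exists>c. \<forall>w\<in>ball z e. \<phi> w = c"
    by (rule has_field_derivative_zero_constant) (use e in \<open>auto simp: dist_commute intro: has_field_derivative_at_within\<close>)
  then obtain c where "\<And>w. dist w z < e \<Longrightarrow> G w = Some c" using e(2) by (force simp: dist_commute)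
  then have "\<forall>\<^sub>F w in at z. G w = Some c" using e(1) by (auto simp: eventually_at)
  with ne[where v = "Some c"] have "\<forall>\<^sub>F w in at z. False" by eventually_elim simp
  then show False by simp
qed

section \<open>Hurwitz-type theorems\<close>

lemma nicely_meromorphic_zero_at_pole:
  assumes "f nicely_meromorphic_on D" "z \<in> D" "is_pole f z"
  shows "f z = 0"
  using assms not_tendsto_and_filterlim_at_infinity[OF at_neq_bot]
  unfolding nicely_meromorphic_on_def is_pole_def by blast

text \<open>A nicely meromorphic function has the value 0 at its poles, and
  \<open>inverse 0 = 0\<close>, so the pointwise reciprocal is already analytic there, with no value
  to correct. The charts are stated explicitly since the hypotheses of the criterion speak of
  derivatives and pole orders of \<open>f\<close> itself.\<close>

lemma shol_ext_val:
  assumes f: "f nicely_meromorphic_on D" and D: "open D" "z \<in> D"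
  shows "shol (ext_val f) {z}"
    and "is_pole f z \<Longrightarrow> (\<lambda>w. inverse (f w)) analytic_on {z}"
    and "is_pole f z \<Longrightarrow> \<forall>\<^sub>F w in nhds z. sinv (ext_val f w) = Some (inverse (f w))"
    and "\<not> is_pole f z \<Longrightarrow> f analytic_on {z}"
    and "\<not> is_pole f z \<Longrightarrow> \<forall>\<^sub>F w in nhds z. ext_val f w = Some (f w)"
proof -
  show an: "f analytic_on {z}" if "\<not> is_pole f z"
    using nicely_meromorphic_on_imp_analytic_at[OF f D(2) that] .
  show ev: "\<forall>\<^sub>F w in nhds z. ext_val f w = Some (f w)" if "\<not> is_pole f z"
    using eventually_nhds_analytic[OF an[OF that]]
    by eventually_elim (simp add: ext_val_def analytic_at_imp_no_pole)
  show ian: "(\<lambda>w. inverse (f w)) analytic_on {z}" if p: "is_pole f z"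
  proof (rule nicely_meromorphic_on_imp_analytic_at[OF nicely_meromorphic_on_inverse[OF f] D(2)])
    have "(\<lambda>w. inverse (f w)) \<midarrow>z\<rightarrow> 0"
      using p unfolding is_pole_def by (rule filterlim_compose[OF tendsto_inverse_0])
    then show "\<not> is_pole (\<lambda>w. inverse (f w)) z"
      using not_tendsto_and_filterlim_at_infinity[OF at_neq_bot] unfolding is_pole_def by blast
  qed
  show iev: "\<forall>\<^sub>F w in nhds z. sinv (ext_val f w) = Some (inverse (f w))" if p: "is_pole f z"
  proof -
    have fz: "f z = 0" by (rule nicely_meromorphic_zero_at_pole[OF f D(2) p])
    have "\<forall>\<^sub>F w in at z. f w \<noteq> 0" using p non_zero_neighbour_pole by blast
    then have nz: "\<forall>\<^sub>F w in nhds z. w \<noteq> z \<longrightarrow> f w \<noteq> 0" by (simp add: eventually_at_filter)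
    have "\<forall>\<^sub>F w in nhds z. w \<in> D" using D by (rule eventually_nhds_in_open)
    with nz show ?thesis
    proof eventually_elim
      case (elim w)
      show ?case
      proof (cases "w = z")
        case True
        then show ?thesis using p fz by (simp add: ext_val_def)
      next
        case False
        then have "f w \<noteq> 0" using elim by simp
        then have "\<not> is_pole f w" using nicely_meromorphic_zero_at_pole[OF f elim(2)] by blast
        then show ?thesis using \<open>f w \<noteq> 0\<close> by (simp add: ext_val_def)
      qed
    qed
  qed
  show "shol (ext_val f) {z}"
  proof (cases "is_pole f z")
    case True
    have "shol (\<lambda>w. sinv (ext_val f w)) {z}" by (rule sholI[OF ian[OF True] iev[OF True]])
    then show ?thesis by simp
  qed (use sholI an ev in blast)
qed

lemma higher_deriv_zero_factor:
  assumes "g analytic_on {z}" "\<forall>\<^sub>F w in nhds z. h w = (w - z) ^ m * g w" "k < m"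
  shows "(deriv ^^ k) h z = 0"
  using assms
proof (induction k arbitrary: h g m)
  case 0
  have "h z = (z - z) ^ m * g z" using 0(2) by (rule eventually_nhds_x_imp_x)
  then show ?case using 0(3) by simp
next
  case (Suc k)
  then obtain m' where m': "m = Suc m'" "k < m'" by (cases m) auto
  have "\<forall>\<^sub>F w in nhds z. \<forall>\<^sub>F x in nhds w. h x = (x - z) ^ m * g x"
    using Suc.prems(2) by (simp add: eventually_eventually)
  with eventually_nhds_analytic[OF Suc.prems(1)]
  have "\<forall>\<^sub>F w in nhds z. deriv h w = (w - z) ^ m' * (of_nat m * g w + (w - z) * deriv g w)"
  proof eventually_elim
    case (elim w)
    have "deriv h w = deriv (\<lambda>x. (x - z) ^ m * g x) w" using elim(2) by (rule deriv_cong_ev) simp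
    also have "((\<lambda>x. (x - z) ^ m) has_field_derivative of_nat m * (w - z) ^ m') (at w)"
    proof -
      have "((\<lambda>x. x - z) has_field_derivative 1) (at w)" by (auto intro!: derivative_eq_intros)
      moreover have "m - Suc 0 = m'" using m'(1) by simp
      ultimately show ?thesis using DERIV_power[of "\<lambda>x. x - z" 1 w UNIV m] by simp
    qed
    from DERIV_mult[OF this analytic_derivI[OF elim(1)]]
    have "((\<lambda>x. (x - z) ^ m * g x) has_field_derivative (w - z) ^ m' * (of_nat m * g w + (w - z) * deriv g w)) (at w)"
      by (rule DERIV_cong) (simp add: m'(1) algebra_simps)
    then have "deriv (\<lambda>x. (x - z) ^ m * g x) w = (w - z) ^ m' * (of_nat m * g w + (w - z) * deriv g w)"
      by (rule DERIV_imp_deriv)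
    finally show ?case .
  qed
  moreover have "(\<lambda>w. of_nat m * g w + (w - z) * deriv g w) analytic_on {z}"
    using Suc.prems(1) by (intro analytic_intros) auto
  ultimately have "(deriv ^^ k) (deriv h) z = 0" using Suc.IH m'(2) by blast
  then show ?case by (simp add: funpow_Suc_right del: funpow.simps)
qed

text \<open>Translates pole multiplicity into vanishing derivatives of the reciprocal, the form in
  which finite ramified values are handled; infinity then follows the same route with the bound
  0.\<close>

lemma higher_deriv_inverse_pole:
  assumes f: "f nicely_meromorphic_on D" and D: "open D" "z \<in> D" and p: "is_pole f z"
    and m: "- zorder f z \<ge> int m" and k: "k < m"
  shows "(deriv ^^ k) (\<lambda>w. inverse (f w)) z = 0"
proof -
  have "\<forall>\<^sub>F w in at z. f w \<noteq> 0" using p non_zero_neighbour_pole by blast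
  then have nz: "\<forall>\<^sub>F w in nhds z. w \<noteq> z \<longrightarrow> f w \<noteq> 0" by (simp add: eventually_at_filter)
  have "\<forall>\<^sub>F w in nhds z. w \<in> D" using D by (rule eventually_nhds_in_open)
  with nz have "\<forall>\<^sub>F w in nhds z. w \<in> D \<and> (w \<noteq> z \<longrightarrow> f w \<noteq> 0)" by eventually_elim simp
  then obtain U where U: "open U" "z \<in> U" "\<And>w. w \<in> U \<Longrightarrow> w \<in> D \<and> (w \<noteq> z \<longrightarrow> f w \<noteq> 0)"
    by (auto simp: eventually_nhds)
  have "f analytic_on {w}" if w: "w \<in> U - {z}" for w
  proof (rule shol_ext_val(4)[OF f D(1)])
    show "w \<in> D" using U w by auto
    have "f w \<noteq> 0" using U w by auto
    then show "\<not> is_pole f w" using nicely_meromorphic_zero_at_pole[OF f \<open>w \<in> D\<close>] by blast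
  qed
  then have hol: "f holomorphic_on U - {z}" using analytic_imp_holomorphic analytic_on_analytic_at by blast
  define N where "N = nat (- zorder f z)"
  define g where "g = zor_poly f z"
  have mN: "m \<le> N" using m by (simp add: N_def)
  obtain r where r: "r > 0" "g holomorphic_on cball z r" "\<forall>w\<in>cball z r - {z}. f w = g w / (w - z) ^ N \<and> g w \<noteq> 0"
    and gz: "g z \<noteq> 0"
    using zorder_exist_pole[OF hol U(1,2) p] unfolding N_def g_def by blast
  have ga: "g analytic_on {z}" using r holomorphic_on_subset[of g "cball z r" "ball z r"] analytic_at_ball by (meson ball_subset_cball)
  show ?thesis
  proof (rule higher_deriv_zero_factor[OF _ _ k])
    show "(\<lambda>w. (w - z) ^ (N - m) / g w) analytic_on {z}" using ga gz by (intro analytic_intros) auto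
    have "\<forall>\<^sub>F w in nhds z. w \<in> ball z r" using r by (intro eventually_nhds_in_open) auto
    then show "\<forall>\<^sub>F w in nhds z. inverse (f w) = (w - z) ^ m * ((w - z) ^ (N - m) / g w)"
    proof eventually_elim
      case (elim w)
      show ?case
      proof (cases "w = z")
        case True
        then show ?thesis using nicely_meromorphic_zero_at_pole[OF f D(2) p] k by simp
      next
        case False
        then have "f w = g w / (w - z) ^ N" using r elim by auto
        moreover have "(w - z) ^ N = (w - z) ^ m * (w - z) ^ (N - m)" using mN by (simp add: power_add[symmetric])
        ultimately show ?thesis by simp
      qed
    qed
  qed
qed

section \<open>Points, multiplicities and omitted values of limits\<close>

lemma eventually_selection:
  fixes z :: "'a :: metric_space"
  assumes "\<And>e. e > 0 \<Longrightarrow> \<forall>\<^sub>F n in sequentially. \<exists>w\<in>ball z e. P n w"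
  obtains w where "w \<longlonglongrightarrow> z" "\<forall>\<^sub>F n in sequentially. P n (w n)"
proof -
  \<comment> \<open>For each \<open>n\<close> the finest radius \<open>1 / real (Suc j)\<close> with
    \<open>j \<le> n\<close> that admits a witness is used; the cap \<open>j \<le> n\<close> keeps
    the candidates finite, and every fixed \<open>j\<close> is eventually a candidate.\<close>
  define J where "J = (\<lambda>n. {j. j \<le> n \<and> (\<exists>w\<in>ball z (1 / real (Suc j)). P n w)})"
  define j where "j = (\<lambda>n. Max (J n))"
  have finJ: "finite (J n)" for n by (rule finite_subset[of _ "{..n}"]) (auto simp: J_def)
  have ex: "\<exists>w. J n \<noteq> {} \<longrightarrow> w \<in> ball z (1 / real (Suc (j n))) \<and> P n w" for n
  proof (cases "J n = {}")
    case False
    then have "j n \<in> J n" unfolding j_def by (rule Max_in[OF finJ])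
    then show ?thesis by (auto simp: J_def)
  qed simp
  then obtain w where w: "\<And>n. J n \<noteq> {} \<Longrightarrow> w n \<in> ball z (1 / real (Suc (j n))) \<and> P n (w n)" by metis
  have evJ: "\<forall>\<^sub>F n in sequentially. i \<in> J n" for i
  proof -
    have "\<forall>\<^sub>F n in sequentially. \<exists>w\<in>ball z (1 / real (Suc i)). P n w" by (rule assms) simp
    with eventually_ge_at_top[of i] show ?thesis by eventually_elim (simp add: J_def)
  qed
  show ?thesis
  proof (rule that[of w])
    show "\<forall>\<^sub>F n in sequentially. P n (w n)" using evJ[of 0] by eventually_elim (use w in blast)
    show "w \<longlonglongrightarrow> z"
    proof (rule tendstoI)
      fix e :: real assume "e > 0"
      then obtain i where i: "1 / real (Suc i) < e" using nat_approx_posE by blast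
      show "\<forall>\<^sub>F n in sequentially. dist (w n) z < e"
        using evJ[of i]
      proof eventually_elim
        case (elim n)
        have "i \<le> j n" unfolding j_def using elim finJ by (intro Max_ge) auto
        then have "1 / real (Suc (j n)) \<le> 1 / real (Suc i)" by (intro divide_left_mono) auto
        moreover have "w n \<in> ball z (1 / real (Suc (j n)))" using w[of n] elim by auto
        ultimately show ?case using i by (simp add: dist_commute)
      qed
    qed
  qed
qed

lemma sconv_eventually_neq:
  assumes lim: "sconv H g UNIV" and nc: "\<not> (\<exists>v. \<forall>z. g z = v)"
  shows "\<forall>\<^sub>F w in at z. g w \<noteq> v"
  using shol_identity[OF sconv_shol[OF open_UNIV lim] open_UNIV connected_UNIV, where z = z and v = v] nc
  by (auto simp: frequently_def)

text \<open>If the value were missed infinitely often, a subsequence would omit it on the disc, and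
  Hurwitz' theorem would make the nonconstant limit omit it too. The value at infinity is reduced to
  0 by inversion.\<close>

lemma hurwitz_points:
  assumes lim: "sconv H g UNIV" and nc: "\<not> (\<exists>v. \<forall>z. g z = v)" and gz: "g z = v" and e: "e > 0"
  shows "\<forall>\<^sub>F n in sequentially. \<exists>w\<in>ball z e. H n w = v"
proof -
  have *: "\<forall>\<^sub>F n in sequentially. \<exists>w\<in>ball z e. H n w = Some c"
    if lim: "sconv H g UNIV" and nc: "\<not> (\<exists>v. \<forall>z. g z = v)" and gz: "g z = Some c" for H g c
  proof (rule ccontr)
    assume "\<not> (\<forall>\<^sub>F n in sequentially. \<exists>w\<in>ball z e. H n w = Some c)"
    then obtain r :: "nat \<Rightarrow> nat" where r: "strict_mono r" "\<And>n. \<not> (\<exists>w\<in>ball z e. H (r n) w = Some c)"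
      using not_eventually_sequentiallyD by blast
    have gz': "g z \<noteq> None" using gz by simp
    obtain d N where d: "d > 0"
      and hol: "\<And>n. n \<ge> N \<Longrightarrow> (\<lambda>w. the (H n w)) holomorphic_on ball z d"
      and some: "\<And>n w. n \<ge> N \<Longrightarrow> w \<in> ball z d \<Longrightarrow> H n w = Some (the (H n w))"
      and gsome: "\<And>w. w \<in> ball z d \<Longrightarrow> g w = Some (the (g w))"
      and holg: "(\<lambda>w. the (g w)) holomorphic_on ball z d"
      and ul: "uniform_limit (ball z d) (\<lambda>n w. the (H n w)) (\<lambda>w. the (g w)) sequentially"
      by (rule sconv_chart[OF open_UNIV lim UNIV_I gz']; rule that; blast)
    define t where "t = min d e"
    have t: "t > 0" "ball z t \<subseteq> ball z d" "ball z t \<subseteq> ball z e" using d e by (auto simp: t_def)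
    have rn: "r (n + N) \<ge> N" for n using seq_suble[OF r(1), of "n + N"] by linarith
    have "the (g z) - c \<noteq> 0"
    proof (rule Hurwitz_no_zeros[where S = "ball z t" and \<F> = "\<lambda>n w. the (H (r (n + N)) w) - c" and g = "\<lambda>w. the (g w) - c"])
      show "(\<lambda>w. the (H (r (n + N)) w) - c) holomorphic_on ball z t" for n
        using holomorphic_on_subset[OF hol[OF rn[of n]] t(2)] by (intro holomorphic_intros)
      show "(\<lambda>w. the (g w) - c) holomorphic_on ball z t"
        using holomorphic_on_subset[OF holg t(2)] by (intro holomorphic_intros)
      fix K assume K: "compact K" "K \<subseteq> ball z t"
      show "uniform_limit K (\<lambda>n w. the (H (r (n + N)) w) - c) (\<lambda>w. the (g w) - c) sequentially"
        unfolding uniform_limit_sequentially_iff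
      proof (intro allI impI)
        fix \<epsilon> :: real assume "\<epsilon> > 0"
        then obtain n0 where n0: "\<forall>n\<ge>n0. \<forall>w\<in>ball z d. dist (the (H n w)) (the (g w)) < \<epsilon>"
          using ul unfolding uniform_limit_sequentially_iff by blast
        show "\<exists>n0. \<forall>n\<ge>n0. \<forall>w\<in>K. dist (the (H (r (n + N)) w) - c) (the (g w) - c) < \<epsilon>"
        proof (intro exI[of _ n0] allI impI ballI)
          fix n w assume n: "n \<ge> n0" "w \<in> K"
          have "r (n + N) \<ge> n0" using seq_suble[OF r(1), of "n + N"] n by linarith
          moreover have "w \<in> ball z d" using n K t by blast
          ultimately show "dist (the (H (r (n + N)) w) - c) (the (g w) - c) < \<epsilon>"
            using n0 by (simp add: dist_norm)
        qed
      qed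
    next
      show "\<not> (\<lambda>w. the (g w) - c) constant_on ball z t"
      proof
        assume "(\<lambda>w. the (g w) - c) constant_on ball z t"
        then obtain k where k: "\<And>w. w \<in> ball z t \<Longrightarrow> the (g w) - c = k" by (auto simp: constant_on_def)
        have "g w = Some (k + c)" if "w \<in> ball z t" for w
        proof -
          have "w \<in> ball z d" using that t by blast
          then show ?thesis using gsome[of w] k[OF that] by (metis diff_add_cancel)
        qed
        then have "\<forall>\<^sub>F w in at z. g w = Some (k + c)"
          using eventually_at_in_open'[of "ball z t" z] t(1) by (auto elim: eventually_mono)
        with sconv_eventually_neq[OF lim nc, of "Some (k + c)" z] have "\<forall>\<^sub>F w in at z. False"
          by eventually_elim simp
        then show False by simp
      qed
      show "the (H (r (n + N)) w) - c \<noteq> 0" if "w \<in> ball z t" for n w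
      proof -
        have "w \<in> ball z d" "w \<in> ball z e" using that t by auto
        then show ?thesis using some[OF rn, of w n] r(2)[of "n + N"] by force
      qed
    qed (use t in auto)
    then show False using gz by simp
  qed
  show ?thesis
  proof (cases v)
    case (Some c)
    then show ?thesis using *[OF lim nc] gz by simp
  next
    case None
    have "\<forall>\<^sub>F n in sequentially. \<exists>w\<in>ball z e. sinv (H n w) = Some 0"
      by (rule *[OF sconv_sinv[OF lim]]) (use nc gz None in \<open>auto simp: sinv_eq_iff\<close>)
    then show ?thesis by (simp add: None sinv_eq_iff)
  qed
qed

lemma sconv_chart_seq:
  assumes lim: "sconv H g UNIV" and gz: "g z = Some c"
  shows "\<exists>d>0. (\<forall>\<^sub>F n in sequentially. (\<lambda>w. the (H n w)) holomorphic_on ball z d \<and> (\<forall>w\<in>ball z d. H n w = Some (the (H n w)))) \<and>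
    (\<forall>w\<in>ball z d. g w = Some (the (g w))) \<and> (\<lambda>w. the (g w)) holomorphic_on ball z d \<and>
    uniform_limit (ball z d) (\<lambda>n w. the (H n w)) (\<lambda>w. the (g w)) sequentially"
proof -
  have gz': "g z \<noteq> None" using gz by simp
  obtain d N where d: "d > 0"
    and hol: "\<And>n. n \<ge> N \<Longrightarrow> (\<lambda>w. the (H n w)) holomorphic_on ball z d"
    and some: "\<And>n w. n \<ge> N \<Longrightarrow> w \<in> ball z d \<Longrightarrow> H n w = Some (the (H n w))"
    and gsome: "\<And>w. w \<in> ball z d \<Longrightarrow> g w = Some (the (g w))"
    and holg: "(\<lambda>w. the (g w)) holomorphic_on ball z d"
    and ul: "uniform_limit (ball z d) (\<lambda>n w. the (H n w)) (\<lambda>w. the (g w)) sequentially"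
    by (rule sconv_chart[OF open_UNIV lim UNIV_I gz']; rule that; blast)
  show ?thesis
    by (intro exI[of _ d] conjI d holg ul ballI gsome eventually_sequentiallyI[of N] hol some)
qed

text \<open>Translating by \<open>w n - z\<close> replaces the moving points by the fixed point
  \<open>z\<close>. The translated functions still converge uniformly on a smaller disc, by uniform
  continuity of \<open>g\<close>, so Weierstrass' theorem applies.\<close>

lemma higher_deriv_limit_moving:
  assumes hol: "\<forall>\<^sub>F n in sequentially. f n holomorphic_on ball z d" and d: "d > 0"
    and holg: "g holomorphic_on ball z d" and ul: "uniform_limit (ball z d) f g sequentially" and w: "w \<longlonglongrightarrow> z"
  shows "(\<lambda>n. (deriv ^^ k) (f n) (w n)) \<longlonglongrightarrow> (deriv ^^ k) g z"
proof -
  define \<delta> where "\<delta> = (\<lambda>n. w n - z)"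
  have "\<delta> \<longlonglongrightarrow> 0" unfolding \<delta>_def using tendsto_diff[OF w tendsto_const[of z]] by simp
  then have \<delta>n: "(\<lambda>n. norm (\<delta> n)) \<longlonglongrightarrow> 0" by (rule tendsto_norm_zero)
  have \<delta>: "\<forall>\<^sub>F n in sequentially. norm (\<delta> n) < e" if "e > 0" for e
    using order_tendstoD(2)[OF \<delta>n that] .
  have sub: "u + \<delta> n \<in> ball z (d / 2)" if "u \<in> ball z (d / 4)" "norm (\<delta> n) < d / 4" for u n
  proof -
    have "norm (z - (u + \<delta> n)) \<le> norm (z - u) + norm (\<delta> n)" using norm_triangle_ineq4[of "z - u" "\<delta> n"] by (simp add: algebra_simps)
    then show ?thesis using that by (simp add: dist_norm)
  qed
  have "uniform_limit (ball z (d / 4)) (\<lambda>n u. f n (1 * u + \<delta> n)) g sequentially"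
    unfolding uniform_limit_iff
  proof (intro allI impI)
    fix e :: real assume e: "e > 0"
    have cb: "cball z (d / 2) \<subseteq> ball z d" using d by auto
    have "continuous_on (cball z (d / 2)) g"
      using holomorphic_on_imp_continuous_on[OF holg] cb continuous_on_subset by blast
    then have "uniformly_continuous_on (cball z (d / 2)) g" by (intro compact_uniformly_continuous) auto
    then obtain \<eta> where \<eta>: "\<eta> > 0" "\<And>x y. x \<in> cball z (d / 2) \<Longrightarrow> y \<in> cball z (d / 2) \<Longrightarrow> dist y x < \<eta> \<Longrightarrow> dist (g y) (g x) < e / 2"
      using e unfolding uniformly_continuous_on_def by (metis half_gt_zero)
    have "\<forall>\<^sub>F n in sequentially. \<forall>x\<in>ball z d. dist (f n x) (g x) < e / 2"
      using ul[unfolded uniform_limit_iff, rule_format, of "e / 2"] e by simp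
    moreover have "\<forall>\<^sub>F n in sequentially. norm (\<delta> n) < \<eta>" "\<forall>\<^sub>F n in sequentially. norm (\<delta> n) < d / 4"
      using \<delta>[OF \<eta>(1)] \<delta>[of "d / 4"] d by auto
    ultimately show "\<forall>\<^sub>F n in sequentially. \<forall>u\<in>ball z (d / 4). dist (f n (1 * u + \<delta> n)) (g u) < e"
    proof eventually_elim
      case (elim n)
      show ?case
      proof
        fix u assume u: "u \<in> ball z (d / 4)"
        have ud: "u + \<delta> n \<in> ball z (d / 2)" using sub[OF u elim(3)] .
        have "dist (g (u + \<delta> n)) (g u) < e / 2"
        proof (rule \<eta>(2))
          have "dist z u < d / 4" using u by simp
          then have "dist z u \<le> d / 2" using d by linarith
          then show "u \<in> cball z (d / 2)" by simp
          show "u + \<delta> n \<in> cball z (d / 2)" using ud by simp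
          show "dist (u + \<delta> n) u < \<eta>" using elim(2) by (simp add: dist_norm)
        qed
        moreover have "dist (f n (u + \<delta> n)) (g (u + \<delta> n)) < e / 2"
          using elim(1) ud cb by (meson ball_subset_cball subsetD)
        ultimately show "dist (f n (1 * u + \<delta> n)) (g u) < e"
          using dist_triangle[of "f n (u + \<delta> n)" "g u" "g (u + \<delta> n)"] by simp
      qed
    qed
  qed
  moreover have ev: "\<forall>\<^sub>F n in sequentially. f n holomorphic_on ball z d \<and> norm (\<delta> n) < d / 4"
    using hol \<delta>[of "d / 4"] d by (simp add: eventually_conj_iff)
  have "\<forall>\<^sub>F n in sequentially. (\<lambda>u. f n (1 * u + \<delta> n)) holomorphic_on ball z (d / 4)"
    using ev
  proof eventually_elim
    case (elim n)
    have "(f n \<circ> (\<lambda>u. 1 * u + \<delta> n)) holomorphic_on ball z (d / 4)"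
    proof (rule holomorphic_on_compose_gen[where t = "ball z d"])
      show "(\<lambda>u. 1 * u + \<delta> n) ` ball z (d / 4) \<subseteq> ball z d" using sub[of _ n] elim d by fastforce
    qed (use elim in \<open>auto intro!: holomorphic_intros\<close>)
    then show ?case by (simp add: o_def)
  qed
  ultimately have "(\<lambda>n. (deriv ^^ k) (\<lambda>u. f n (1 * u + \<delta> n)) z) \<longlonglongrightarrow> (deriv ^^ k) g z"
    using d by (intro higher_deriv_complex_uniform_limit[where A = "ball z (d / 4)"]) auto
  then show ?thesis
  proof (rule Lim_transform_eventually)
    show "\<forall>\<^sub>F n in sequentially. (deriv ^^ k) (\<lambda>u. f n (1 * u + \<delta> n)) z = (deriv ^^ k) (f n) (w n)"
      using ev
    proof eventually_elim
      case (elim n)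
      have "(deriv ^^ k) (\<lambda>u. f n (1 * u + \<delta> n)) z = 1 ^ k * (deriv ^^ k) (f n) (1 * z + \<delta> n)"
      proof (rule higher_deriv_compose_linear'[where T = "ball z d" and S = "ball z (d / 4)"])
        show "1 * u + \<delta> n \<in> ball z d" if "u \<in> ball z (d / 4)" for u using sub[OF that] elim d by fastforce
      qed (use elim d in auto)
      then show ?case by (simp add: \<delta>_def)
    qed
  qed
qed

text \<open>A single sequence of \<open>c\<close>-points tending to \<open>z\<close> suffices: along
  it the derivatives of orders 1 to m - 1 are bounded by \<epsilon>, which tends to 0, so those of
  the limit vanish at \<open>z\<close>. Multiplicity is expressed as chordal contact of order
  \<open>m\<close>, a form independent of charts and stable under inversion and composition.\<close>

lemma hurwitz_ramified:
  assumes lim: "sconv H g UNIV" and nc: "\<not> (\<exists>v. \<forall>z. g z = v)" and gz: "g z = Some c"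
    and \<epsilon>: "\<epsilon> \<longlonglongrightarrow> 0"
    and bd: "\<forall>\<^sub>F n in sequentially. \<forall>w\<in>ball z 1. H n w = Some c \<longrightarrow>
       (\<forall>k\<in>{1..<m}. norm ((deriv ^^ k) (\<lambda>w. the (H n w)) w) \<le> \<epsilon> n)"
  shows "\<exists>C. \<forall>\<^sub>F w in nhds z. chordal (g w) (Some c) \<le> C * norm (w - z) ^ m"
proof -
  define \<phi> where "\<phi> = (\<lambda>w. the (g w))"
  obtain d where d: "d > 0"
    and hol: "\<forall>\<^sub>F n in sequentially. (\<lambda>w. the (H n w)) holomorphic_on ball z d \<and> (\<forall>w\<in>ball z d. H n w = Some (the (H n w)))"
    and gsome: "\<forall>w\<in>ball z d. g w = Some (\<phi> w)" and holg: "\<phi> holomorphic_on ball z d"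
    and ul: "uniform_limit (ball z d) (\<lambda>n w. the (H n w)) \<phi> sequentially"
    using sconv_chart_seq[OF lim gz] unfolding \<phi>_def by blast
  have hol': "\<forall>\<^sub>F n in sequentially. (\<lambda>w. the (H n w)) holomorphic_on ball z d" using hol by eventually_elim blast
  have \<phi>z: "\<phi> z = c" using gz by (simp add: \<phi>_def)
  obtain w where w: "w \<longlonglongrightarrow> z" "\<forall>\<^sub>F n in sequentially. H n (w n) = Some c"
    using eventually_selection[of z "\<lambda>n w. H n w = Some c", OF hurwitz_points[OF lim nc gz]] by blast
  have der0: "(deriv ^^ k) \<phi> z = 0" if k: "k \<in> {1..<m}" for k
  proof -
    have l: "(\<lambda>n. norm ((deriv ^^ k) (\<lambda>w. the (H n w)) (w n))) \<longlonglongrightarrow> norm ((deriv ^^ k) \<phi> z)"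
      by (intro tendsto_norm higher_deriv_limit_moving[OF hol' d holg ul w(1)])
    have "\<forall>\<^sub>F n in sequentially. w n \<in> ball z 1"
      using w(1) by (rule topological_tendstoD) auto
    with w(2) bd have "\<forall>\<^sub>F n in sequentially. norm ((deriv ^^ k) (\<lambda>w. the (H n w)) (w n)) \<le> \<epsilon> n"
      by eventually_elim (use k in blast)
    then have "norm ((deriv ^^ k) \<phi> z) \<le> 0"
      by (intro tendsto_le[OF _ \<epsilon> l]) auto
    then show ?thesis by simp
  qed
  have "\<exists>n>0. (deriv ^^ n) \<phi> z \<noteq> 0"
  proof (rule ccontr)
    assume "\<not> (\<exists>n>0. (deriv ^^ n) \<phi> z \<noteq> 0)"
    then have "(deriv ^^ n) \<phi> z = 0" if "n > 0" for n using that by blast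
    then have "\<phi> w = \<phi> z" if "w \<in> ball z d" for w
      using holomorphic_fun_eq_const_on_connected[OF holg open_ball connected_ball, of z w] that d by simp
    then have "\<forall>w\<in>ball z d. g w = Some c" using gsome \<phi>z by auto
    then have "\<forall>\<^sub>F w in at z. g w = Some c"
      using eventually_at_in_open'[of "ball z d" z] d by (auto elim: eventually_mono)
    with sconv_eventually_neq[OF lim nc, of "Some c" z] have "\<forall>\<^sub>F w in at z. False" by eventually_elim simp
    then show False by simp
  qed
  then obtain n where n: "n > 0 \<and> (deriv ^^ n) \<phi> z \<noteq> 0" "\<And>i. i < n \<Longrightarrow> \<not> (i > 0 \<and> (deriv ^^ i) \<phi> z \<noteq> 0)"
    using exists_least_iff[of "\<lambda>n. n > 0 \<and> (deriv ^^ n) \<phi> z \<noteq> 0"] by blast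
  have mn: "m \<le> n"
  proof (rule ccontr)
    assume "\<not> m \<le> n"
    then have "n \<in> {1..<m}" using n by auto
    then show False using der0 n by blast
  qed
  obtain \<psi> r where r: "0 < r" "\<psi> holomorphic_on ball z r" and fac: "\<And>w. w \<in> ball z r \<Longrightarrow> \<phi> w - \<phi> z = (w - z) ^ n * \<psi> w"
  proof (rule holomorphic_factor_order_of_zero[OF holg open_ball, of z n])
    show "(deriv ^^ i) \<phi> z = 0" if "0 < i" "i < n" for i using n(2)[OF that(2)] that(1) by blast
  qed (use n d in auto)
  have "\<psi> analytic_on {z}" using r analytic_at_ball by blast
  from analytic_tendsto(1)[OF this] have "\<forall>\<^sub>F w in nhds z. norm (\<psi> w) < norm (\<psi> z) + 1"
    by (intro order_tendstoD(2)[OF tendsto_norm]) auto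
  \<comment> \<open>The radius is at most 1 so that the exponent \<open>n \<ge> m\<close> may be
    lowered to \<open>m\<close>.\<close>
  moreover have "\<forall>\<^sub>F w in nhds z. w \<in> ball z (min (min r d) 1)"
    using r d by (intro eventually_nhds_in_open) auto
  ultimately have "\<forall>\<^sub>F w in nhds z. chordal (g w) (Some c) \<le> (2 * (norm (\<psi> z) + 1)) * norm (w - z) ^ m"
  proof eventually_elim
    case (elim w)
    have wz: "norm (w - z) \<le> 1" using elim by (simp add: dist_norm norm_minus_commute)
    have "g w = Some (\<phi> w)" using gsome elim by auto
    then have "chordal (g w) (Some c) \<le> 2 * norm (\<phi> w - c)" using chordal_Some_le by simp
    also have "\<phi> w - c = (w - z) ^ n * \<psi> w" using fac[of w] elim \<phi>z by auto
    also have "2 * norm ((w - z) ^ n * \<psi> w) = 2 * (norm (w - z) ^ n * norm (\<psi> w))" by (simp add: norm_mult norm_power)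
    also have "\<dots> \<le> 2 * (norm (w - z) ^ m * (norm (\<psi> z) + 1))"
      using elim wz mn by (intro mult_left_mono mult_mono power_decreasing) auto
    finally show ?case by (simp add: algebra_simps)
  qed
  then show ?thesis by blast
qed

text \<open>Every zero of \<open>g\<close> is simple and also a zero of \<open>f\<close>, so the
  singularities of the quotient are removable. At a zero \<open>deriv f w / deriv g w\<close> is the
  limit of the quotient, which gives one formula on all of \<open>S\<close>.\<close>

lemma holomorphic_quotient_simple_zeros:
  assumes f: "f holomorphic_on S" and g: "g holomorphic_on S" and S: "open S"
    and z: "\<And>w. w \<in> S \<Longrightarrow> g w = 0 \<Longrightarrow> f w = 0 \<and> deriv g w \<noteq> 0"
  obtains q where "q holomorphic_on S" "\<And>w. w \<in> S \<Longrightarrow> f w = q w * g w"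
proof -
  define q where "q = (\<lambda>w. if g w = 0 then deriv f w / deriv g w else f w / g w)"
  have "q analytic_on {x}" if x: "x \<in> S" for x
  proof -
    have fa: "f analytic_on {x}" and ga: "g analytic_on {x}"
      using f g S x holomorphic_on_imp_analytic_at by auto
    show ?thesis
    proof (cases "g x = 0")
      case False
      have ev: "\<forall>\<^sub>F w in nhds x. q w = f w / g w"
        using eventually_nhds_not_nonpos(2)[OF ga False] by eventually_elim (simp add: q_def)
      have "(\<lambda>w. f w / g w) analytic_on {x}" using fa ga False by (intro analytic_intros) auto
      then show ?thesis using analytic_at_cong[OF ev refl] by simp
    next
      case True
      have fx: "f x = 0" and gx: "deriv g x \<noteq> 0" using z[OF x True] by auto
      obtain f1 where f1: "f1 analytic_on {x}" "f1 x = deriv f x" "\<And>w. f w = f x + (w - x) * f1 w"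
        using analytic_divide_diff[OF fa] by metis
      obtain g1 where g1: "g1 analytic_on {x}" "g1 x = deriv g x" "\<And>w. g w = g x + (w - x) * g1 w"
        using analytic_divide_diff[OF ga] by metis
      have g1x: "g1 x \<noteq> 0" using g1 gx by simp
      have ev: "\<forall>\<^sub>F w in nhds x. q w = f1 w / g1 w"
        using eventually_nhds_not_nonpos(2)[OF g1(1) g1x]
      proof eventually_elim
        case (elim w)
        show ?case
        proof (cases "w = x")
          case True
          then show ?thesis using \<open>g x = 0\<close> f1(2) g1(2) by (simp add: q_def)
        next
          case False
          then have "g w = (w - x) * g1 w" "f w = (w - x) * f1 w" "g w \<noteq> 0"
            using f1(3)[of w] g1(3)[of w] True fx elim by auto
          then show ?thesis using False by (simp add: q_def)
        qed
      qed
      have "(\<lambda>w. f1 w / g1 w) analytic_on {x}" using f1 g1 g1x by (intro analytic_intros) auto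
      then show ?thesis using analytic_at_cong[OF ev refl] by simp
    qed
  qed
  then have "q holomorphic_on S" using analytic_imp_holomorphic analytic_on_analytic_at by blast
  moreover have "f w = q w * g w" if "w \<in> S" for w using z[OF that] by (simp add: q_def)
  ultimately show ?thesis using that by blast
qed

text \<open>Near a \<open>b\<close>-point of the limit the quotients \<open>(\<phi>\<^sub>n' - \<epsilon>\<^sub>n) / (\<phi>\<^sub>n - b)\<close> are holomorphic, so the maximum
  principle bounds them uniformly; in the limit \<open>\<bar>\<phi>'\<bar> \<le> M \<bar>\<phi> - b\<bar>\<close>, which is impossible at a zero of \<open>\<phi> - b\<close>.\<close>

lemma hurwitz_omits:
  assumes lim: "sconv H g UNIV" and nc: "\<not> (\<exists>v. \<forall>z. g z = v)"
    and \<epsilon>: "\<epsilon> \<longlonglongrightarrow> 0" "\<And>n. \<epsilon> n \<noteq> 0"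
    and der: "\<forall>\<^sub>F n in sequentially. \<forall>w\<in>ball z 1. H n w = Some b \<longrightarrow> deriv (\<lambda>w. the (H n w)) w = \<epsilon> n"
  shows "g z \<noteq> Some b"
proof
  assume gz: "g z = Some b"
  define \<phi> where "\<phi> = (\<lambda>w. the (g w))"
  define f where "f = (\<lambda>n w. the (H n w))"
  obtain d where d: "d > 0"
    and hol: "\<forall>\<^sub>F n in sequentially. f n holomorphic_on ball z d \<and> (\<forall>w\<in>ball z d. H n w = Some (f n w))"
    and gsome: "\<forall>w\<in>ball z d. g w = Some (\<phi> w)" and holg: "\<phi> holomorphic_on ball z d"
    and ul: "uniform_limit (ball z d) f \<phi> sequentially"
    using sconv_chart_seq[OF lim gz] unfolding \<phi>_def f_def by blast
  have \<phi>z: "\<phi> z = b" using gz by (simp add: \<phi>_def)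
  define h where "h = (\<lambda>w. \<phi> w - b)"
  have h: "h analytic_on {z}" unfolding h_def using holg d by (intro analytic_intros) (auto simp: analytic_at_ball)
  have hz: "h z = 0" by (simp add: h_def \<phi>z)
  have hnz: "\<forall>\<^sub>F w in at z. h w \<noteq> 0"
  proof -
    have "\<forall>\<^sub>F w in at z. w \<in> ball z d" using d by (intro eventually_at_in_open') auto
    with sconv_eventually_neq[OF lim nc, of "Some b" z] show ?thesis
      by eventually_elim (use gsome in \<open>auto simp: h_def\<close>)
  qed
  obtain k r0 \<psi> where k: "0 < (k::nat)" and r0: "0 < r0" and \<psi>: "\<psi> holomorphic_on ball z r0"
    and fac: "\<forall>w\<in>ball z r0. h w = (w - z) ^ k * \<psi> w \<and> \<psi> w \<noteq> 0 \<and>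
       deriv h w = (w - z) ^ (k - 1) * (of_nat k * \<psi> w + (w - z) * deriv \<psi> w)"
    using zero_factorization[OF h hz hnz] by blast
  define R where "R = min (min d r0) 1"
  have R: "R > 0" "ball z R \<subseteq> ball z d" "ball z R \<subseteq> ball z r0" "ball z R \<subseteq> ball z 1" using d r0 by (auto simp: R_def)
  define r where "r = R / 2"
  have r: "r > 0" "cball z r \<subseteq> ball z R" using R(1) by (auto simp: r_def)
  have c\<phi>: "continuous_on (cball z r) \<phi>"
    using holomorphic_on_imp_continuous_on[OF holg] r R continuous_on_subset by blast
  have "\<exists>x\<in>sphere z r. \<forall>y\<in>sphere z r. norm (h x) \<le> norm (h y)"
  proof (rule continuous_attains_inf)
    show "continuous_on (sphere z r) (\<lambda>x. norm (h x))"
      unfolding h_def using continuous_on_subset[OF c\<phi>, of "sphere z r"] by (intro continuous_intros) auto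
  qed (use r in auto)
  then obtain x where x: "x \<in> sphere z r" "\<And>y. y \<in> sphere z r \<Longrightarrow> norm (h x) \<le> norm (h y)" by blast
  define \<mu> where "\<mu> = norm (h x)"
  have "h x \<noteq> 0"
  proof -
    have "x \<in> ball z r0" "x \<noteq> z" using x r R by (auto simp: subset_iff)
    then show ?thesis using fac by simp
  qed
  then have \<mu>: "\<mu> > 0" by (simp add: \<mu>_def)
  \<comment> \<open>Boundary estimates use discs of radius \<open>r / 2\<close> about points of the
    circle of radius \<open>r\<close>; they reach to \<open>3 * r / 2\<close>, still less than
    \<open>R = 2 * r\<close>.\<close>
  define q where "q = 3 * r / 2"
  have q: "q > 0" "cball z q \<subseteq> ball z R" using R(1) by (auto simp: q_def r_def)
  have "continuous_on (cball z q) \<phi>"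
    using holomorphic_on_imp_continuous_on[OF holg] q R continuous_on_subset by blast
  then have "bounded (\<phi> ` cball z q)" by (intro compact_imp_bounded compact_continuous_image) auto
  then obtain M where "\<forall>w\<in>cball z q. norm (\<phi> w) \<le> M" by (auto simp: bounded_iff)
  note M = this[rule_format]
  \<comment> \<open>Cauchy's estimate bounds the derivative on the circle by
    \<open>(M + 1) / (r / 2)\<close>, the summand 1 accounts for \<open>\<epsilon> n\<close>, and
    \<open>\<mu> / 2\<close> is a lower bound for \<open>norm (f n w - b)\<close> there.\<close>
  define M' where "M' = ((M + 1) / (r / 2) + 1) / (\<mu> / 2)"
  have ev1: "\<forall>\<^sub>F n in sequentially. \<forall>w\<in>ball z d. dist (f n w) (\<phi> w) < 1"
    and ev2: "\<forall>\<^sub>F n in sequentially. \<forall>w\<in>ball z d. dist (f n w) (\<phi> w) < \<mu> / 2"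
    using ul \<mu> unfolding uniform_limit_iff by (auto dest: spec[of _ "1::real"] spec[of _ "\<mu> / 2"])
  have ev3: "\<forall>\<^sub>F n in sequentially. norm (\<epsilon> n) < 1"
    using tendsto_norm[OF \<epsilon>(1)] by (intro order_tendstoD(2)) auto
  have key: "\<forall>\<^sub>F n in sequentially. \<forall>w\<in>ball z r. norm (deriv (f n) w - \<epsilon> n) \<le> M' * norm (f n w - b)"
    using hol der ev1 ev2 ev3
  proof eventually_elim
    case (elim n)
    have fR: "f n holomorphic_on ball z R" using elim(1) R holomorphic_on_subset by blast
    \<comment> \<open>Here the prescribed derivative enters: the numerator vanishes wherever the
      denominator does, and \<open>\<epsilon> n \<noteq> 0\<close> makes the zeros of the
      denominator simple.\<close>
    have zz: "deriv (f n) w - \<epsilon> n = 0 \<and> deriv (\<lambda>w. f n w - b) w \<noteq> 0" if w: "w \<in> ball z R" "f n w - b = 0" for w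
    proof -
      have "H n w = Some b" using elim(1) w R by auto
      then have "deriv (f n) w = \<epsilon> n" using elim(2) w(1) R unfolding f_def by blast
      moreover have "deriv (\<lambda>w. f n w - b) w = deriv (f n) w"
        using fR w by (subst deriv_diff) (auto simp: holomorphic_on_imp_differentiable_at)
      ultimately show ?thesis using \<epsilon>(2) by simp
    qed
    have "(\<lambda>w. deriv (f n) w - \<epsilon> n) holomorphic_on ball z R" "(\<lambda>w. f n w - b) holomorphic_on ball z R"
      using fR by (auto intro!: holomorphic_intros)
    from holomorphic_quotient_simple_zeros[OF this open_ball zz]
    obtain Q where Q: "Q holomorphic_on ball z R" "\<And>w. w \<in> ball z R \<Longrightarrow> deriv (f n) w - \<epsilon> n = Q w * (f n w - b)"
      by blast
    have bdry: "norm (Q w) \<le> M'" if w: "w \<in> sphere z r" for w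
    proof -
      have sub: "cball w (r / 2) \<subseteq> cball z q"
      proof
        fix u assume "u \<in> cball w (r / 2)"
        then show "u \<in> cball z q" using w dist_triangle[of z u w] by (simp add: q_def)
      qed
      have "norm ((deriv ^^ 1) (f n) w) \<le> fact 1 * (M + 1) / (r / 2) ^ 1"
      proof (rule Cauchy_higher_deriv_bound[where y = 0])
        show "f n holomorphic_on ball w (r / 2)"
          using fR sub q by (meson ball_subset_cball holomorphic_on_subset subset_trans)
        show "continuous_on (cball w (r / 2)) (f n)"
          using holomorphic_on_imp_continuous_on[OF fR] sub q by (meson continuous_on_subset subset_trans)
        fix u assume "u \<in> ball w (r / 2)"
        then have u: "u \<in> cball z q" using sub by (meson ball_subset_cball subsetD)
        have "dist (f n u) (\<phi> u) < 1" using elim(3) u q R by blast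
        then have "norm (f n u) < norm (\<phi> u) + 1" using norm_triangle_sub[of "f n u" "\<phi> u"] by (simp add: dist_norm)
        then show "f n u \<in> ball 0 (M + 1)" using M[OF u] by simp
      qed (use r in auto)
      then have 1: "norm (deriv (f n) w - \<epsilon> n) \<le> (M + 1) / (r / 2) + 1"
        using norm_triangle_ineq4[of "deriv (f n) w" "\<epsilon> n"] elim(5) by simp
      have wR: "w \<in> ball z R" using w r by auto
      have "\<mu> \<le> norm (h w)" using x(2)[OF w] by (simp add: \<mu>_def)
      moreover have "norm (h w) \<le> norm (f n w - b) + dist (f n w) (\<phi> w)"
        using norm_triangle_ineq4[of "f n w - b" "f n w - \<phi> w"] by (simp add: h_def dist_norm)
      moreover have "dist (f n w) (\<phi> w) < \<mu> / 2" using elim(4) wR R by blast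
      ultimately have 2: "norm (f n w - b) \<ge> \<mu> / 2" by linarith
      have "norm (Q w) * (\<mu> / 2) \<le> norm (Q w) * norm (f n w - b)" using 2 by (intro mult_left_mono) auto
      also have "\<dots> = norm (deriv (f n) w - \<epsilon> n)" using Q(2)[OF wR] by (simp add: norm_mult)
      also note 1
      finally show ?thesis unfolding M'_def using \<mu> by (intro mult_imp_le_div_pos) auto
    qed
    show ?case
    proof
      fix w assume w: "w \<in> ball z r"
      have "norm (Q w) \<le> M'"
      proof (rule maximum_modulus_frontier[of Q "cball z r"])
        show "Q holomorphic_on interior (cball z r)" using Q(1) r by (meson holomorphic_on_subset interior_subset subset_trans)
        show "continuous_on (closure (cball z r)) Q"
          using holomorphic_on_imp_continuous_on[OF Q(1)] r by (simp add: continuous_on_subset)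
      qed (use bdry w in auto)
      then have "norm (Q w) * norm (f n w - b) \<le> M' * norm (f n w - b)" by (intro mult_right_mono) auto
      then show "norm (deriv (f n) w - \<epsilon> n) \<le> M' * norm (f n w - b)"
        using Q(2)[of w] w r by (auto simp: norm_mult subset_iff)
    qed
  qed
  have lim_ineq: "norm (deriv \<phi> w) \<le> M' * norm (h w)" if w: "w \<in> ball z r" for w
  proof -
    have wd: "w \<in> ball z d" using w r R by (auto simp: subset_iff)
    have hol1: "\<forall>\<^sub>F n in sequentially. f n holomorphic_on ball z d" using hol by eventually_elim blast
    have 1: "(\<lambda>n. deriv (f n) w) \<longlonglongrightarrow> deriv \<phi> w"
      using higher_deriv_complex_uniform_limit[OF ul hol1 _ open_ball wd, of 1] by simp
    have 2: "(\<lambda>n. f n w) \<longlonglongrightarrow> \<phi> w" by (rule tendsto_uniform_limitI[OF ul wd])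
    have "norm (deriv \<phi> w - 0) \<le> M' * norm (\<phi> w - b)"
    proof (rule tendsto_le[OF trivial_limit_sequentially])
      show "(\<lambda>n. M' * norm (f n w - b)) \<longlonglongrightarrow> M' * norm (\<phi> w - b)" by (intro tendsto_intros 2)
      show "(\<lambda>n. norm (deriv (f n) w - \<epsilon> n)) \<longlonglongrightarrow> norm (deriv \<phi> w - 0)" by (intro tendsto_intros 1 \<epsilon>)
      show "\<forall>\<^sub>F n in sequentially. norm (deriv (f n) w - \<epsilon> n) \<le> M' * norm (f n w - b)"
        using key by eventually_elim (use w in blast)
    qed
    then show ?thesis by (simp add: h_def)
  qed
  have \<psi>z: "\<psi> analytic_on {z}" using \<psi> r0 analytic_at_ball by blast
  note c\<psi> = analytic_tendsto(2)[OF \<psi>z] and c\<psi>' = analytic_tendsto(2)[OF analytic_deriv[OF \<psi>z]]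
  \<comment> \<open>After division by the power of |w - z| with exponent k - 1, letting
    \<open>w\<close> tend to \<open>z\<close> leaves \<open>k * norm (\<psi> z) \<le> 0\<close>,
    which contradicts \<open>\<psi> z \<noteq> 0\<close>.\<close>
  have "norm (of_nat k * \<psi> z + (z - z) * deriv \<psi> z) \<le> M' * norm (z - z) * norm (\<psi> z)"
  proof (rule tendsto_le[OF at_neq_bot])
    show "((\<lambda>w. norm (of_nat k * \<psi> w + (w - z) * deriv \<psi> w)) \<longlongrightarrow> norm (of_nat k * \<psi> z + (z - z) * deriv \<psi> z)) (at z)"
      by (intro tendsto_intros c\<psi> c\<psi>')
    show "((\<lambda>w. M' * norm (w - z) * norm (\<psi> w)) \<longlongrightarrow> M' * norm (z - z) * norm (\<psi> z)) (at z)"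
      by (intro tendsto_intros c\<psi>)
    have "\<forall>\<^sub>F w in at z. w \<in> ball z r \<and> w \<noteq> z"
      using r(1) eventually_at_in_open[of "ball z r" z] by (auto elim: eventually_mono)
    then show "\<forall>\<^sub>F w in at z. norm (of_nat k * \<psi> w + (w - z) * deriv \<psi> w) \<le> M' * norm (w - z) * norm (\<psi> w)"
    proof eventually_elim
      case (elim w)
      have wr0: "w \<in> ball z r0" "w \<in> ball z d" using elim r R by (auto simp: subset_iff)
      define t where "t = norm (w - z)"
      have t: "t > 0" using elim by (simp add: t_def)
      have "deriv h w = deriv \<phi> w"
        unfolding h_def using holg wr0 by (subst deriv_diff) (auto simp: holomorphic_on_imp_differentiable_at)
      then have "norm (deriv h w) \<le> M' * norm (h w)" using lim_ineq[of w] elim by simp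
      then have "t ^ (k - 1) * norm (of_nat k * \<psi> w + (w - z) * deriv \<psi> w) \<le> M' * (t ^ k * norm (\<psi> w))"
        using fac wr0(1) by (simp add: norm_mult norm_power t_def)
      also have "t ^ k = t ^ (k - 1) * t" using k by (metis Suc_diff_1 power_Suc2)
      finally have "t ^ (k - 1) * norm (of_nat k * \<psi> w + (w - z) * deriv \<psi> w) \<le> t ^ (k - 1) * (M' * t * norm (\<psi> w))"
        by (simp add: mult_ac)
      then show ?case using t unfolding t_def[symmetric] by (subst (asm) mult_le_cancel_left_pos) auto
    qed
  qed
  moreover have "\<psi> z \<noteq> 0" using fac r0 by simp
  ultimately show False using k by (simp add: norm_mult mult_le_0_iff)
qed

section \<open>The normality criterion\<close>

lemma higher_deriv_rescaled:
  fixes a w :: complex and \<rho> :: complex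
  assumes an: "\<psi> analytic_on {a + \<rho> * w}" and ev: "\<forall>\<^sub>F x in nhds (a + \<rho> * w). Q x = Some (\<psi> x)"
  shows "(deriv ^^ k) (\<lambda>u. the (Q (a + \<rho> * u))) w = \<rho> ^ k * (deriv ^^ k) \<psi> (a + \<rho> * w)"
proof -
  define l where "l = (\<lambda>u. \<rho> * u + a)"
  have l: "l w = a + \<rho> * w" by (simp add: l_def)
  obtain e where e: "e > 0" "\<psi> holomorphic_on ball (l w) e" using an l analytic_at_ball by metis
  have cl: "continuous_on UNIV l" and la: "l analytic_on {w}"
    unfolding l_def by (intro continuous_intros analytic_intros)+
  define S where "S = l -` ball (l w) e"
  have S: "open S" "w \<in> S" unfolding S_def using e by (auto intro: open_vimage[OF open_ball cl])
  from eventually_compose_filterlim[OF ev[folded l] analytic_tendsto(1)[OF la]]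
  have "\<forall>\<^sub>F u in nhds w. the (Q (a + \<rho> * u)) = \<psi> (\<rho> * u + a)"
    by eventually_elim (simp add: l_def add.commute)
  then have "(deriv ^^ k) (\<lambda>u. the (Q (a + \<rho> * u))) w = (deriv ^^ k) (\<lambda>u. \<psi> (\<rho> * u + a)) w"
    by (rule higher_deriv_cong_ev) simp
  also have "\<dots> = \<rho> ^ k * (deriv ^^ k) \<psi> (\<rho> * w + a)"
    by (rule higher_deriv_compose_linear'[OF e(2) S(1) open_ball S(2)]) (auto simp: S_def l_def)
  finally show ?thesis by (simp add: add.commute)
qed

lemma chordal_bound_exp:
  fixes c z :: complex
  assumes "\<forall>\<^sub>F w in nhds (c + exp z). chordal (g w) v \<le> C * norm (w - (c + exp z)) ^ m"
  shows "\<exists>C'. \<forall>\<^sub>F w in nhds z. chordal (g (c + exp w)) v \<le> C' * norm (w - z) ^ m"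
proof -
  have "(\<lambda>w. c + exp w) analytic_on {z}" by (intro analytic_intros)
  from eventually_compose_filterlim[OF assms analytic_tendsto(1)[OF this]]
  have 1: "\<forall>\<^sub>F w in nhds z. chordal (g (c + exp w)) v \<le> C * norm (exp w - exp z) ^ m" by simp
  have "((\<lambda>w. (exp w - exp z) / (w - z)) \<longlongrightarrow> exp z) (at z)"
    using DERIV_exp[of z] by (simp add: has_field_derivative_iff)
  then have "\<forall>\<^sub>F w in at z. norm ((exp w - exp z) / (w - z)) < norm (exp z) + 1"
    by (intro order_tendstoD(2)[OF tendsto_norm]) auto
  then have 2: "\<forall>\<^sub>F w in nhds z. w \<noteq> z \<longrightarrow> norm ((exp w - exp z) / (w - z)) < norm (exp z) + 1"
    by (simp add: eventually_at_filter)
  from 1 2 have "\<forall>\<^sub>F w in nhds z. chordal (g (c + exp w)) v \<le> (\<bar>C\<bar> * (norm (exp z) + 1) ^ m) * norm (w - z) ^ m"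
  proof eventually_elim
    case (elim w)
    have "norm (exp w - exp z) \<le> (norm (exp z) + 1) * norm (w - z)"
    proof (cases "w = z")
      case False
      then show ?thesis using elim(2) by (simp add: norm_divide divide_less_eq)
    qed simp
    then have "norm (exp w - exp z) ^ m \<le> ((norm (exp z) + 1) * norm (w - z)) ^ m" by (intro power_mono) auto
    then have "\<bar>C\<bar> * norm (exp w - exp z) ^ m \<le> \<bar>C\<bar> * ((norm (exp z) + 1) * norm (w - z)) ^ m" by (intro mult_left_mono) auto
    moreover have "C * norm (exp w - exp z) ^ m \<le> \<bar>C\<bar> * norm (exp w - exp z) ^ m" by (intro mult_right_mono) auto
    ultimately show ?case using elim(1) by (simp add: power_mult_distrib mult_ac)
  qed
  then show ?thesis by blast
qed

theorem mainTheorem1: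
  fixes F :: "(complex \<Rightarrow> complex) set" and D :: "complex set"
    and A :: "complex option set" and B :: "complex set" and C :: "complex option set"
    and m :: "complex option \<Rightarrow> nat"
  assumes D: "open D" "connected D"
    and mero: "\<And>f. f \<in> F \<Longrightarrow> f nicely_meromorphic_on D"
    and fin: "finite A" "finite B" "finite C"
    and B0: "0 \<notin> B"
    and disj: "A \<inter> Some ` B = {}" "A \<inter> C = {}" "Some ` B \<inter> C = {}"
    and share: "\<And>z. z \<in> D \<Longrightarrow> (\<forall>f\<in>F. ext_val f z \<in> A) \<or> (\<forall>f\<in>F. ext_val f z \<notin> A)"
    and Bcond: "\<And>b f z. b \<in> B \<Longrightarrow> f \<in> F \<Longrightarrow> z \<in> D \<Longrightarrow> ext_val f z = Some b
                 \<Longrightarrow> deriv f z = b"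
    and m2: "\<And>c. c \<in> C \<Longrightarrow> m c \<ge> 2"
    and poles: "None \<in> C \<Longrightarrow> (\<And>f z. f \<in> F \<Longrightarrow> z \<in> D \<Longrightarrow> is_pole f z
                 \<Longrightarrow> - zorder f z \<ge> int (m None))"
    and Ccond: "\<And>c. Some c \<in> C \<Longrightarrow> \<exists>M::real. \<forall>f\<in>F. \<forall>z\<in>D. ext_val f z = Some c \<longrightarrow>
                 (\<forall>k\<in>{1..<m (Some c)}. norm ((deriv ^^ k) f z) \<le> M)"
    and ineq: "real (card A) + real (card B) + (\<Sum>c\<in>C. 1 - 1 / real (m c)) > 2"
  shows "normal_family F D"
proof -
  have shF: "shol (ext_val f) D" if "f \<in> F" for f
    using shol_ext_val(1)[OF mero[OF that] D(1)] by (subst shol_sing) blast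
  have bounded: "\<exists>M. \<forall>f\<in>F. \<forall>z\<in>K. sder (ext_val f) z \<le> M" if K: "compact K" "K \<subseteq> D" for K
  proof (rule ccontr)
    assume "\<not> (\<exists>M. \<forall>f\<in>F. \<forall>z\<in>K. sder (ext_val f) z \<le> M)"
    then have "\<forall>n::nat. \<exists>f z. f \<in> F \<and> z \<in> K \<and> sder (ext_val f) z \<ge> real n" by (meson nle_le)
    then obtain ff x where ff: "\<And>n. ff n \<in> F" "\<And>n. x n \<in> K" "\<And>n. sder (ext_val (ff n)) (x n) \<ge> real n" by metis
    obtain k :: "nat \<Rightarrow> nat" and a :: "nat \<Rightarrow> complex" and \<rho> :: "nat \<Rightarrow> real" and g z0
      where z0: "z0 \<in> D" and a: "a \<longlonglongrightarrow> z0" and \<rho>: "\<rho> \<longlonglongrightarrow> 0" and \<rho>0': "\<And>n. \<rho> n > 0"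
        and sc: "sconv (\<lambda>n \<zeta>. ext_val (ff (k n)) (a n + of_real (\<rho> n) * \<zeta>)) g UNIV" and nc: "\<not> (\<exists>v. \<forall>z. g z = v)"
      by (rule zalcman_rescaling[where Fs = "\<lambda>n. ext_val (ff n)", OF D(1) shF[OF ff(1)] K ff(2,3)]; rule that; assumption)
    have \<rho>0: "\<forall>n. \<rho> n > 0" using \<rho>0' by blast
    define f where "f = (\<lambda>n. ff (k n))"
    define p where "p = (\<lambda>n \<zeta>. a n + of_real (\<rho> n) * \<zeta>)"
    define H where "H = (\<lambda>n \<zeta>. ext_val (f n) (p n \<zeta>))"
    have H: "sconv H g UNIV" using sc by (simp add: H_def f_def p_def)
    have fF: "f n \<in> F" for n using ff(1) by (simp add: f_def)
    \<comment> \<open>Unit discs about \<zeta> are carried into any prescribed neighbourhood of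
      \<open>z0\<close>: this transfers the hypotheses on \<open>D\<close> to the rescaled functions
      and localises the sharing argument at \<open>z0\<close>.\<close>
    have evU: "\<forall>\<^sub>F n in sequentially. \<forall>w\<in>ball \<zeta> 1. p n w \<in> U" if U: "open U" "z0 \<in> U" for U \<zeta>
    proof -
      obtain e where e: "e > 0" "ball z0 e \<subseteq> U" using U open_contains_ball by blast
      have "(\<lambda>n. norm (a n - z0) + \<rho> n * (norm \<zeta> + 1)) \<longlonglongrightarrow> norm (z0 - z0) + 0 * (norm \<zeta> + 1)"
        by (intro tendsto_intros a \<rho>)
      then have "\<forall>\<^sub>F n in sequentially. norm (a n - z0) + \<rho> n * (norm \<zeta> + 1) < e"
        by (rule order_tendstoD) (use e in simp)
      then show ?thesis
      proof eventually_elim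
        case (elim n)
        show ?case
        proof
          fix w assume "w \<in> ball \<zeta> 1"
          then have "norm w \<le> norm \<zeta> + 1" using norm_triangle_sub[of w \<zeta>] by (simp add: dist_norm norm_minus_commute)
          then have "\<rho> n * norm w \<le> \<rho> n * (norm \<zeta> + 1)" using \<rho>0 by (intro mult_left_mono) (auto simp: less_imp_le)
          moreover have "norm (p n w - z0) \<le> norm (a n - z0) + \<rho> n * norm w"
            using norm_triangle_ineq[of "a n - z0" "of_real (\<rho> n) * w"] \<rho>0'[of n] by (simp add: p_def norm_mult algebra_simps)
          ultimately have "dist z0 (p n w) < e" using elim by (simp add: dist_norm norm_minus_commute)
          then show "p n w \<in> U" using e by auto
        qed
      qed
    qed
    have fin_der: "(deriv ^^ j) (\<lambda>u. the (H n u)) w = of_real (\<rho> n) ^ j * (deriv ^^ j) (f n) (p n w)"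
      if "p n w \<in> D" "H n w = Some c" for n w c j
    proof -
      have np: "\<not> is_pole (f n) (p n w)" using that(2) by (auto simp: H_def ext_val_def split: if_splits)
      show ?thesis
        using higher_deriv_rescaled[of "f n" "a n" "of_real (\<rho> n)" w "ext_val (f n)" j]
          shol_ext_val(4,5)[OF mero[OF fF] D(1) that(1) np]
        by (simp add: H_def p_def)
    qed
    have inf_der: "(deriv ^^ j) (\<lambda>u. the (sinv (H n u))) w = of_real (\<rho> n) ^ j * (deriv ^^ j) (\<lambda>x. inverse (f n x)) (p n w)"
      if "p n w \<in> D" "H n w = None" for n w j
    proof -
      have ip: "is_pole (f n) (p n w)" using that(2) by (auto simp: H_def ext_val_def split: if_splits)
      show ?thesis
        using higher_deriv_rescaled[of "\<lambda>x. inverse (f n x)" "a n" "of_real (\<rho> n)" w "\<lambda>x. sinv (ext_val (f n) x)" j]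
          shol_ext_val(2,3)[OF mero[OF fF] D(1) that(1) ip]
        by (simp add: H_def p_def)
    qed
    \<comment> \<open>By the chain rule the derivative at a \<open>b\<close>-point of
      \<open>H n\<close> is exactly \<open>\<rho> n * b\<close>; it tends to 0 and, as
      \<open>0 \<notin> B\<close>, is nonzero.\<close>
    have omitB: "g z \<noteq> Some b" if b: "b \<in> B" for b z
    proof (rule hurwitz_omits[OF H nc, where \<epsilon> = "\<lambda>n. of_real (\<rho> n) * b"])
      have "(\<lambda>n. of_real (\<rho> n) * b) \<longlonglongrightarrow> of_real 0 * b" by (intro tendsto_intros \<rho>)
      then show "(\<lambda>n. of_real (\<rho> n) * b) \<longlonglongrightarrow> 0" by simp
      have "\<rho> n \<noteq> 0" for n using \<rho>0 by (metis less_irrefl)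
      then show "of_real (\<rho> n) * b \<noteq> 0" for n using b B0 by auto
      show "\<forall>\<^sub>F n in sequentially. \<forall>w\<in>ball z 1. H n w = Some b \<longrightarrow> deriv (\<lambda>w. the (H n w)) w = of_real (\<rho> n) * b"
        using evU[OF D(1) z0, of z]
      proof eventually_elim
        case (elim n)
        show ?case
        proof (intro ballI impI)
          fix w assume w: "w \<in> ball z 1" "H n w = Some b"
          have pD: "p n w \<in> D" using elim w by blast
          have "deriv (f n) (p n w) = b" using Bcond[OF b fF pD] w(2) by (simp add: H_def)
          then show "deriv (\<lambda>w. the (H n w)) w = of_real (\<rho> n) * b"
            using fin_der[OF pD w(2), of 1] by simp
        qed
      qed
    qed
    have ramC: "\<exists>K. \<forall>\<^sub>F w in nhds z. chordal (g w) v \<le> K * norm (w - z) ^ m v" if v: "v \<in> C" and gz: "g z = v" for v z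
    proof (cases v)
      case (Some c)
      obtain M where M: "\<And>f z k. f \<in> F \<Longrightarrow> z \<in> D \<Longrightarrow> ext_val f z = Some c \<Longrightarrow> k \<in> {1..<m (Some c)} \<Longrightarrow> norm ((deriv ^^ k) f z) \<le> M"
        using Ccond[of c] v Some by blast
      have "\<exists>K. \<forall>\<^sub>F w in nhds z. chordal (g w) (Some c) \<le> K * norm (w - z) ^ m (Some c)"
      \<comment> \<open>For orders k \<ge> 1 and \<rho> n < 1 the scaling factor \<rho>^k is at most
        \<open>\<rho> n\<close>. The absolute value is taken because \<open>M\<close> may be
        negative if \<open>c\<close> is never attained.\<close>
      proof (rule hurwitz_ramified[OF H nc, where \<epsilon> = "\<lambda>n. \<rho> n * \<bar>M\<bar>"])
        show "g z = Some c" using gz Some by simp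
        have "(\<lambda>n. \<rho> n * \<bar>M\<bar>) \<longlonglongrightarrow> 0 * \<bar>M\<bar>" by (intro tendsto_intros \<rho>)
        then show "(\<lambda>n. \<rho> n * \<bar>M\<bar>) \<longlonglongrightarrow> 0" by simp
        have "\<forall>\<^sub>F n in sequentially. \<rho> n < 1" by (rule order_tendstoD[OF \<rho>]) simp
        with evU[OF D(1) z0, of z] show "\<forall>\<^sub>F n in sequentially. \<forall>w\<in>ball z 1. H n w = Some c \<longrightarrow>
            (\<forall>k\<in>{1..<m (Some c)}. norm ((deriv ^^ k) (\<lambda>w. the (H n w)) w) \<le> \<rho> n * \<bar>M\<bar>)"
        proof eventually_elim
          case (elim n)
          show ?case
          proof (intro ballI impI)
            fix w j assume w: "w \<in> ball z 1" "H n w = Some c" and j: "j \<in> {1..<m (Some c)}"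
            have pD: "p n w \<in> D" using elim w by blast
            have "norm ((deriv ^^ j) (f n) (p n w)) \<le> \<bar>M\<bar>"
              using M[OF fF pD _ j, of n] w(2) by (auto simp: H_def)
            moreover have "\<rho> n ^ j \<le> \<rho> n ^ 1" using \<rho>0 elim(2) j by (intro power_decreasing) (auto simp: less_imp_le)
            ultimately have "\<rho> n ^ j * norm ((deriv ^^ j) (f n) (p n w)) \<le> \<rho> n ^ 1 * \<bar>M\<bar>"
              using \<rho>0 by (intro mult_mono) (auto simp: less_imp_le)
            then show "norm ((deriv ^^ j) (\<lambda>w. the (H n w)) w) \<le> \<rho> n * \<bar>M\<bar>"
              using fin_der[OF pD w(2), of j] \<rho>0 by (simp add: norm_mult norm_power less_imp_le)
          qed
        qed
      qed
      then show ?thesis using Some by simp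
    next
      case None
      have "\<exists>K. \<forall>\<^sub>F w in nhds z. chordal (sinv (g w)) (Some 0) \<le> K * norm (w - z) ^ m None"
      proof (rule hurwitz_ramified[OF sconv_sinv[OF H], where \<epsilon> = "\<lambda>n. 0"])
        show "\<not> (\<exists>v. \<forall>z. sinv (g z) = v)" using nc by (auto simp: sinv_eq_iff)
        show "sinv (g z) = Some 0" using gz None by simp
        show "\<forall>\<^sub>F n in sequentially. \<forall>w\<in>ball z 1. sinv (H n w) = Some 0 \<longrightarrow>
            (\<forall>k\<in>{1..<m None}. norm ((deriv ^^ k) (\<lambda>w. the (sinv (H n w))) w) \<le> 0)"
          using evU[OF D(1) z0, of z]
        proof eventually_elim
          case (elim n)
          show ?case
          proof (intro ballI impI)
            fix w j assume w: "w \<in> ball z 1" "sinv (H n w) = Some 0" and j: "j \<in> {1..<m None}"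
            have pD: "p n w \<in> D" using elim w by blast
            have HN: "H n w = None" using w(2) by (simp add: sinv_eq_iff)
            then have ip: "is_pole (f n) (p n w)" by (auto simp: H_def ext_val_def split: if_splits)
            have ord: "- zorder (f n) (p n w) \<ge> int (m None)" using poles[OF _ fF pD ip] v None by simp
            have "(deriv ^^ j) (\<lambda>x. inverse (f n x)) (p n w) = 0"
              by (rule higher_deriv_inverse_pole[OF mero[OF fF] D(1) pD ip ord]) (use j in simp)
            then show "norm ((deriv ^^ j) (\<lambda>w. the (sinv (H n w))) w) \<le> 0"
              using inf_der[OF pD HN, of j] by simp
          qed
        qed
      qed simp
      moreover have "chordal (sinv x) (Some 0) = chordal x None" for x
        using chordal_sinv[of x None] by (simp only: sinv.simps)
      ultimately show ?thesis using None by simp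
    qed
    have uniqueA: "z1 = z2" if z1: "g z1 \<in> A" and z2: "g z2 \<in> A" for z1 z2
    proof (rule ccontr)
      assume "z1 \<noteq> z2"
      define e where "e = min 1 (dist z1 z2 / 2)"
      have e: "e > 0" "e \<le> 1" using \<open>z1 \<noteq> z2\<close> by (auto simp: e_def)
      have disjoint: "w1 \<noteq> w2" if "w1 \<in> ball z1 e" "w2 \<in> ball z2 e" for w1 w2
      proof
        assume "w1 = w2"
        then have "dist z1 z2 < e + e" using that dist_triangle[of z1 z2 w1] by (simp add: dist_commute)
        then show False by (simp add: e_def)
      qed
      \<comment> \<open>The member \<open>f 0\<close> is fixed while \<open>n\<close> varies. As
        \<rho> n > 0, two distinct points have distinct images under \<open>p n\<close>, so at least
        one image differs from \<open>z0\<close>; sharing makes it an \<open>A\<close>-point of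
        \<open>f 0\<close>.\<close>
      have fr: "\<exists>\<^sub>F x in at z0. \<exists>v\<in>A. ext_val (f 0) x = v"
      proof (rule ccontr)
        assume "\<not> (\<exists>\<^sub>F x in at z0. \<exists>v\<in>A. ext_val (f 0) x = v)"
        then have "\<forall>\<^sub>F x in at z0. ext_val (f 0) x \<notin> A" by (simp add: frequently_def)
        then obtain U where U: "open U" "z0 \<in> U" "\<And>x. x \<in> U \<Longrightarrow> x \<noteq> z0 \<Longrightarrow> ext_val (f 0) x \<notin> A"
          by (auto simp: eventually_at_topological)
        have "open (U \<inter> D)" "z0 \<in> U \<inter> D" using U D z0 by auto
        note ev = evU[OF this]
        have "\<forall>\<^sub>F n in sequentially. False"
          using ev[of z1] ev[of z2] hurwitz_points[OF H nc refl e(1), of z1] hurwitz_points[OF H nc refl e(1), of z2]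
        proof eventually_elim
          case (elim n)
          obtain w1 w2 where w: "w1 \<in> ball z1 e" "H n w1 = g z1" "w2 \<in> ball z2 e" "H n w2 = g z2"
            using elim(3,4) by blast
          have p: "p n w1 \<in> U \<inter> D" "p n w2 \<in> U \<inter> D" using elim(1,2) w e by auto
          have "p n w1 \<noteq> p n w2" using disjoint[OF w(1,3)] \<rho>0 by (auto simp: p_def less_irrefl dest: spec[of _ n])
          then obtain w where w': "p n w \<noteq> z0" "p n w \<in> U \<inter> D" "H n w \<in> A" using p w z1 z2 by metis
          then have "ext_val (f 0) (p n w) \<in> A" using share[of "p n w"] fF by (auto simp: H_def)
          then show False using U(3) w' by blast
        qed
        then show False by simp
      qed
      \<comment> \<open>\<open>A\<close> is finite, so one value \<open>v\<close> recurs near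
        \<open>z0\<close>; the identity theorem makes \<open>f 0\<close> equal to \<open>v\<close>
        near \<open>z0\<close>, and sharing puts the values of all members there into
        \<open>A\<close>.\<close>
      obtain v where v: "v \<in> A" "\<exists>\<^sub>F x in at z0. ext_val (f 0) x = v"
        using frequently_bex_finite[OF fin(1) fr] by blast
      have "\<forall>\<^sub>F x in nhds z0. ext_val (f 0) x = v"
        using shol_frequently_eq[OF _ v(2)] shF[OF fF] z0 by (auto intro: shol_subset)
      moreover have "\<forall>\<^sub>F x in nhds z0. x \<in> D" using D z0 by (intro eventually_nhds_in_open)
      ultimately have "\<forall>\<^sub>F x in nhds z0. \<forall>f\<in>F. ext_val f x \<in> A"
        by eventually_elim (use share fF v(1) in blast)
      then obtain U where U: "open U" "z0 \<in> U" "\<And>x f. x \<in> U \<Longrightarrow> f \<in> F \<Longrightarrow> ext_val f x \<in> A"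
        unfolding eventually_nhds by blast
      \<comment> \<open>\<open>H n \<zeta>\<close> lies in the finite set \<open>A\<close> for large
        \<open>n\<close>, hence so does its limit \<open>g \<zeta>\<close>; a nonconstant
        \<open>g\<close> cannot take its values in a finite set.\<close>
      have gA: "\<exists>v\<in>A. g \<zeta> = v" for \<zeta>
      proof -
        have "\<forall>\<^sub>F n in sequentially. \<exists>v\<in>A. H n \<zeta> = v"
          using evU[OF U(1,2), of \<zeta>] by eventually_elim (use U(3) fF in \<open>auto simp: H_def\<close>)
        then have "\<exists>\<^sub>F n in sequentially. \<exists>v\<in>A. H n \<zeta> = v" by (rule eventually_frequently[rotated]) simp
        then obtain v where v: "v \<in> A" "\<exists>\<^sub>F n in sequentially. H n \<zeta> = v" using frequently_bex_finite[OF fin(1), of "\<lambda>n v. H n \<zeta> = v"] by blast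
        have "chordal v (g \<zeta>) < e" if "e > 0" for e
        proof -
          have "\<exists>N. \<forall>n\<ge>N. \<forall>z\<in>{\<zeta>}. chordal (H n z) (g z) < e"
            using H that unfolding sconv_def by (meson compact_sing subset_UNIV)
          then have "\<forall>\<^sub>F n in sequentially. chordal (H n \<zeta>) (g \<zeta>) < e" by (auto simp: eventually_sequentially)
          from frequently_ex[OF frequently_eventually_conj[OF v(2) this]] show ?thesis by auto
        qed
        then have "chordal v (g \<zeta>) \<le> 0" by (metis less_irrefl not_le)
        then have "chordal v (g \<zeta>) = 0" using chordal_nonneg[of v "g \<zeta>"] by linarith
        then show ?thesis using v(1) by auto
      qed
      have "\<forall>\<^sub>F w in at 0. \<exists>v\<in>A. g w = v" by (intro always_eventually allI gA)
      then have "\<exists>\<^sub>F w in at 0. \<exists>v\<in>A. g w = v" by (rule eventually_frequently[rotated]) simp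
      then obtain u where "\<exists>\<^sub>F w in at 0. g w = u" using frequently_bex_finite[OF fin(1), of "\<lambda>w v. g w = v"] by blast
      then show False using sconv_eventually_neq[OF H nc, of u 0] by (simp add: frequently_def)
    qed
    \<comment> \<open>If \<open>g\<close> has no \<open>A\<close>-point, any \<zeta>0
      serves.\<close>
    obtain \<zeta>0 where \<zeta>0: "\<And>z. g z \<in> A \<Longrightarrow> z = \<zeta>0" using uniqueA by metis
    define E where "E = (\<lambda>w. g (\<zeta>0 + exp w))"
    define S where "S = A \<union> Some ` B \<union> C"
    have S: "finite S" using fin by (simp add: S_def)
    define tot where "tot = real (card A) + real (card B) + (\<Sum>c\<in>C. 1 - 1 / real (m c))"
    \<comment> \<open>At most half of the excess over 2 is spent on all of \<open>S\<close>; the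
      added 1 avoids division by zero. The bound 1/4 keeps the weights positive, since 1 - 1 / m is
      at least 1/2.\<close>
    define \<eta> where "\<eta> = min (1 / 4) ((tot - 2) / (2 * (real (card S) + 1)))"
    have \<eta>: "\<eta> > 0" "\<eta> \<le> 1 / 4" 
      unfolding \<eta>_def using ineq[folded tot_def] by (simp_all only: min_less_iff_conj min.cobounded1) simp
    have \<eta>S: "\<eta> * real (card S) < tot - 2"
    proof -
      have "\<eta> * (2 * (real (card S) + 1)) \<le> tot - 2"
      proof -
        have "\<eta> \<le> (tot - 2) / (2 * (real (card S) + 1))" by (simp only: \<eta>_def min.cobounded2)
        then show ?thesis by (subst (asm) pos_le_divide_eq) auto
      qed
      moreover have "\<eta> * (2 * (real (card S) + 1)) = 2 * (\<eta> * real (card S)) + 2 * \<eta>" by (simp add: algebra_simps)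
      moreover have "\<eta> * real (card S) \<ge> 0" using \<eta>(1) by simp
      ultimately show ?thesis using \<eta>(1) by linarith
    qed
    \<comment> \<open>Outside \<open>C\<close> the weight is that of an omitted value:
      \<open>E\<close> misses \<open>B\<close> because \<open>g\<close> does, and \<open>A\<close>
      because \<open>exp\<close> never vanishes.\<close>
    define \<alpha> where "\<alpha> = (\<lambda>v. (if v \<in> C then 1 - 1 / real (m v) else 1) - \<eta>)"
    have half: "1 / real (m v) \<le> 1 / 2" "1 / real (m v) > 0" if "v \<in> C" for v
      using m2[OF that] by (auto simp: field_simps)
    have "\<exists>v. \<forall>z. E z = v"
    proof (rule picard_ramified[OF _ S, of E \<alpha>])
      have "shol E {z}" for z
        unfolding E_def
      proof (rule shol_compose(1))
        show "(\<lambda>w. \<zeta>0 + exp w) analytic_on {z}" by (intro analytic_intros)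
        show "shol g {\<zeta>0 + exp z}" using sconv_shol[OF open_UNIV H] by (rule shol_subset) simp
      qed
      then show "shol E UNIV" by (subst shol_sing) blast
      show "0 < \<alpha> v" "\<alpha> v < 1" if "v \<in> S" for v
      proof -
        have "1 / 2 \<le> \<alpha> v + \<eta>" "\<alpha> v + \<eta> \<le> 1"
          using half[of v] unfolding \<alpha>_def by (cases "v \<in> C"; simp)+
        then show "0 < \<alpha> v" "\<alpha> v < 1" using \<eta> by linarith+
      qed
      have "(\<Sum>v\<in>S. \<alpha> v) = (\<Sum>v\<in>S. if v \<in> C then 1 - 1 / real (m v) else 1) - \<eta> * real (card S)"
        by (simp add: \<alpha>_def sum_subtractf)
      also have "(\<Sum>v\<in>S. if v \<in> C then 1 - 1 / real (m v) else 1) = tot"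
      proof -
        have "(\<Sum>v\<in>S. if v \<in> C then 1 - 1 / real (m v) else 1)
            = (\<Sum>v\<in>A \<union> Some ` B. if v \<in> C then 1 - 1 / real (m v) else 1) + (\<Sum>v\<in>C. if v \<in> C then 1 - 1 / real (m v) else 1)"
          unfolding S_def using fin disj by (intro sum.union_disjoint) auto
        also have "(\<Sum>v\<in>A \<union> Some ` B. if v \<in> C then 1 - 1 / real (m v) else 1) = (\<Sum>v\<in>A \<union> Some ` B. 1)"
          using disj by (intro sum.cong) auto
        also have "\<dots> = real (card A) + real (card B)"
          using fin disj by (simp add: card_Un_disjoint card_image)
        finally show ?thesis by (simp add: tot_def)
      qed
      finally show "(\<Sum>v\<in>S. \<alpha> v) > 2" using \<eta>S by linarith
      fix v z assume v: "v \<in> S" and Ez: "E z = v"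
      have "v \<notin> A" using \<zeta>0[of "\<zeta>0 + exp z"] Ez by (auto simp: E_def)
      moreover have "v \<notin> Some ` B" using omitB Ez by (auto simp: E_def)
      ultimately have vC: "v \<in> C" using v by (auto simp: S_def)
      \<comment> \<open>The margin \<eta> makes the ramification condition strict; for the weight 1
        - 1 / m the product would be exactly 1.\<close>
      have "real (m v) * (1 - \<alpha> v) = 1 + real (m v) * \<eta>"
        using vC half(2)[OF vC] by (simp add: \<alpha>_def algebra_simps)
      moreover have "real (m v) * \<eta> > 0" using m2[OF vC] \<eta>(1) by (intro mult_pos_pos) auto
      ultimately have "real (m v) * (1 - \<alpha> v) > 1" by linarith
      moreover obtain K where "\<forall>\<^sub>F w in nhds (\<zeta>0 + exp z). chordal (g w) v \<le> K * norm (w - (\<zeta>0 + exp z)) ^ m v"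
        using ramC[OF vC, of "\<zeta>0 + exp z"] Ez by (auto simp: E_def)
      ultimately show "\<exists>m C. real m * (1 - \<alpha> v) > 1 \<and> (\<forall>\<^sub>F w in nhds z. chordal (E w) v \<le> C * norm (w - z) ^ m)"
        unfolding E_def using chordal_bound_exp by blast
    qed
    then obtain v where v: "\<And>z. E z = v" by blast
    \<comment> \<open>\<open>exp\<close> covers the plane except 0, so \<open>g\<close> is constant
      off \<zeta>0.\<close>
    have "g w = v" if "w \<noteq> \<zeta>0" for w
      using v[of "Ln (w - \<zeta>0)"] that by (simp add: E_def)
    then have "\<forall>\<^sub>F w in at \<zeta>0. g w = v" by (auto simp: eventually_at_filter)
    with sconv_eventually_neq[OF H nc, of v \<zeta>0] have "\<forall>\<^sub>F w in at \<zeta>0. False" by eventually_elim simp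
    then show False by simp
  qed
  show ?thesis
    unfolding normal_family_def
  proof (intro allI impI)
    fix fs :: "nat \<Rightarrow> complex \<Rightarrow> complex" assume fs: "\<forall>n. fs n \<in> F"
    have "\<exists>N M. \<forall>n\<ge>N. shol (ext_val (fs n)) K \<and> (\<forall>z\<in>K. sder (ext_val (fs n)) z \<le> M)" if K: "compact K" "K \<subseteq> D" for K
    proof -
      obtain M where "\<forall>f\<in>F. \<forall>z\<in>K. sder (ext_val f) z \<le> M" using bounded[OF K] by blast
      then show ?thesis
        using fs by (intro exI[of _ 0] exI[of _ M] allI impI conjI shol_subset[OF shF K(2)]) auto
    qed
    from sder_bounded_imp_convergent_subsequence[OF D(1) this]
    obtain r g where r: "strict_mono (r :: nat \<Rightarrow> nat)"
      and g: "\<And>K e. compact K \<Longrightarrow> K \<subseteq> D \<Longrightarrow> e > 0 \<Longrightarrow> \<exists>N. \<forall>n\<ge>N. \<forall>z\<in>K. chordal (ext_val (fs (r n)) z) (g z) < e"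
      by metis
    show "\<exists>(r :: nat \<Rightarrow> nat) g. strict_mono r \<and> (\<forall>K. compact K \<and> K \<subseteq> D \<longrightarrow>
        (\<forall>e>0. \<exists>N. \<forall>n\<ge>N. \<forall>z\<in>K. chordal (ext_val (fs (r n)) z) (g z) < e))"
    proof (rule exI[of _ r], rule exI[of _ g], intro conjI allI impI)
      fix K and e :: real assume "compact K \<and> K \<subseteq> D" "e > 0"
      then show "\<exists>N. \<forall>n\<ge>N. \<forall>z\<in>K. chordal (ext_val (fs (r n)) z) (g z) < e" using g by blast
    qed (rule r)
  qed
qed

end
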